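(* Let $B=1$ and let $p$ be a sufficiently large prime. Then there exist a real constant $E$ and real numbers $c_0,k_5$, not both zero, such that, with $(c_n)_{n\ge 0}$ and $(k_n)_{n\ge 1}$ the real sequences determined from $c_0,k_5,B,E$ by the recursion given in the context, the function $$\psi_0(x)=\sum_{n=0}^{\infty}c_nf_n(x)+\sum_{n=1}^{\infty}k_ng_{-n}(x)=\begin{cases}\sum_{n=0}^{\infty}c_n|x|_p^n & \text{if }x\in\mathbb{Z}_p,\\ \sum_{n=1}^{\infty}k_n|x|_p^{-n}&\text{if }x\in\mathbb{Q}_p\setminus\mathbb{Z}_p,\end{cases}$$ (with both series convergent in $\mathbb{R}$ for every such $x$) is a solution on $\mathbb{Q}_p$ of the equation $$D^2\Psi(x)+B|x|_p^2\,\Psi(x)=E\,\Psi(x).$$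
   Context: $|\cdot|_p$ is the $p$-adic norm on $\mathbb{Q}_p$ (with $|p|_p=1/p$), and $dy$ is the Haar measure on $(\mathbb{Q}_p,+)$ normalized by $\int_{\mathbb{Z}_p}dy=1$. For a real number $x\neq 0$, $\Gamma_p(x)=\frac{1-p^{x-1}}{1-p^{-x}}$. For $\alpha>0$ and a complex-valued function $f$ on $\mathbb{Q}_p$, $$D^\alpha f(x)=\frac{1}{\Gamma_p(-\alpha)}\int_{\mathbb{Q}_p}\frac{f(y)-f(x)}{|x-y|_p^{\alpha+1}}\,dy .$$ For an integer $n$, $f_n(x)=|x|_p^n$ if $x\in\mathbb{Z}_p$ and $f_n(x)=0$ otherwise; $g_n(x)=0$ if $x\in\mathbb{Z}_p$ and $g_n(x)=|x|_p^n$ otherwise (with $f_0=1$ on all of $\mathbb{Z}_p$). Recursion: given $B\ne0$, $E$, $c_0$, $k_5$, set $c_2=0$, $c_{2n+1}=0$ for all $n\ge 0$, and $$c_{2n+4}\frac{\Gamma_p(2n+5)}{\Gamma_p(2n+3)}+Bc_{2n}=Ec_{2n+2}\quad(n\ge 0);$$ set $k_1=k_3=0$, $k_{2n}=0$ for all $n\ge 1$, and $$k_{2n+1}\frac{\Gamma_p(-2n)}{\Gamma_p(-2n-2)}+Bk_{2n+5}=Ek_{2n+3}\quad(n\ge 1).$$ *)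

theory Defs
  imports "HOL-Analysis.Analysis" "HOL-Computational_Algebra.Primes"
begin

text \<open>
  The prime \<open>p\<close> is a term-level parameter (the theorem quantifies over it), so the \<open>p\<close>-adic numbers
  are a carrier set: the completion of the rationals for the \<open>p\<close>-adic absolute value, i.e. Cauchy
  sequences of rationals modulo sequences tending to zero. Only the additive group, the absolute
  value and the topology of this completion are needed.
\<close>

definition rat_padic_norm :: "nat \<Rightarrow> rat \<Rightarrow> real" where
  "rat_padic_norm p q =
     (if q = 0 then 0
      else real p powi (int (multiplicity (int p) (snd (quotient_of q)))
                        - int (multiplicity (int p) (fst (quotient_of q)))))"

definition padic_Cauchy :: "nat \<Rightarrow> (nat \<Rightarrow> rat) set" where
  "padic_Cauchy p = {X. Metric_space.MCauchy UNIV (\<lambda>a b. rat_padic_norm p (a - b)) X}"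

definition padic_rel :: "nat \<Rightarrow> ((nat \<Rightarrow> rat) \<times> (nat \<Rightarrow> rat)) set" where
  "padic_rel p = {(X, Y). X \<in> padic_Cauchy p \<and> Y \<in> padic_Cauchy p \<and>
                    (\<lambda>n. rat_padic_norm p (X n - Y n)) \<longlonglongrightarrow> 0}"

type_synonym padic = "(nat \<Rightarrow> rat) set"

definition Qp :: "nat \<Rightarrow> padic set" where
  "Qp p = padic_Cauchy p // padic_rel p"

definition padic_add :: "nat \<Rightarrow> padic \<Rightarrow> padic \<Rightarrow> padic" where
  "padic_add p x y = (\<Union>X\<in>x. \<Union>Y\<in>y. padic_rel p `` {\<lambda>n. X n + Y n})"

definition padic_diff :: "nat \<Rightarrow> padic \<Rightarrow> padic \<Rightarrow> padic" where
  "padic_diff p x y = (\<Union>X\<in>x. \<Union>Y\<in>y. padic_rel p `` {\<lambda>n. X n - Y n})"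

text \<open>All representatives of a class have the same limit of absolute values.\<close>

definition padic_norm :: "nat \<Rightarrow> padic \<Rightarrow> real" where
  "padic_norm p x = (THE r. \<forall>X\<in>x. (\<lambda>n. rat_padic_norm p (X n)) \<longlonglongrightarrow> r)"

definition Zp :: "nat \<Rightarrow> padic set" where
  "Zp p = {x \<in> Qp p. padic_norm p x \<le> 1}"

text \<open>
  The locale \<open>Metric_space\<close> demands nonnegativity and symmetry also off the carrier; hence the guard.
\<close>

definition padic_dist :: "nat \<Rightarrow> padic \<Rightarrow> padic \<Rightarrow> real" where
  "padic_dist p x y = (if x \<in> Qp p \<and> y \<in> Qp p then padic_norm p (padic_diff p x y) else 0)"

definition padic_topology :: "nat \<Rightarrow> padic topology" where
  "padic_topology p = Metric_space.mtopology (Qp p) (padic_dist p)"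

definition padic_borel :: "nat \<Rightarrow> padic measure" where
  "padic_borel p = sigma (Qp p) {U. openin (padic_topology p) U}"

definition is_normalized_haar :: "nat \<Rightarrow> padic measure \<Rightarrow> bool" where
  "is_normalized_haar p M \<longleftrightarrow>
     space M = Qp p \<and> sets M = sets (padic_borel p) \<and>
     (\<forall>a\<in>Qp p. \<forall>A\<in>sets M. emeasure M (padic_add p a ` A) = emeasure M A) \<and>
     emeasure M (Zp p) = 1"

text \<open>For prime \<open>p\<close> exactly one measure has these properties, so the choice is immaterial.\<close>

definition padic_haar :: "nat \<Rightarrow> padic measure" where
  "padic_haar p = (SOME M. is_normalized_haar p M)"

text \<open>Meant for \<open>x \<noteq> 0\<close>; it is never used at \<open>0\<close>.\<close>

definition Gamma_p :: "nat \<Rightarrow> real \<Rightarrow> real" where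
  "Gamma_p p x = (1 - real p powr (x - 1)) / (1 - real p powr (- x))"

text \<open>At the single point \<open>y = x\<close>, a null set, the integrand is \<open>0 / 0 = 0\<close>.\<close>

definition D_integrand :: "nat \<Rightarrow> real \<Rightarrow> (padic \<Rightarrow> complex) \<Rightarrow> padic \<Rightarrow> padic \<Rightarrow> complex" where
  "D_integrand p \<alpha> f x y =
     (f y - f x) / complex_of_real (padic_norm p (padic_diff p x y) powr (\<alpha> + 1))"

definition D_padic :: "nat \<Rightarrow> real \<Rightarrow> (padic \<Rightarrow> complex) \<Rightarrow> padic \<Rightarrow> complex" where
  "D_padic p \<alpha> f x =
     1 / complex_of_real (Gamma_p p (- \<alpha>)) * (\<integral>y. D_integrand p \<alpha> f x y \<partial>padic_haar p)"

text \<open>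
  The Bochner integral is \<open>0\<close> for non-integrable functions, so that the left-hand side is
  meaningful has to be part of being a solution.
\<close>

definition is_solution :: "nat \<Rightarrow> real \<Rightarrow> real \<Rightarrow> (padic \<Rightarrow> complex) \<Rightarrow> bool" where
  "is_solution p B E \<psi> \<longleftrightarrow>
     (\<forall>x\<in>Qp p. integrable (padic_haar p) (D_integrand p 2 \<psi> x) \<and>
        D_padic p 2 \<psi> x + complex_of_real (B * (padic_norm p x)\<^sup>2) * \<psi> x
          = complex_of_real E * \<psi> x)"

definition f_fun :: "nat \<Rightarrow> int \<Rightarrow> padic \<Rightarrow> real" where
  "f_fun p n x = (if x \<in> Zp p then padic_norm p x powi n else 0)"

definition g_fun :: "nat \<Rightarrow> int \<Rightarrow> padic \<Rightarrow> real" where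
  "g_fun p n x = (if x \<in> Zp p then 0 else padic_norm p x powi n)"

definition c_recursion :: "nat \<Rightarrow> real \<Rightarrow> real \<Rightarrow> real \<Rightarrow> (nat \<Rightarrow> real) \<Rightarrow> bool" where
  "c_recursion p B E c0 c \<longleftrightarrow>
     c 0 = c0 \<and> c 2 = 0 \<and> (\<forall>n. c (2 * n + 1) = 0) \<and>
     (\<forall>n. c (2 * n + 4) * (Gamma_p p (2 * real n + 5) / Gamma_p p (2 * real n + 3)) + B * c (2 * n)
            = E * c (2 * n + 2))"

text \<open>The sequence \<open>k\<close> is indexed from \<open>1\<close>; the value \<open>k 0\<close> is unconstrained and unused.\<close>

definition k_recursion :: "nat \<Rightarrow> real \<Rightarrow> real \<Rightarrow> real \<Rightarrow> (nat \<Rightarrow> real) \<Rightarrow> bool" where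
  "k_recursion p B E k5 k \<longleftrightarrow>
     k 5 = k5 \<and> k 1 = 0 \<and> k 3 = 0 \<and> (\<forall>n\<ge>1. k (2 * n) = 0) \<and>
     (\<forall>n\<ge>1. k (2 * n + 1) * (Gamma_p p (- 2 * real n) / Gamma_p p (- 2 * real n - 2))
              + B * k (2 * n + 5)
            = E * k (2 * n + 3))"

definition psi0 :: "nat \<Rightarrow> (nat \<Rightarrow> real) \<Rightarrow> (nat \<Rightarrow> real) \<Rightarrow> padic \<Rightarrow> real" where
  "psi0 p c k x = (\<Sum>n. c n * f_fun p (int n) x) + (\<Sum>n. k (Suc n) * g_fun p (- int (Suc n)) x)"

end

theory Submission
  imports Defs
begin

text \<open>
  Everything in the equation depends only on \<open>|x|\<close>. For a radial function with value \<open>u z\<close> at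
  \<open>|x| = z\<close>, the ultrametric inequality turns \<open>|x - y|\<close> into the larger of \<open>|x|\<close> and \<open>|y|\<close>
  wherever the numerator of the integrand is nonzero, so the integral defining \<open>D\<^sup>2\<close> is a sum over
  spheres. With \<open>w = p\<close> and \<open>g = (1 - 1/w) / \<Gamma>\<^sub>p(-2)\<close> it reads, for \<open>|x| = z > 0\<close>,
  \<open>g ((T - u z * z/(w-1)) / z^3 + R - u z / (z^2 (w^2-1)))\<close>, where \<open>T\<close> sums \<open>v * u v\<close> over the
  smaller absolute values \<open>v\<close> and \<open>R\<close> sums \<open>u v / v^2\<close> over the larger ones.

  For a power series in \<open>z\<close> below 1 and in \<open>1/z\<close> above 1 both sums telescope to explicit series.
  Substituting them, the powers of \<open>z\<close> match exactly when the coefficients satisfy the two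
  recursions, except for one constant term on \<open>\<int>\<^sub>p\<close> and one term \<open>|x|^(-3)\<close> outside. These two
  exceptions are two homogeneous linear conditions on the two free coefficients, and a nontrivial
  solution exists if and only if a determinant, a function of \<open>E\<close>, vanishes. For large \<open>p\<close> the
  determinant is close to \<open>2 - E\<close>: the constants 1 coming from the two leading terms of
  the inner series add up to 2 and everything else is of order \<open>1/p\<close>. The intermediate value theorem on
  \<open>[1, 3]\<close> gives \<open>E\<close> (lemma \<open>ex_matching_zero\<close>).

  To evaluate the integral at all one needs a Haar measure. It is the image of Lebesgue measure on
  \<open>[0, \<infinity>)\<close> under reversal of the base \<open>p\<close> digits, which maps \<open>\<Sum> d\<^sub>i p^(-i-1)\<close> to
  \<open>\<Sum> d\<^sub>i p^i\<close>: agreement of leading digits of real numbers becomes \<open>p\<close>-adic closeness, so the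
  preimage of a ball is an interval whose length is the radius (lemma \<open>haar0_is_normalized_haar\<close>).
  The measure of a ball under an arbitrary normalized Haar measure is then obtained
  from translation invariance alone.
\<close>

section \<open>The absolute value on the rationals\<close>

locale p_adic =
  fixes p :: nat
  assumes prime_p: "prime p"
begin

abbreviation pr :: rat where "pr \<equiv> of_nat p"
abbreviation w :: real where "w \<equiv> real p"
abbreviation N :: "rat \<Rightarrow> real" where "N \<equiv> rat_padic_norm p"

lemma p_gt_1: "p > 1" and p_pos: "p > 0"
  using prime_gt_1_nat[OF prime_p] by auto

lemma prime_int_p: "prime (int p)"
  using prime_p by simp

lemma w_gt_1: "w > 1"
  using p_gt_1 by auto

lemma p_nz [simp]: "p \<noteq> 0" "0 < p"
  using p_pos by auto

lemma w_powi_pos [simp]: "w powi n > 0"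
  using p_pos by simp

lemma w_powi_less_iff [simp]: "w powi m < w powi n \<longleftrightarrow> m < n"
proof (cases m n rule: linorder_cases)
  case less
  then show ?thesis using power_int_strict_increasing[OF less w_gt_1] by blast
next
  case greater
  then have "w powi n < w powi m" using power_int_strict_increasing[OF greater w_gt_1] by blast
  then show ?thesis using greater by linarith
qed simp

lemma w_powi_le_iff [simp]: "w powi m \<le> w powi n \<longleftrightarrow> m \<le> n"
  using w_powi_less_iff[of n m] by linarith

lemma w_powi_eq_iff [simp]: "w powi m = w powi n \<longleftrightarrow> m = n"
  using w_powi_less_iff[of n m] w_powi_less_iff[of m n] by linarith

lemma ex_w_powi_less:
  assumes "e > 0" obtains n :: nat where "w powi (- int n) < e"
proof -
  obtain n where "inverse w ^ n < e"
    using real_arch_pow_inv[OF assms, of "inverse w"] w_gt_1 by (auto simp: inverse_less_1_iff)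
  then show ?thesis
    using that[of n] by (simp add: power_int_minus power_inverse)
qed

lemma ex_less_w_powi: obtains n :: nat where "r < w powi (int n)"
  using real_arch_pow[OF w_gt_1, of r] by auto

text \<open>The localization of the integers at \<open>p\<close>. Scaled by powers of \<open>p\<close>, this subring gives
  the closed balls around 0, so its closure under sums is the ultrametric inequality.\<close>

definition plocal :: "rat set" where
  "plocal = {q. \<exists>a b::int. \<not> int p dvd b \<and> q = of_int a / of_int b}"

lemma plocal_of_int [simp, intro]: "of_int a \<in> plocal"
proof -
  have "\<not> int p dvd 1" using prime_int_p not_prime_unit by blast
  moreover have "of_int a = (of_int a / of_int 1 :: rat)" by simp
  ultimately show ?thesis unfolding plocal_def by blast
qed

lemma plocal_add: assumes "x \<in> plocal" "y \<in> plocal" shows "x + y \<in> plocal"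
proof -
  obtain a b c d :: int where *: "\<not> int p dvd b" "x = of_int a / of_int b"
      "\<not> int p dvd d" "y = of_int c / of_int d"
    using assms unfolding plocal_def by blast
  then have "b \<noteq> 0" "d \<noteq> 0" by auto
  then have "x + y = of_int (a * d + c * b) / of_int (b * d)"
    using * by (simp add: add_frac_eq)
  moreover have "\<not> int p dvd b * d"
    using * prime_int_p by (simp add: prime_dvd_mult_iff)
  ultimately show ?thesis unfolding plocal_def by blast
qed

lemma plocal_mult: assumes "x \<in> plocal" "y \<in> plocal" shows "x * y \<in> plocal"
proof -
  obtain a b c d :: int where *: "\<not> int p dvd b" "x = of_int a / of_int b"
      "\<not> int p dvd d" "y = of_int c / of_int d"
    using assms unfolding plocal_def by blast
  then have "x * y = of_int (a * c) / of_int (b * d)"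
    by simp
  moreover have "\<not> int p dvd b * d"
    using * prime_int_p by (simp add: prime_dvd_mult_iff)
  ultimately show ?thesis unfolding plocal_def by blast
qed

lemma plocal_powi: "n \<ge> 0 \<Longrightarrow> pr powi n \<in> plocal"
  using plocal_of_int[of "int p ^ nat n"] by (simp add: power_int_def)

text \<open>The definition of the norm reads the valuation off a reduced fraction. A factorization into a
  power of \<open>p\<close> and a unit is easier to use, as it need not be reduced.\<close>

lemma rat_decompose:
  assumes "q \<noteq> 0"
  obtains v :: int and a b :: int where "\<not> int p dvd a" "\<not> int p dvd b"
    "q = pr powi v * (of_int a / of_int b)" "N q = w powi (- v)"
proof -
  obtain n d where nd: "quotient_of q = (n, d)" by force
  then have q: "q = of_int n / of_int d" and d: "d > 0"
    using quotient_of_div quotient_of_denom_pos by blast+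
  then have "n \<noteq> 0" "d \<noteq> 0" using assms by auto
  have nu: "\<not> is_unit (int p)" using prime_int_p not_prime_unit by blast
  obtain a where a: "n = int p ^ multiplicity (int p) n * a" "\<not> int p dvd a"
    using multiplicity_decompose'[OF \<open>n \<noteq> 0\<close> nu] by blast
  obtain b where b: "d = int p ^ multiplicity (int p) d * b" "\<not> int p dvd b"
    using multiplicity_decompose'[OF \<open>d \<noteq> 0\<close> nu] by blast
  let ?i = "multiplicity (int p) n" and ?j = "multiplicity (int p) d"
  have "q = of_int (int p ^ ?i * a) / of_int (int p ^ ?j * b)"
    using q a(1) b(1) by metis
  also have "\<dots> = pr powi (int ?i - int ?j) * (of_int a / of_int b)"
    by (simp add: power_int_diff)
  finally show ?thesis
    using that[of a b "int ?i - int ?j"] a b assms nd by (simp add: rat_padic_norm_def)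
qed

lemma N_le_iff: "N q \<le> w powi (- n) \<longleftrightarrow> q * pr powi (- n) \<in> plocal"
proof (cases "q = 0")
  case True
  then show ?thesis using plocal_of_int[of 0] by (simp add: rat_padic_norm_def less_imp_le)
next
  case False
  obtain v a b where *: "\<not> int p dvd a" "\<not> int p dvd b"
    "q = pr powi v * (of_int a / of_int b)" "N q = w powi (- v)"
    using rat_decompose[OF False] by blast
  have q: "q * pr powi (- n) = pr powi (v - n) * (of_int a / of_int b)"
    using * by (simp add: power_int_diff power_int_minus field_simps)
  show ?thesis
  proof
    assume "N q \<le> w powi (- n)"
    then have "n \<le> v" using * by simp
    moreover have "of_int a / of_int b \<in> plocal"
      using * unfolding plocal_def by blast
    ultimately show "q * pr powi (- n) \<in> plocal"
      unfolding q by (intro plocal_mult plocal_powi) auto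
  next
    assume "q * pr powi (- n) \<in> plocal"
    then obtain c d where cd: "\<not> int p dvd d" "q * pr powi (- n) = of_int c / of_int d"
      unfolding plocal_def by blast
    have "n \<le> v"
    proof (rule ccontr)
      assume "\<not> n \<le> v"
      then obtain k where k: "n = v + int (Suc k)"
        by (metis add.commute linorder_not_le zless_iff_Suc_zadd)
      have "b \<noteq> 0" "d \<noteq> 0" using * cd by auto
      have "(of_int a / of_int b :: rat) = pr ^ Suc k * (of_int c / of_int d)"
      proof -
        have "of_int c / of_int d = pr powi (- int (Suc k)) * (of_int a / of_int b)"
          using cd q k by (simp add: algebra_simps)
        then show ?thesis by (simp only: power_int_minus power_int_of_nat) (simp add: field_simps)
      qed
      then have "(of_int (a * d) :: rat) = of_int (int p ^ Suc k * c * b)"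
        using \<open>b \<noteq> 0\<close> \<open>d \<noteq> 0\<close> by (simp add: field_simps)
      then have "a * d = int p ^ Suc k * c * b" by (simp only: of_int_eq_iff)
      then have "int p dvd a * d" by simp
      then show False using * cd prime_int_p by (simp add: prime_dvd_mult_iff)
    qed
    then show "N q \<le> w powi (- n)" using * by simp
  qed
qed

lemma N_0 [simp]: "N 0 = 0"
  by (simp add: rat_padic_norm_def)

lemma N_eq_0_iff [simp]: "N q = 0 \<longleftrightarrow> q = 0"
  using p_pos by (simp add: rat_padic_norm_def)

lemma N_nonneg [simp]: "N q \<ge> 0"
  by (simp add: rat_padic_norm_def)

lemma N_values: "N q = 0 \<or> (\<exists>n. N q = w powi n)"
  by (auto simp: rat_padic_norm_def)

lemma N_minus [simp]: "N (- q) = N q"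
proof -
  have "multiplicity (int p) (- a) = multiplicity (int p) a" for a
    by (simp add: multiplicity_def)
  then show ?thesis by (simp add: rat_padic_norm_def rat_uminus_code split: prod.split)
qed

lemma N_commute: "N (a - b) = N (b - a)"
  by (metis N_minus minus_diff_eq)

lemma N_add_le:
  assumes "N a \<le> w powi n" "N b \<le> w powi n" shows "N (a + b) \<le> w powi n"
  using assms N_le_iff[of _ "- n"] plocal_add by (simp add: distrib_right)

lemma N_ultra: "N (a + b) \<le> max (N a) (N b)"
proof -
  consider "a = 0" | "b = 0" | n where "max (N a) (N b) = w powi n"
    using N_values[of a] N_values[of b] unfolding max_def by (metis N_eq_0_iff)
  then show ?thesis
  proof cases
    case 3
    then show ?thesis using N_add_le by (metis max.cobounded1 max.cobounded2)
  qed auto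
qed

lemma N_diff_ultra: "N (a - c) \<le> max (N (a - b)) (N (b - c))"
  using N_ultra[of "a - b" "b - c"] by simp

lemma N_sum_le:
  assumes "\<And>i. i \<in> I \<Longrightarrow> N (f i) \<le> w powi n" shows "N (sum f I) \<le> w powi n"
  using assms by (induction I rule: infinite_finite_induct) (auto simp: N_add_le less_imp_le)

text \<open>One inequality is the ultrametric one, the other is the same applied to \<open>a = (a + b) - b\<close>.\<close>

lemma N_isosceles: assumes "N b < N a" shows "N (a + b) = N a"
proof (rule order_antisym)
  show "N (a + b) \<le> N a" using N_ultra[of a b] assms by simp
  show "N a \<le> N (a + b)" using N_ultra[of "a + b" "- b"] assms by simp
qed

lemma N_powi_times_of_int_le: "N (of_int a * pr powi v) \<le> w powi (- v)"
proof -
  have "of_int a * pr powi v * pr powi (- v) = of_int a" by (simp add: power_int_minus field_simps)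
  then have "of_int a * pr powi v * pr powi (- v) \<in> plocal" by (metis plocal_of_int)
  then show ?thesis using N_le_iff by blast
qed

text \<open>By the upper bound above it suffices to exclude the next smaller value, which
  would make \<open>p\<close> divide \<open>a\<close>.\<close>

lemma N_powi_times_unit:
  assumes "\<not> int p dvd a" shows "N (of_int a * pr powi v) = w powi (- v)"
proof -
  let ?q = "of_int a * pr powi v"
  have "\<not> N ?q \<le> w powi (- (v + 1))"
  proof
    assume "N ?q \<le> w powi (- (v + 1))"
    then have "?q * pr powi (- (v + 1)) \<in> plocal" using N_le_iff by blast
    moreover have "?q * pr powi (- (v + 1)) = of_int a / pr"
      by (simp add: power_int_minus power_int_add power_int_diff field_simps)
    ultimately obtain c d where cd: "\<not> int p dvd d" "of_int a / pr = of_int c / of_int d"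
      unfolding plocal_def by auto
    then have "d \<noteq> 0" by auto
    then have "(of_int (a * d) :: rat) = of_int (int p * c)"
      using cd by (simp add: field_simps)
    then have "a * d = int p * c" by (simp only: of_int_eq_iff)
    then have "int p dvd a * d" by simp
    then show False using assms cd prime_int_p by (simp add: prime_dvd_mult_iff)
  qed
  moreover have "?q \<noteq> 0" using assms by auto
  then obtain n where "N ?q = w powi n" using N_values[of ?q] by auto
  ultimately show ?thesis using N_powi_times_of_int_le[of a v] by simp
qed

text \<open>The residue field has the representatives \<open>0, \<dots>, p - 1\<close>: writing the scaled rational as
  \<open>a / b\<close> with \<open>b\<close> prime to \<open>p\<close>, the digit is \<open>a\<close> times the inverse of \<open>b\<close> modulo \<open>p\<close>.\<close>

lemma N_digit:
  assumes "N q \<le> w powi (- n)"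
  obtains d :: nat where "d < p" "N (q - of_nat d * pr powi n) \<le> w powi (- (n + 1))"
proof -
  obtain a b where ab: "\<not> int p dvd b" "q * pr powi (- n) = of_int a / of_int b"
    using assms N_le_iff unfolding plocal_def by blast
  then have b: "b \<noteq> 0" by auto
  have "coprime b (int p)"
    using prime_imp_coprime[OF prime_int_p ab(1)] by (rule coprime_imp_coprime) auto
  then obtain u v where uv: "u * b + v * int p = 1"
    using bezout_int[of b "int p"] by (metis coprime_imp_gcd_eq_1)
  define d where "d = nat ((a * u) mod int p)"
  have di: "int d = (a * u) mod int p" unfolding d_def using p_pos by simp
  have "int p dvd a - int d * b"
  proof -
    have "a - int d * b = a * (u * b + v * int p) - int d * b" using uv by simp
    also have "\<dots> = (a * u - int d) * b + int p * (a * v)" by (simp add: algebra_simps)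
    also have "a * u - int d = int p * (a * u div int p)"
      unfolding di by (simp add: minus_mod_eq_mult_div)
    finally have "a - int d * b = int p * (a * u div int p * b + a * v)"
      by (simp add: algebra_simps)
    then show ?thesis by simp
  qed
  then obtain c where c: "a - int d * b = int p * c" by blast
  have "(q - of_nat d * pr powi n) * pr powi (- (n + 1)) = (of_int a / of_int b - of_nat d) / pr"
    unfolding ab(2)[symmetric] by (simp add: power_int_minus power_int_diff power_int_add field_simps)
  also have "\<dots> = of_int (a - int d * b) / of_int b / pr"
    using b by (simp add: field_simps)
  also have "\<dots> = of_int c / of_int b"
    unfolding c by simp
  finally have "(q - of_nat d * pr powi n) * pr powi (- (n + 1)) \<in> plocal"
    unfolding plocal_def using ab(1) by auto
  moreover have "d < p" using di p_pos
    by (metis of_nat_0_less_iff of_nat_less_iff pos_mod_bound)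
  ultimately show ?thesis using that N_le_iff by blast
qed

lemma metric_N: "Metric_space UNIV (\<lambda>a b. N (a - b))"
proof
  show "N (a - b) = N (b - a)" for a b by (rule N_commute)
  show "N (a - c) \<le> N (a - b) + N (b - c)" for a b c
    using N_diff_ultra[of a c b] N_nonneg[of "a - b"] N_nonneg[of "b - c"] by linarith
qed auto

end

section \<open>The completion as an ultrametric group\<close>

context p_adic begin

definition Qp_class :: "(nat \<Rightarrow> rat) \<Rightarrow> padic" where "Qp_class X = padic_rel p `` {X}"

definition iota :: "rat \<Rightarrow> padic" where "iota q = Qp_class (\<lambda>_. q)"

abbreviation dist_p :: "padic \<Rightarrow> padic \<Rightarrow> real" where "dist_p \<equiv> padic_dist p"
abbreviation norm_p :: "padic \<Rightarrow> real" where "norm_p \<equiv> padic_norm p"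

lemma padic_Cauchy_iff:
  "X \<in> padic_Cauchy p \<longleftrightarrow> (\<forall>e>0. \<exists>M. \<forall>m\<ge>M. \<forall>n\<ge>M. N (X m - X n) < e)"
  unfolding padic_Cauchy_def using Metric_space.MCauchy_def[OF metric_N, of X] by fastforce

lemma padic_CauchyI:
  assumes "\<And>e. e > 0 \<Longrightarrow> \<exists>M. \<forall>m\<ge>M. \<forall>n\<ge>M. N (X m - X n) < e"
  shows "X \<in> padic_Cauchy p"
  using assms padic_Cauchy_iff by blast

lemma padic_CauchyD:
  assumes "X \<in> padic_Cauchy p" "e > 0"
  obtains M where "\<And>m n. m \<ge> M \<Longrightarrow> n \<ge> M \<Longrightarrow> N (X m - X n) < e"
  using assms padic_Cauchy_iff by blast

lemma padic_Cauchy_const [simp]: "(\<lambda>_. q) \<in> padic_Cauchy p"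
  by (rule padic_CauchyI) auto

lemma N_triangle: "N (a - c) \<le> N (a - b) + N (b - c)"
  using N_diff_ultra[of a c b] N_nonneg[of "a - b"] N_nonneg[of "b - c"] by linarith

lemma N_diff_diff_le: "N ((a - b) - (c - d)) \<le> max (N (a - c)) (N (b - d))"
  using N_ultra[of "a - c" "- (b - d)"] unfolding N_minus by (simp add: algebra_simps)

lemma N_add_diff_le: "N ((a + b) - (c + d)) \<le> max (N (a - c)) (N (b - d))"
  using N_ultra[of "a - c" "b - d"] by (simp add: algebra_simps)

lemma padic_Cauchy_diff [intro]:
  assumes "X \<in> padic_Cauchy p" "Y \<in> padic_Cauchy p"
  shows "(\<lambda>n. X n - Y n) \<in> padic_Cauchy p"
proof (rule padic_CauchyI)
  fix e :: real assume "e > 0"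
  obtain K where K: "\<And>m n. m \<ge> K \<Longrightarrow> n \<ge> K \<Longrightarrow> N (X m - X n) < e"
    using padic_CauchyD[OF assms(1) \<open>e > 0\<close>] by blast
  obtain L where L: "\<And>m n. m \<ge> L \<Longrightarrow> n \<ge> L \<Longrightarrow> N (Y m - Y n) < e"
    using padic_CauchyD[OF assms(2) \<open>e > 0\<close>] by blast
  show "\<exists>M. \<forall>m\<ge>M. \<forall>n\<ge>M. N ((X m - Y m) - (X n - Y n)) < e"
    using K L N_diff_diff_le by (intro exI[of _ "max K L"]) (meson le_less_trans max.boundedE max_less_iff_conj)
qed

lemma padic_Cauchy_add [intro]:
  assumes "X \<in> padic_Cauchy p" "Y \<in> padic_Cauchy p"
  shows "(\<lambda>n. X n + Y n) \<in> padic_Cauchy p"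
  using padic_Cauchy_diff[OF assms(1) padic_Cauchy_diff[OF padic_Cauchy_const[of 0] assms(2)]]
  by simp

lemma padic_rel_iff: "(X, Y) \<in> padic_rel p \<longleftrightarrow>
  X \<in> padic_Cauchy p \<and> Y \<in> padic_Cauchy p \<and> (\<lambda>n. N (X n - Y n)) \<longlonglongrightarrow> 0"
  by (simp add: padic_rel_def)

lemma N_tendsto_0_le:
  assumes "(\<lambda>n. N (X n)) \<longlonglongrightarrow> 0" "(\<lambda>n. N (Y n)) \<longlonglongrightarrow> 0" "\<And>n. N (Z n) \<le> max (N (X n)) (N (Y n))"
  shows "(\<lambda>n. N (Z n)) \<longlonglongrightarrow> 0"
proof (rule tendsto_sandwich[of "\<lambda>_. 0" _ _ "\<lambda>n. max (N (X n)) (N (Y n))"])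
  show "(\<lambda>n. max (N (X n)) (N (Y n))) \<longlonglongrightarrow> 0"
    using tendsto_max[OF assms(1,2)] by simp
qed (use assms(3) in auto)

lemma equiv_padic_rel: "equiv (padic_Cauchy p) (padic_rel p)"
proof (rule equivI)
  show "padic_rel p \<subseteq> padic_Cauchy p \<times> padic_Cauchy p" by (auto simp: padic_rel_iff)
  show "refl_on (padic_Cauchy p) (padic_rel p)" by (auto simp: refl_on_def padic_rel_iff)
  show "sym (padic_rel p)"
    by (rule symI) (simp add: padic_rel_iff N_commute[of "_ :: rat" "_ :: rat"])
  show "trans (padic_rel p)"
  proof (rule transI)
    fix X Y Z assume "(X, Y) \<in> padic_rel p" "(Y, Z) \<in> padic_rel p"
    then show "(X, Z) \<in> padic_rel p"
      unfolding padic_rel_iff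
      by (auto intro: N_tendsto_0_le[of "\<lambda>n. X n - Y n" "\<lambda>n. Y n - Z n"] N_diff_ultra)
  qed
qed

lemma Qp_class_eq_iff:
  assumes "X \<in> padic_Cauchy p" "Y \<in> padic_Cauchy p"
  shows "Qp_class X = Qp_class Y \<longleftrightarrow> (\<lambda>n. N (X n - Y n)) \<longlonglongrightarrow> 0"
  unfolding Qp_class_def using eq_equiv_class_iff[OF equiv_padic_rel assms] assms by (simp add: padic_rel_iff)

lemma in_Qp_class_iff: "Y \<in> Qp_class X \<longleftrightarrow> (X, Y) \<in> padic_rel p"
  by (simp add: Qp_class_def)

lemma self_in_Qp_class: "X \<in> padic_Cauchy p \<Longrightarrow> X \<in> Qp_class X"
  by (simp add: in_Qp_class_iff padic_rel_iff)

lemma Qp_class_in_Qp [intro]: "X \<in> padic_Cauchy p \<Longrightarrow> Qp_class X \<in> Qp p"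
  unfolding Qp_def Qp_class_def by (rule quotientI)

lemma iota_in_Qp [simp, intro]: "iota q \<in> Qp p"
  unfolding iota_def by (rule Qp_class_in_Qp) simp

lemma Qp_cases:
  assumes "x \<in> Qp p" obtains X where "X \<in> padic_Cauchy p" "x = Qp_class X"
  using assms unfolding Qp_def Qp_class_def by (auto elim: quotientE)

text \<open>The defining union over all representatives is a union of equal sets, because changing
  a representative by a null sequence changes the difference by a null sequence.\<close>

lemma padic_diff_Qp_class:
  assumes X: "X \<in> padic_Cauchy p" and Y: "Y \<in> padic_Cauchy p"
  shows "padic_diff p (Qp_class X) (Qp_class Y) = Qp_class (\<lambda>n. X n - Y n)"
proof -
  have "padic_rel p `` {\<lambda>n. X' n - Y' n} = Qp_class (\<lambda>n. X n - Y n)"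
    if "X' \<in> Qp_class X" "Y' \<in> Qp_class Y" for X' Y'
  proof -
    have *: "X' \<in> padic_Cauchy p" "(\<lambda>n. N (X n - X' n)) \<longlonglongrightarrow> 0"
      "Y' \<in> padic_Cauchy p" "(\<lambda>n. N (Y n - Y' n)) \<longlonglongrightarrow> 0"
      using that by (auto simp: in_Qp_class_iff padic_rel_iff)
    then have "Qp_class (\<lambda>n. X' n - Y' n) = Qp_class (\<lambda>n. X n - Y n)"
      using X Y by (subst Qp_class_eq_iff)
        (auto intro!: N_tendsto_0_le[OF *(2,4)] simp: N_diff_diff_le N_commute[of "X' _ - _"])
    then show ?thesis by (simp add: Qp_class_def)
  qed
  then show ?thesis
    unfolding padic_diff_def using self_in_Qp_class[OF X] self_in_Qp_class[OF Y] by blast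
qed

lemma padic_add_Qp_class:
  assumes X: "X \<in> padic_Cauchy p" and Y: "Y \<in> padic_Cauchy p"
  shows "padic_add p (Qp_class X) (Qp_class Y) = Qp_class (\<lambda>n. X n + Y n)"
proof -
  have "padic_rel p `` {\<lambda>n. X' n + Y' n} = Qp_class (\<lambda>n. X n + Y n)"
    if "X' \<in> Qp_class X" "Y' \<in> Qp_class Y" for X' Y'
  proof -
    have *: "X' \<in> padic_Cauchy p" "(\<lambda>n. N (X n - X' n)) \<longlonglongrightarrow> 0"
      "Y' \<in> padic_Cauchy p" "(\<lambda>n. N (Y n - Y' n)) \<longlonglongrightarrow> 0"
      using that by (auto simp: in_Qp_class_iff padic_rel_iff)
    then have "Qp_class (\<lambda>n. X' n + Y' n) = Qp_class (\<lambda>n. X n + Y n)"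
      using X Y by (subst Qp_class_eq_iff)
        (auto intro!: N_tendsto_0_le[OF *(2,4)] simp: N_add_diff_le N_commute[of "X' _ + _"])
    then show ?thesis by (simp add: Qp_class_def)
  qed
  then show ?thesis
    unfolding padic_add_def using self_in_Qp_class[OF X] self_in_Qp_class[OF Y] by blast
qed

lemma abs_N_diff_le: "\<bar>N a - N b\<bar> \<le> N (a - b)"
  using N_triangle[of a 0 b] N_triangle[of b 0 a] N_commute[of a b] by auto

text \<open>The limit exists because the absolute values form a real Cauchy sequence, and it is the same
  for all representatives; this is what makes the definite description meaningful.\<close>

lemma norm_tendsto:
  assumes X: "X \<in> padic_Cauchy p"
  shows "(\<lambda>n. N (X n)) \<longlonglongrightarrow> norm_p (Qp_class X)"
proof -
  have "Cauchy (\<lambda>n. N (X n))"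
  proof (rule metric_CauchyI)
    fix e :: real assume "e > 0"
    then obtain M where "\<And>m n. m \<ge> M \<Longrightarrow> n \<ge> M \<Longrightarrow> N (X m - X n) < e"
      using padic_CauchyD[OF X] by blast
    then show "\<exists>M. \<forall>m\<ge>M. \<forall>n\<ge>M. dist (N (X m)) (N (X n)) < e"
      unfolding dist_real_def by (meson abs_N_diff_le le_less_trans)
  qed
  then obtain L where L: "(\<lambda>n. N (X n)) \<longlonglongrightarrow> L"
    using Cauchy_convergent convergent_def by blast
  have *: "\<forall>Y\<in>Qp_class X. (\<lambda>n. N (Y n)) \<longlonglongrightarrow> L"
  proof
    fix Y assume "Y \<in> Qp_class X"
    then have "(\<lambda>n. N (X n - Y n)) \<longlonglongrightarrow> 0" by (simp add: in_Qp_class_iff padic_rel_iff)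
    then have "(\<lambda>n. N (X n) - N (Y n)) \<longlonglongrightarrow> 0"
      by (rule Lim_null_comparison[rotated]) (auto simp: abs_N_diff_le)
    from tendsto_diff[OF L this] show "(\<lambda>n. N (Y n)) \<longlonglongrightarrow> L" by simp
  qed
  have "norm_p (Qp_class X) = L"
    unfolding padic_norm_def
  proof (rule the_equality)
    show "\<forall>Y\<in>Qp_class X. (\<lambda>n. N (Y n)) \<longlonglongrightarrow> L" by (rule *)
    show "r = L" if "\<forall>Y\<in>Qp_class X. (\<lambda>n. N (Y n)) \<longlonglongrightarrow> r" for r
      using that self_in_Qp_class[OF X] L LIMSEQ_unique by blast
  qed
  then show ?thesis using L by simp
qed

lemma padic_diff_in_Qp [intro]: "x \<in> Qp p \<Longrightarrow> y \<in> Qp p \<Longrightarrow> padic_diff p x y \<in> Qp p"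
  by (auto elim!: Qp_cases simp: padic_diff_Qp_class intro!: Qp_class_in_Qp padic_Cauchy_diff)

lemma padic_add_in_Qp [intro]: "x \<in> Qp p \<Longrightarrow> y \<in> Qp p \<Longrightarrow> padic_add p x y \<in> Qp p"
  by (auto elim!: Qp_cases simp: padic_add_Qp_class intro!: Qp_class_in_Qp padic_Cauchy_add)

lemma dist_eq_norm: "x \<in> Qp p \<Longrightarrow> y \<in> Qp p \<Longrightarrow> dist_p x y = norm_p (padic_diff p x y)"
  by (simp add: padic_dist_def)

lemma dist_tendsto:
  assumes "X \<in> padic_Cauchy p" "Y \<in> padic_Cauchy p"
  shows "(\<lambda>n. N (X n - Y n)) \<longlonglongrightarrow> dist_p (Qp_class X) (Qp_class Y)"
  using norm_tendsto[OF padic_Cauchy_diff[OF assms]] assms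
  by (simp add: dist_eq_norm Qp_class_in_Qp padic_diff_Qp_class)

lemma dist_iota: "dist_p (iota q) (iota r) = N (q - r)"
  using dist_tendsto[of "\<lambda>_. q" "\<lambda>_. r"] LIMSEQ_unique[OF _ tendsto_const] unfolding iota_def by fastforce

lemma norm_nonneg: "x \<in> Qp p \<Longrightarrow> norm_p x \<ge> 0"
  by (elim Qp_cases) (auto intro: LIMSEQ_le_const[OF norm_tendsto])

lemma dist_nonneg: "dist_p x y \<ge> 0"
  by (auto simp: padic_dist_def norm_nonneg padic_diff_in_Qp)

lemma dist_commute: "dist_p x y = dist_p y x"
proof (cases "x \<in> Qp p \<and> y \<in> Qp p")
  case True
  then obtain X Y where "X \<in> padic_Cauchy p" "x = Qp_class X" "Y \<in> padic_Cauchy p" "y = Qp_class Y"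
    by (meson Qp_cases)
  moreover have "(\<lambda>n. N (X n - Y n)) = (\<lambda>n. N (Y n - X n))" by (rule ext) (rule N_commute)
  ultimately show ?thesis
    using dist_tendsto[of X Y] dist_tendsto[of Y X] LIMSEQ_unique by metis
qed (auto simp: padic_dist_def)

lemma dist_eq_0_iff: "x \<in> Qp p \<Longrightarrow> y \<in> Qp p \<Longrightarrow> dist_p x y = 0 \<longleftrightarrow> x = y"
  by (elim Qp_cases) (metis Qp_class_eq_iff dist_tendsto LIMSEQ_unique)

lemma dist_ultra:
  assumes "x \<in> Qp p" "y \<in> Qp p" "z \<in> Qp p"
  shows "dist_p x z \<le> max (dist_p x y) (dist_p y z)"
proof -
  obtain X Y Z where *: "X \<in> padic_Cauchy p" "x = Qp_class X" "Y \<in> padic_Cauchy p" "y = Qp_class Y"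
     "Z \<in> padic_Cauchy p" "z = Qp_class Z"
    using assms by (meson Qp_cases)
  show ?thesis unfolding *
    by (rule LIMSEQ_le[OF dist_tendsto tendsto_max[OF dist_tendsto dist_tendsto]])
       (use * N_diff_ultra in auto)
qed

sublocale Qp_metric: Metric_space "Qp p" dist_p
proof
  show "dist_p x z \<le> dist_p x y + dist_p y z" if "x \<in> Qp p" "y \<in> Qp p" "z \<in> Qp p" for x y z
    using dist_ultra[OF that] dist_nonneg[of x y] dist_nonneg[of y z] by linarith
qed (auto simp: dist_nonneg dist_commute dist_eq_0_iff)

text \<open>Passing to the limit does not enlarge the value group: along a Cauchy sequence with nonzero
  limit the absolute values are eventually constant.\<close>

lemma norm_values:
  assumes "x \<in> Qp p" shows "norm_p x = 0 \<or> (\<exists>n. norm_p x = w powi n)"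
proof (cases "norm_p x = 0")
  case False
  then have pos: "norm_p x > 0" using norm_nonneg[OF assms] by linarith
  obtain X where X: "X \<in> padic_Cauchy p" "x = Qp_class X" using Qp_cases[OF assms] by blast
  have lim: "(\<lambda>n. N (X n)) \<longlonglongrightarrow> norm_p x" using norm_tendsto X by simp
  have "norm_p x / 2 > 0" using pos by simp
  then obtain M where M: "\<And>m n. m \<ge> M \<Longrightarrow> n \<ge> M \<Longrightarrow> N (X m - X n) < norm_p x / 2"
    using padic_CauchyD[OF X(1)] by blast
  have "\<forall>\<^sub>F n in sequentially. N (X n) > norm_p x / 2"
    by (rule order_tendstoD(1)[OF lim]) (use pos in simp)
  then obtain K where K: "\<And>n. n \<ge> K \<Longrightarrow> N (X n) > norm_p x / 2"
    by (auto simp: eventually_sequentially)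
  define L where "L = max K M"
  have "N (X n) = N (X L)" if "n \<ge> L" for n
  proof -
    have "N (X n - X L) < N (X L)" using M[of n L] K[of L] that unfolding L_def by force
    from N_isosceles[OF this] show ?thesis by simp
  qed
  then have "\<forall>\<^sub>F n in sequentially. N (X n) = N (X L)"
    unfolding eventually_sequentially by blast
  then have "(\<lambda>n. N (X n)) \<longlonglongrightarrow> N (X L)" by (simp add: tendsto_eventually)
  then have "norm_p x = N (X L)" using lim LIMSEQ_unique by blast
  then show ?thesis using N_values by metis
qed simp

lemma norm_eq_dist: "x \<in> Qp p \<Longrightarrow> norm_p x = dist_p x (iota 0)"
  by (elim Qp_cases) (simp add: dist_eq_norm iota_def padic_diff_Qp_class Qp_class_in_Qp)

lemma norm_eq_0_iff: "x \<in> Qp p \<Longrightarrow> norm_p x = 0 \<longleftrightarrow> x = iota 0"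
  by (simp add: norm_eq_dist dist_eq_0_iff)

lemma norm_iota: "norm_p (iota q) = N q"
  by (simp add: norm_eq_dist dist_iota)

text \<open>The isosceles property, in the form used for the kernel \<open>|x - y|\<close>.\<close>

lemma dist_eq_max:
  assumes "x \<in> Qp p" "y \<in> Qp p" "norm_p x \<noteq> norm_p y"
  shows "dist_p x y = max (norm_p x) (norm_p y)"
  using dist_ultra[of x "iota 0" y] dist_ultra[of x y "iota 0"] dist_ultra[of y x "iota 0"]
    assms dist_commute[of x y] dist_commute[of "iota 0" y] by (auto simp: norm_eq_dist)

lemma padic_add_diff:
  assumes "a \<in> Qp p" "x \<in> Qp p"
  shows "padic_add p a (padic_diff p x a) = x" "padic_diff p (padic_add p a x) a = x"
  using assms by (auto elim!: Qp_cases simp: padic_add_Qp_class padic_diff_Qp_class padic_Cauchy_add padic_Cauchy_diff)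

lemma dist_add:
  assumes "a \<in> Qp p" "x \<in> Qp p" "y \<in> Qp p"
  shows "dist_p (padic_add p a x) (padic_add p a y) = dist_p x y"
proof -
  obtain A X Y where *: "A \<in> padic_Cauchy p" "a = Qp_class A" "X \<in> padic_Cauchy p" "x = Qp_class X"
     "Y \<in> padic_Cauchy p" "y = Qp_class Y"
    using assms by (meson Qp_cases)
  show ?thesis
    using dist_tendsto[OF padic_Cauchy_add[OF *(1,3)] padic_Cauchy_add[OF *(1,5)]]
      dist_tendsto[OF *(3,5)] LIMSEQ_unique by (simp add: * padic_add_Qp_class)
qed

text \<open>Completing the rationals makes them dense.\<close>

lemma rat_dense:
  assumes "x \<in> Qp p" obtains q where "dist_p x (iota q) \<le> w powi n"
proof -
  obtain X where X: "X \<in> padic_Cauchy p" "x = Qp_class X" using Qp_cases[OF assms] by blast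
  obtain M where M: "\<And>m k. m \<ge> M \<Longrightarrow> k \<ge> M \<Longrightarrow> N (X m - X k) < w powi n"
    using padic_CauchyD[OF X(1) w_powi_pos] by blast
  have "dist_p x (iota (X M)) \<le> w powi n"
    unfolding X(2) iota_def
    by (rule LIMSEQ_le_const2[OF dist_tendsto]) (use X M in \<open>auto intro!: exI[of _ M] less_imp_le\<close>)
  then show ?thesis using that by blast
qed

text \<open>Closed balls whose radius is a power of \<open>p\<close>. As the absolute value takes no other nonzero
  values, every ball of positive radius is of this form.\<close>

definition pball :: "padic \<Rightarrow> int \<Rightarrow> padic set" where
  "pball x n = {y \<in> Qp p. dist_p x y \<le> w powi n}"

lemma pball_eq: assumes "x \<in> Qp p" "y \<in> pball x n" shows "pball y n = pball x n"
proof -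
  have y: "y \<in> Qp p" "dist_p x y \<le> w powi n" "dist_p y x \<le> w powi n"
    using assms dist_commute by (auto simp: pball_def)
  show ?thesis
    unfolding pball_def
    using dist_ultra[OF assms(1) y(1)] dist_ultra[OF y(1) assms(1)] y(2,3)
    by (smt (verit) Collect_cong max_def)
qed

lemma self_in_pball: "x \<in> Qp p \<Longrightarrow> x \<in> pball x n"
  using less_imp_le[OF w_powi_pos] by (simp add: pball_def dist_eq_0_iff[THEN iffD2])

lemma pball_mono: "m \<le> n \<Longrightarrow> pball x m \<subseteq> pball x n"
  unfolding pball_def using w_powi_le_iff[of m n] by (auto intro: order_trans)

lemma pball_subset_Qp: "pball x n \<subseteq> Qp p"
  by (auto simp: pball_def)

lemma pball_eq_iota: assumes "x \<in> Qp p" obtains q where "pball x n = pball (iota q) n"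
proof -
  obtain q where "dist_p x (iota q) \<le> w powi n" using rat_dense[OF assms] by blast
  then have "iota q \<in> pball x n" by (simp add: pball_def)
  then show ?thesis using that pball_eq[OF assms] by metis
qed

text \<open>If two balls share a point, it is a center of both.\<close>

lemma pball_Int:
  assumes "x \<in> Qp p" "y \<in> Qp p"
  shows "pball x m \<inter> pball y n = {} \<or> pball x m \<inter> pball y n = pball x m \<or> pball x m \<inter> pball y n = pball y n"
proof (cases "pball x m \<inter> pball y n = {}")
  case False
  then obtain z where z: "z \<in> pball x m" "z \<in> pball y n" by blast
  have "pball z m = pball x m" "pball z n = pball y n"
    by (rule pball_eq[OF assms(1) z(1)]) (rule pball_eq[OF assms(2) z(2)])
  then show ?thesis using pball_mono[of m n z] pball_mono[of n m z] by (cases "m \<le> n") auto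
qed simp

lemma add_image_pball:
  assumes "a \<in> Qp p" "x \<in> Qp p" shows "padic_add p a ` pball x n = pball (padic_add p a x) n"
proof
  show "padic_add p a ` pball x n \<subseteq> pball (padic_add p a x) n"
    using assms by (auto simp: pball_def dist_add padic_add_in_Qp)
  show "pball (padic_add p a x) n \<subseteq> padic_add p a ` pball x n"
  proof
    fix y assume y: "y \<in> pball (padic_add p a x) n"
    then have yQ: "y \<in> Qp p" by (simp add: pball_def)
    have "y = padic_add p a (padic_diff p y a)" using padic_add_diff assms yQ by simp
    moreover have "padic_diff p y a \<in> pball x n"
      using y dist_add[OF assms padic_diff_in_Qp[OF yQ assms(1)]] padic_add_diff(1)[OF assms(1) yQ]
        padic_diff_in_Qp[OF yQ assms(1)] by (simp add: pball_def)
    ultimately show "y \<in> padic_add p a ` pball x n" by blast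
  qed
qed

text \<open>Rational centers suffice by density, so this family is countable. The empty set makes it
  closed under intersection.\<close>

definition balls :: "padic set set" where "balls = insert {} (range (\<lambda>(q, n). pball (iota q) n))"

lemma pball_in_balls: "x \<in> Qp p \<Longrightarrow> pball x n \<in> balls"
  unfolding balls_def using pball_eq_iota by (metis (mono_tags, lifting) case_prod_conv insertI2 rangeI)

lemma ballsE: assumes "B \<in> balls" obtains "B = {}" | x n where "x \<in> Qp p" "B = pball x n"
  using assms unfolding balls_def by auto

lemma countable_balls: "countable balls"
  by (simp add: balls_def)

lemma balls_subset: "balls \<subseteq> Pow (Qp p)"
  using pball_subset_Qp by (auto elim!: ballsE)

lemma Int_stable_balls: "Int_stable balls"
proof (rule Int_stableI)
  fix A B assume AB: "A \<in> balls" "B \<in> balls"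
  show "A \<inter> B \<in> balls"
  proof (cases "A = {} \<or> B = {}")
    case True
    then show ?thesis by (auto simp: balls_def)
  next
    case False
    obtain x m where A: "x \<in> Qp p" "A = pball x m" using AB(1) False by (auto elim!: ballsE)
    obtain y n where B: "y \<in> Qp p" "B = pball y n" using AB(2) False by (auto elim!: ballsE)
    have "A \<inter> B = {} \<or> A \<inter> B = A \<or> A \<inter> B = B"
      unfolding A(2) B(2) by (rule pball_Int[OF A(1) B(1)])
    moreover have "{} \<in> balls" by (simp add: balls_def)
    ultimately show ?thesis using AB by metis
  qed
qed

lemma openin_pball: assumes "x \<in> Qp p" shows "openin (padic_topology p) (pball x n)"
  unfolding padic_topology_def Qp_metric.openin_mtopology_mcball
proof (intro conjI allI impI pball_subset_Qp exI)
  fix y assume "y \<in> pball x n"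
  then have "pball y n = pball x n" using pball_eq assms by blast
  then show "Qp_metric.mcball y (w powi n) \<subseteq> pball x n" by (auto simp: pball_def Qp_metric.mcball_def)
qed simp

text \<open>Together with countability of the balls this makes every open set a countable union of
  balls, hence the balls generate the Borel sets.\<close>

lemma openin_imp_Union_balls:
  assumes "openin (padic_topology p) U"
  shows "U = \<Union>{B \<in> balls. B \<subseteq> U}"
proof
  show "U \<subseteq> \<Union>{B \<in> balls. B \<subseteq> U}"
  proof
    fix x assume x: "x \<in> U"
    then obtain r where r: "r > 0" "Qp_metric.mcball x r \<subseteq> U" and xQ: "x \<in> Qp p"
      using assms unfolding padic_topology_def Qp_metric.openin_mtopology_mcball by blast
    obtain n where "w powi (- int n) < r" using ex_w_powi_less[OF r(1)] by blast
    then have "pball x (- int n) \<subseteq> U"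
      using r(2) xQ by (auto simp: pball_def Qp_metric.mcball_def)
    then show "x \<in> \<Union>{B \<in> balls. B \<subseteq> U}"
      using self_in_pball[OF xQ] pball_in_balls[OF xQ] by blast
  qed
qed auto

lemma space_padic_borel: "space (padic_borel p) = Qp p"
  and sets_padic_borel: "sets (padic_borel p) = sigma_sets (Qp p) balls"
proof -
  have sub: "{U. openin (padic_topology p) U} \<subseteq> Pow (Qp p)"
    using Qp_metric.openin_mtopology by (auto simp: padic_topology_def)
  then show "space (padic_borel p) = Qp p"
    by (simp add: padic_borel_def space_measure_of_conv)
  have s: "sets (padic_borel p) = sigma_sets (Qp p) {U. openin (padic_topology p) U}"
    unfolding padic_borel_def using sub by (simp add: sets_measure_of)
  show "sets (padic_borel p) = sigma_sets (Qp p) balls"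
    unfolding s
  proof (rule sigma_sets_eqI)
    fix U assume "U \<in> {U. openin (padic_topology p) U}"
    then have "U = \<Union>{B \<in> balls. B \<subseteq> U}" using openin_imp_Union_balls by blast
    moreover have "countable {B \<in> balls. B \<subseteq> U}"
      by (rule countable_subset[OF _ countable_balls]) auto
    then have "\<Union>{B \<in> balls. B \<subseteq> U} \<in> sigma_sets (Qp p) balls"
      by (intro sigma_sets_UNION) (auto intro: sigma_sets.Basic)
    ultimately show "U \<in> sigma_sets (Qp p) balls" by metis
  next
    fix B assume "B \<in> balls"
    then show "B \<in> sigma_sets (Qp p) {U. openin (padic_topology p) U}"
      by (elim ballsE) (auto intro: sigma_sets.Empty sigma_sets.Basic openin_pball)
  qed
qed

end

section \<open>Haar measure from reversed digits\<close>

context p_adic begin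

lemma w_pow_le_iff [simp]: "w ^ m \<le> w ^ n \<longleftrightarrow> m \<le> n"
  by (rule power_increasing_iff[OF w_gt_1])

lemma powi_cancel [simp]: "w powi (- n) * w powi n = 1" "w powi n * w powi (- n) = 1"
  by (simp_all add: power_int_minus)

text \<open>The integer formed by the base \<open>p\<close> digits of \<open>t\<close> down to the place of weight \<open>p^(-i)\<close>; two
  numbers share these digits if and only if the integers agree.\<close>

definition floor_at :: "int \<Rightarrow> real \<Rightarrow> int" where "floor_at i t = \<lfloor>t * w powi i\<rfloor>"

text \<open>The digit of weight \<open>p^(-i-1)\<close>, so that index 0 is the first digit after the point.\<close>

definition digit :: "int \<Rightarrow> real \<Rightarrow> int" where "digit i t = floor_at (i + 1) t mod int p"

text \<open>Digits before the point become coefficients of negative powers of \<open>p\<close>. Truncating both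
  ends at \<open>M\<close> gives a rational number; for \<open>t < p^M\<close> no digit is lost at the lower end.\<close>

definition rev_trunc :: "real \<Rightarrow> nat \<Rightarrow> rat" where
  "rev_trunc t M = (\<Sum>i\<in>{- int M..<int M}. of_int (digit i t) * pr powi i)"

definition rev_digits :: "real \<Rightarrow> padic" where "rev_digits t = Qp_class (rev_trunc t)"

lemma floor_at_step: "floor_at i t = floor_at (i + 1) t div int p"
proof -
  have "t * w powi i = t * w powi (i + 1) / real_of_int (int p)"
    by (simp add: power_int_add)
  then show ?thesis unfolding floor_at_def by (metis floor_divide_real_eq_div of_nat_0_le_iff)
qed

lemma floor_at_eq_mono:
  assumes "floor_at n s = floor_at n t" "i \<le> n" shows "floor_at i s = floor_at i t"
  using assms(2)
proof (induction rule: int_le_induct)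
  case (step i)
  then show ?case using floor_at_step[of "i - 1" s] floor_at_step[of "i - 1" t] by simp
qed (rule assms(1))

lemma digit_eq: assumes "floor_at n s = floor_at n t" "i < n" shows "digit i s = digit i t"
  unfolding digit_def using floor_at_eq_mono[OF assms(1), of "i + 1"] assms(2) by simp

lemma floor_at_step': "floor_at (i + 1) t = int p * floor_at i t + digit i t"
  using floor_at_step[of i t] mult_div_mod_eq[of "int p" "floor_at (i + 1) t"] unfolding digit_def by simp

lemma digit_bounds: "0 \<le> digit i t" "digit i t < int p"
  using p_pos by (auto simp: digit_def)

lemma floor_at_eq_0: assumes "0 \<le> t" "t < w powi (int M)" "i \<le> - int M" shows "floor_at i t = 0"
proof -
  have "t * w powi i \<le> t * w powi (- int M)"
    using assms by (intro mult_left_mono) auto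
  also have "\<dots> < w powi (int M) * w powi (- int M)"
    using assms by (intro mult_strict_right_mono) auto
  also have "\<dots> = 1" by (simp add: power_int_minus)
  finally have "t * w powi i < 1" .
  moreover have "0 \<le> t * w powi i" using assms less_imp_le[OF w_powi_pos] by auto
  ultimately show ?thesis unfolding floor_at_def by linarith
qed

lemma digit_eq_0: assumes "0 \<le> t" "t < w powi (int M)" "i < - int M" shows "digit i t = 0"
  unfolding digit_def using floor_at_eq_0[OF assms(1,2), of "i + 1"] assms(3) by simp

lemma N_digit_le: "n \<le> i \<Longrightarrow> N (of_int a * pr powi i) \<le> w powi (- n)"
  using N_powi_times_of_int_le[of a i] w_powi_le_iff[of "- i" "- n"] by linarith

text \<open>Digits with index below \<open>-M\<close> vanish and those from \<open>n\<close> on contribute multiples of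
  \<open>p^n\<close>.\<close>

lemma rev_trunc_tail:
  assumes t: "0 \<le> t" "t < w powi (int M)" and n: "- int M \<le> n" "n \<le> int M'" "M \<le> M'"
  shows "N (rev_trunc t M' - (\<Sum>i\<in>{- int M..<n}. of_int (digit i t) * pr powi i)) \<le> w powi (- n)"
proof -
  have split: "{- int M'..<int M'} = {- int M..<n} \<union> ({- int M'..<- int M} \<union> {n..<int M'})"
    using n by auto
  have "rev_trunc t M' = (\<Sum>i\<in>{- int M..<n}. of_int (digit i t) * pr powi i) +
    (\<Sum>i\<in>{- int M'..<- int M} \<union> {n..<int M'}. of_int (digit i t) * pr powi i)"
    unfolding rev_trunc_def split by (rule sum.union_disjoint) (use n in auto)
  then have "rev_trunc t M' - (\<Sum>i\<in>{- int M..<n}. of_int (digit i t) * pr powi i) =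
    (\<Sum>i\<in>{- int M'..<- int M} \<union> {n..<int M'}. of_int (digit i t) * pr powi i)"
    by simp
  moreover have "N (\<Sum>i\<in>{- int M'..<- int M} \<union> {n..<int M'}. of_int (digit i t) * pr powi i) \<le> w powi (- n)"
  proof (rule N_sum_le)
    fix i assume "i \<in> {- int M'..<- int M} \<union> {n..<int M'}"
    then consider "i < - int M" | "n \<le> i" by auto
    then show "N (of_int (digit i t) * pr powi i) \<le> w powi (- n)"
    proof cases
      case 1 then show ?thesis using digit_eq_0[OF t] by (simp add: less_imp_le)
    next
      case 2 then show ?thesis by (rule N_digit_le)
    qed
  qed
  ultimately show ?thesis by simp
qed

lemma rev_trunc_Cauchy: assumes "0 \<le> t" shows "rev_trunc t \<in> padic_Cauchy p"
proof (rule padic_CauchyI)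
  fix e :: real assume "e > 0"
  then obtain K where K: "w powi (- int K) < e" using ex_w_powi_less by blast
  obtain L where L: "t < w powi (int L)" using ex_less_w_powi by blast
  define M where "M = max K L"
  have tM: "t < w powi (int M)"
    using L w_powi_le_iff[of "int L" "int M"] unfolding M_def by linarith
  let ?P = "\<Sum>i\<in>{- int M..<int M}. of_int (digit i t) * pr powi i"
  have *: "N (rev_trunc t m - ?P) \<le> w powi (- int M)" if "m \<ge> M" for m
    using rev_trunc_tail[OF assms tM, of "int M" m] that by simp
  have "N (rev_trunc t m - rev_trunc t n) < e" if "m \<ge> M" "n \<ge> M" for m n
  proof -
    have "N (rev_trunc t m - rev_trunc t n) \<le> max (N (rev_trunc t m - ?P)) (N (?P - rev_trunc t n))"
      by (rule N_diff_ultra)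
    also have "\<dots> \<le> w powi (- int M)" using *[OF that(1)] *[OF that(2)] N_commute[of ?P] by simp
    also have "\<dots> \<le> w powi (- int K)" unfolding M_def by simp
    finally show ?thesis using K by simp
  qed
  then show "\<exists>M. \<forall>m\<ge>M. \<forall>n\<ge>M. N (rev_trunc t m - rev_trunc t n) < e" by blast
qed

lemma rev_digits_in_Qp [intro]: "0 \<le> t \<Longrightarrow> rev_digits t \<in> Qp p"
  unfolding rev_digits_def using rev_trunc_Cauchy by blast

text \<open>If the digits differ, the first difference is at an index \<open>i < n\<close>. It contributes a term of absolute
  value exactly \<open>p^(-i)\<close>, since two distinct digits are incongruent modulo \<open>p\<close>, and all
  later digits contribute less.\<close>

lemma N_rev_trunc_diff_le_iff:
  assumes s: "0 \<le> s" "s < w powi (int M)" and t: "0 \<le> t" "t < w powi (int M)"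
    and n: "- int M \<le> n" "n \<le> int M"
  shows "N (rev_trunc s M - rev_trunc t M) \<le> w powi (- n) \<longleftrightarrow> floor_at n s = floor_at n t"
proof -
  let ?f = "\<lambda>i. of_int (digit i s - digit i t) * pr powi i"
  have diff: "rev_trunc s M - rev_trunc t M = (\<Sum>i\<in>{- int M..<int M}. ?f i)"
    unfolding rev_trunc_def by (simp add: sum_subtractf[symmetric] left_diff_distrib)
  show ?thesis
  proof
    assume eq: "floor_at n s = floor_at n t"
    show "N (rev_trunc s M - rev_trunc t M) \<le> w powi (- n)"
      unfolding diff
    proof (rule N_sum_le)
      fix i assume "i \<in> {- int M..<int M}"
      show "N (?f i) \<le> w powi (- n)"
      proof (cases "i < n")
        case True then show ?thesis using digit_eq[OF eq] by (simp add: less_imp_le)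
      next
        case False then show ?thesis by (intro N_digit_le) simp
      qed
    qed
  next
    assume le: "N (rev_trunc s M - rev_trunc t M) \<le> w powi (- n)"
    show "floor_at n s = floor_at n t"
    proof (rule ccontr)
      assume "floor_at n s \<noteq> floor_at n t"
      define Q where "Q = (\<lambda>j::nat. floor_at (- int M + int j) s \<noteq> floor_at (- int M + int j) t)"
      have "Q (nat (n + int M))" unfolding Q_def using \<open>floor_at n s \<noteq> floor_at n t\<close> n by simp
      define j where "j = (LEAST j. Q j)"
      have j: "Q j" "\<And>k. k < j \<Longrightarrow> \<not> Q k" "j \<le> nat (n + int M)"
        unfolding j_def
        by (rule LeastI, rule \<open>Q (nat (n + int M))\<close>, rule not_less_Least, assumption,
            rule Least_le, rule \<open>Q (nat (n + int M))\<close>)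
      have "\<not> Q 0" unfolding Q_def using floor_at_eq_0[OF s] floor_at_eq_0[OF t] by simp
      then obtain j' where j': "j = Suc j'" using j(1) by (cases j) auto
      define i where "i = - int M + int j'"
      have eq: "floor_at i s = floor_at i t" using j(2)[of j'] j' by (simp add: Q_def i_def)
      have i: "- int M \<le> i" "i < n" using j(3) j' n by (auto simp: i_def)
      have "floor_at (i + 1) s \<noteq> floor_at (i + 1) t" using j(1) by (simp add: Q_def i_def j' algebra_simps)
      then have ne: "digit i s \<noteq> digit i t" using eq floor_at_step' by metis
      have nd: "\<not> int p dvd digit i s - digit i t"
      proof
        assume "int p dvd digit i s - digit i t"
        then have "digit i s mod int p = digit i t mod int p" by (simp add: mod_eq_dvd_iff)
        then show False using ne by (simp add: digit_bounds)
      qed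
      have rest: "N (\<Sum>k\<in>{- int M..<int M} - {i}. ?f k) \<le> w powi (- (i + 1))"
      proof (rule N_sum_le)
        fix k assume "k \<in> {- int M..<int M} - {i}"
        then consider "k < i" | "i + 1 \<le> k" by force
        then show "N (?f k) \<le> w powi (- (i + 1))"
        proof cases
          case 1 then show ?thesis using digit_eq[OF eq] by (simp add: less_imp_le)
        next
          case 2 then show ?thesis by (rule N_digit_le)
        qed
      qed
      have fi: "N (?f i) = w powi (- i)" using N_powi_times_unit[OF nd] by simp
      have sum: "(\<Sum>k\<in>{- int M..<int M}. ?f k) = ?f i + (\<Sum>k\<in>{- int M..<int M} - {i}. ?f k)"
        using i n by (intro sum.remove) auto
      have "N (\<Sum>k\<in>{- int M..<int M} - {i}. ?f k) < N (?f i)"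
        using rest w_powi_less_iff[of "- (i + 1)" "- i"] unfolding fi by linarith
      then have "N (rev_trunc s M - rev_trunc t M) = w powi (- i)"
        unfolding diff sum fi[symmetric] by (rule N_isosceles)
      then show False using le i(2) by simp
    qed
  qed
qed

text \<open>The previous equivalence survives the limit because the value group is discrete: if the
  bound fails along the truncations, it fails by a factor of at least \<open>p\<close>.\<close>

lemma dist_rev_digits_le_iff:
  assumes "0 \<le> s" "0 \<le> t"
  shows "dist_p (rev_digits s) (rev_digits t) \<le> w powi (- n) \<longleftrightarrow> floor_at n s = floor_at n t"
proof -
  obtain K where K: "max s t < w powi (int K)" using ex_less_w_powi by blast
  define M where "M = max K (nat \<bar>n\<bar> + 1)"
  have ev: "N (rev_trunc s m - rev_trunc t m) \<le> w powi (- k) \<longleftrightarrow> floor_at k s = floor_at k t"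
    if "m \<ge> M" "k \<in> {n - 1, n}" for m k
  proof (rule N_rev_trunc_diff_le_iff)
    have "w powi (int K) \<le> w powi (int m)" using that by (simp add: M_def)
    then show "s < w powi (int m)" "t < w powi (int m)"
      using K max.cobounded1[of s t] max.cobounded2[of t s] by linarith+
  qed (use assms that in \<open>auto simp: M_def\<close>)
  have lim: "(\<lambda>m. N (rev_trunc s m - rev_trunc t m)) \<longlonglongrightarrow> dist_p (rev_digits s) (rev_digits t)"
    unfolding rev_digits_def using assms by (intro dist_tendsto rev_trunc_Cauchy)
  show ?thesis
  proof
    assume eq: "floor_at n s = floor_at n t"
    then have "\<forall>m\<ge>M. N (rev_trunc s m - rev_trunc t m) \<le> w powi (- n)" using ev[of _ n] by blast
    then show "dist_p (rev_digits s) (rev_digits t) \<le> w powi (- n)"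
      by (intro LIMSEQ_le_const2[OF lim] exI[of _ M]) blast
  next
    assume le: "dist_p (rev_digits s) (rev_digits t) \<le> w powi (- n)"
    show "floor_at n s = floor_at n t"
    proof (rule ccontr)
      assume ne: "floor_at n s \<noteq> floor_at n t"
      \<comment> \<open>discreteness of the value group gives a gap that the limit cannot close\<close>
      have "w powi (- n + 1) \<le> N (rev_trunc s m - rev_trunc t m)" if "m \<ge> M" for m
      proof -
        have "w powi (- n) < N (rev_trunc s m - rev_trunc t m)"
          using ev[OF that, of n] ne by (simp add: not_le[symmetric] del: not_le)
        moreover from this have "N (rev_trunc s m - rev_trunc t m) \<noteq> 0"
          using w_powi_pos[of "- n"] by linarith
        then obtain k where "N (rev_trunc s m - rev_trunc t m) = w powi k"
          using N_values by blast
        ultimately show ?thesis by simp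
      qed
      then have "w powi (- n + 1) \<le> dist_p (rev_digits s) (rev_digits t)"
        by (intro LIMSEQ_le_const[OF lim] exI[of _ M]) blast
      then have "w powi (- n + 1) \<le> w powi (- n)" using le by linarith
      then show False by simp
    qed
  qed
qed

text \<open>Digits of the expansion are found one at a time, each as a representative in the residue
  field of the remaining error; \<open>k\<close> collects them in reversed order.\<close>

lemma rational_approx:
  assumes q: "N q \<le> w powi (int M)"
  shows "\<exists>k. 0 \<le> k \<and> k < int p ^ j \<and>
    N (q - (\<Sum>i\<in>{- int M..<- int M + int j}. of_int (digit i (of_int k * w powi (int M - int j))) * pr powi i))
      \<le> w powi (int M - int j)"
proof (induction j)
  case 0
  then show ?case using q by (intro exI[of _ 0]) auto
next
  case (Suc j)
  define n where "n = int j - int M"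
  from Suc obtain k where k: "0 \<le> k" "k < int p ^ j"
    "N (q - (\<Sum>i\<in>{- int M..<n}. of_int (digit i (of_int k * w powi (- n))) * pr powi i)) \<le> w powi (- n)"
    by (auto simp: n_def)
  let ?t = "of_int k * w powi (- n)"
  obtain d where d: "d < p"
    "N (q - (\<Sum>i\<in>{- int M..<n}. of_int (digit i ?t) * pr powi i) - of_nat d * pr powi n) \<le> w powi (- (n + 1))"
    using N_digit[OF k(3)] by blast
  define k' where "k' = int p * k + int d"
  let ?t' = "of_int k' * w powi (- (n + 1))"
  have floor_at: "floor_at n ?t = k" "floor_at (n + 1) ?t' = k'"
    unfolding floor_at_def mult.assoc powi_cancel by simp_all
  then have floor_at': "floor_at n ?t' = k" using d(1) by (simp add: floor_at_step[of n] k'_def)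
  then have "digit n ?t' = int d" using floor_at_step'[of n ?t'] floor_at by (simp add: k'_def)
  moreover have "digit i ?t' = digit i ?t" if "i < n" for i
    using digit_eq[OF _ that, of ?t' ?t] floor_at floor_at' by simp
  moreover have "{- int M..<n + 1} = insert n {- int M..<n}" by (auto simp: n_def)
  ultimately have "(\<Sum>i\<in>{- int M..<n + 1}. of_int (digit i ?t') * pr powi i) =
      (\<Sum>i\<in>{- int M..<n}. of_int (digit i ?t) * pr powi i) + of_nat d * pr powi n"
    by simp
  then have "N (q - (\<Sum>i\<in>{- int M..<n + 1}. of_int (digit i ?t') * pr powi i)) \<le> w powi (- (n + 1))"
    using d(2) by (simp add: diff_diff_eq)
  moreover have "0 \<le> k' \<and> k' < int p ^ Suc j"
  proof -
    have k0: "0 \<le> k'" using k by (simp add: k'_def)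
    have "k' < int p * (k + 1)" using d(1) by (simp add: k'_def distrib_left)
    also have "\<dots> \<le> int p * int p ^ j" using k(2) by (intro mult_left_mono) auto
    finally show ?thesis using k0 by simp
  qed
  moreover have idx: "- int M + int (Suc j) = n + 1" "int M - int (Suc j) = - (n + 1)"
    by (simp_all add: n_def)
  ultimately show ?case unfolding idx by blast
qed

lemma rev_digits_dense:
  assumes "x \<in> Qp p" obtains t where "0 \<le> t" "rev_digits t \<in> pball x (- n)"
proof -
  obtain q where q: "dist_p x (iota q) \<le> w powi (- n)" using rat_dense[OF assms] by blast
  obtain K where K: "N q < w powi (int K)" using ex_less_w_powi by blast
  define M where "M = max K (nat \<bar>n\<bar>)"
  have "w powi (int K) \<le> w powi (int M)" by (simp add: M_def)
  then have "N q \<le> w powi (int M)" using K by linarith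
  moreover have nM: "- int M + int (nat (n + int M)) = n" "int M - int (nat (n + int M)) = - n"
      "0 \<le> n + int M" "- int M \<le> n" "n \<le> int M"
    by (auto simp: M_def)
  ultimately obtain k where
    k: "0 \<le> k" "k < int p ^ nat (n + int M)"
    "N (q - (\<Sum>i\<in>{- int M..<n}. of_int (digit i (of_int k * w powi (- n))) * pr powi i)) \<le> w powi (- n)"
    using rational_approx[of q M "nat (n + int M)"] unfolding nM by blast
  define t where "t = of_int k * w powi (- n)"
  have t0: "0 \<le> t" using k(1) by (simp add: t_def less_imp_le)
  have "real_of_int k < w powi (n + int M)"
  proof -
    have "real_of_int k < real_of_int (int p ^ nat (n + int M))" using k(2) by (simp only: of_int_less_iff)
    then show ?thesis using nM(3) by (simp add: power_int_def)
  qed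
  then have "t < w powi (n + int M) * w powi (- n)"
    unfolding t_def by (intro mult_strict_right_mono) auto
  also have "\<dots> = w powi (int M)" by (simp flip: power_int_add)
  finally have tM: "t < w powi (int M)" .
  let ?P = "\<Sum>i\<in>{- int M..<n}. of_int (digit i t) * pr powi i"
  have "N (q - rev_trunc t m) \<le> w powi (- n)" if "m \<ge> M" for m
  proof -
    have "N (rev_trunc t m - ?P) \<le> w powi (- n)"
      using that nM by (intro rev_trunc_tail[OF t0 tM]) auto
    then show ?thesis
      using N_diff_ultra[of q "rev_trunc t m" ?P] k(3) N_commute[of ?P] by (simp add: t_def)
  qed
  then have "dist_p (iota q) (rev_digits t) \<le> w powi (- n)"
    unfolding iota_def rev_digits_def
    by (intro LIMSEQ_le_const2[OF dist_tendsto] exI[of _ M]) (auto simp: rev_trunc_Cauchy t0)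
  then have "dist_p x (rev_digits t) \<le> w powi (- n)"
    using dist_ultra[OF assms iota_in_Qp rev_digits_in_Qp[OF t0]] q by (meson max.boundedI order_trans)
  then show ?thesis using that t0 rev_digits_in_Qp[OF t0] by (simp add: pball_def)
qed

text \<open>A ball contains a reversed number by density, which can serve as its center; being in the
  ball then means sharing the leading digits with it.\<close>

lemma vimage_rev_digits_pball:
  assumes "x \<in> Qp p"
  obtains k :: int where "0 \<le> k"
    "rev_digits -` pball x (- n) \<inter> {0..} = {of_int k * w powi (- n)..<(of_int k + 1) * w powi (- n)}"
proof -
  obtain t where t: "0 \<le> t" "rev_digits t \<in> pball x (- n)" using rev_digits_dense[OF assms] by blast
  have pball: "pball x (- n) = pball (rev_digits t) (- n)" using pball_eq[OF assms t(2)] by simp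
  have "s \<in> rev_digits -` pball x (- n) \<longleftrightarrow> floor_at n s = floor_at n t" if "0 \<le> s" for s
    unfolding pball using that t(1) dist_rev_digits_le_iff[OF t(1) that, of n] rev_digits_in_Qp[OF that]
    by (auto simp: pball_def)
  moreover have "floor_at n s = floor_at n t \<longleftrightarrow> s \<in> {of_int (floor_at n t) * w powi (- n)..<(of_int (floor_at n t) + 1) * w powi (- n)}" for s
    unfolding floor_at_def[of n s] floor_eq_iff by (simp add: power_int_minus field_simps)
  moreover have "0 \<le> floor_at n t" using t(1) by (simp add: floor_at_def less_imp_le)
  moreover have "0 \<le> s" if "s \<in> {of_int (floor_at n t) * w powi (- n)..<(of_int (floor_at n t) + 1) * w powi (- n)}" for s
  proof -
    have "0 \<le> of_int (floor_at n t) * w powi (- n)" using \<open>0 \<le> floor_at n t\<close> by (simp add: less_imp_le)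
    then show ?thesis using that by simp
  qed
  ultimately have "rev_digits -` pball x (- n) \<inter> {0..} =
      {of_int (floor_at n t) * w powi (- n)..<(of_int (floor_at n t) + 1) * w powi (- n)}"
    by blast
  then show ?thesis using that \<open>0 \<le> floor_at n t\<close> by blast
qed

definition haar0 :: "padic measure" where
  "haar0 = distr (restrict_space lborel {0..}) (padic_borel p) rev_digits"

lemma rev_digits_measurable: "rev_digits \<in> measurable (restrict_space lborel {0..}) (padic_borel p)"
proof (rule measurable_sigma_sets[OF sets_padic_borel balls_subset])
  show "rev_digits \<in> space (restrict_space lborel {0..}) \<rightarrow> Qp p"
    by (auto simp: space_restrict_space)
  fix B assume "B \<in> balls"
  then show "rev_digits -` B \<inter> space (restrict_space lborel {0..}) \<in> sets (restrict_space lborel {0..})"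
  proof (elim ballsE)
    fix x n assume x: "x \<in> Qp p" and B: "B = pball x n"
    obtain k where "0 \<le> k" "rev_digits -` B \<inter> {0..} = {of_int k * w powi n..<(of_int k + 1) * w powi n}"
      using vimage_rev_digits_pball[OF x, of "- n"] B by auto
    then have "rev_digits -` B \<inter> {0..} \<in> sets lborel" by simp
    then show ?thesis by (auto simp: space_restrict_space sets_restrict_space intro!: image_eqI[where x="rev_digits -` B \<inter> {0..}"])
  qed simp
qed

lemma sets_haar0: "sets haar0 = sigma_sets (Qp p) balls" and space_haar0: "space haar0 = Qp p"
  by (simp_all add: haar0_def sets_padic_borel space_padic_borel)

lemma emeasure_haar0_pball:
  assumes x: "x \<in> Qp p" shows "emeasure haar0 (pball x n) = ennreal (w powi n)"
proof -
  obtain k where k: "0 \<le> k"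
    "rev_digits -` pball x n \<inter> {0..} = {of_int k * w powi n..<(of_int k + 1) * w powi n}"
    using vimage_rev_digits_pball[OF x, of "- n"] by auto
  have "pball x n \<in> sets (padic_borel p)"
    unfolding sets_padic_borel using pball_in_balls[OF x] by (rule sigma_sets.Basic)
  then have "emeasure haar0 (pball x n) = emeasure (restrict_space lborel {0..}) (rev_digits -` pball x n \<inter> {0..})"
    unfolding haar0_def by (subst emeasure_distr[OF rev_digits_measurable]) (simp_all add: space_restrict_space)
  also have "\<dots> = emeasure lborel (rev_digits -` pball x n \<inter> {0..})"
    by (rule emeasure_restrict_space) auto
  also have "\<dots> = ennreal (w powi n)"
    unfolding k(2) by (simp add: distrib_right less_imp_le)
  finally show ?thesis .
qed

lemma Zp_eq_pball: "Zp p = pball (iota 0) 0"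
  by (auto simp: Zp_def pball_def norm_eq_dist dist_commute)

text \<open>A measure giving all balls of the same radius the same mass is translation invariant,
  as the balls form a generator closed under intersection.\<close>

lemma haar0_is_normalized_haar: "is_normalized_haar p haar0"
  unfolding is_normalized_haar_def
proof (intro conjI ballI)
  show "space haar0 = Qp p" "sets haar0 = sets (padic_borel p)"
    by (simp_all add: space_haar0 sets_haar0 sets_padic_borel)
  show "emeasure haar0 (Zp p) = 1" by (simp add: Zp_eq_pball emeasure_haar0_pball)
  fix a A assume a: "a \<in> Qp p" and A: "A \<in> sets haar0"
  let ?T = "\<lambda>y. padic_diff p y a"
  have image_eq: "?T -` B \<inter> Qp p = padic_add p a ` B" if "B \<subseteq> Qp p" for B
  proof
    show "?T -` B \<inter> Qp p \<subseteq> padic_add p a ` B"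
      using padic_add_diff(1)[OF a, symmetric] by blast
    show "padic_add p a ` B \<subseteq> ?T -` B \<inter> Qp p"
      using that padic_add_diff(2)[OF a] padic_add_in_Qp[OF a] by auto
  qed
  have ball_img: "\<exists>y\<in>Qp p. padic_add p a ` pball x n = pball y n" if "x \<in> Qp p" for x n
    using add_image_pball[OF a that] padic_add_in_Qp[OF a that] by blast
  have meas: "?T \<in> measurable haar0 haar0"
  proof (rule measurable_sigma_sets[OF sets_haar0 balls_subset])
    show "?T \<in> space haar0 \<rightarrow> Qp p" using a by (auto simp: space_haar0)
    fix B assume "B \<in> balls"
    then show "?T -` B \<inter> space haar0 \<in> sets haar0"
    proof (elim ballsE)
      fix x n assume x: "x \<in> Qp p" and B: "B = pball x n"
      have "?T -` B \<inter> space haar0 = padic_add p a ` pball x n"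
        unfolding space_haar0 B by (rule image_eq[OF pball_subset_Qp])
      then show ?thesis
        using ball_img[OF x] pball_in_balls unfolding sets_haar0 by (metis sigma_sets.Basic)
    qed simp
  qed
  have "distr haar0 haar0 ?T = haar0"
  proof (rule measure_eqI_generator_eq[OF Int_stable_balls balls_subset, where A = "\<lambda>i. pball (iota 0) (int i)"])
    fix B assume B: "B \<in> balls"
    then have "B \<in> sets haar0" unfolding sets_haar0 by (rule sigma_sets.Basic)
    then have *: "emeasure (distr haar0 haar0 ?T) B = emeasure haar0 (padic_add p a ` B)"
      using B balls_subset by (subst emeasure_distr[OF meas]) (auto simp: space_haar0 image_eq)
    from B show "emeasure (distr haar0 haar0 ?T) B = emeasure haar0 B"
    proof (cases rule: ballsE)
      case (2 x n)
      then obtain y where "y \<in> Qp p" "padic_add p a ` B = pball y n" using ball_img by blast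
      then show ?thesis using * 2 by (simp add: emeasure_haar0_pball)
    qed (simp add: *)
  next
    show "(\<Union>i. pball (iota 0) (int i)) = Qp p"
    proof
      show "Qp p \<subseteq> (\<Union>i. pball (iota 0) (int i))"
      proof
        fix x assume x: "x \<in> Qp p"
        obtain i where "dist_p (iota 0) x < w powi (int i)" using ex_less_w_powi by blast
        then show "x \<in> (\<Union>i. pball (iota 0) (int i))" using x by (auto simp: pball_def intro!: exI[of _ i] less_imp_le)
      qed
    qed (use pball_subset_Qp in auto)
    have "emeasure (distr haar0 haar0 ?T) (pball (iota 0) (int i)) = emeasure haar0 (padic_add p a ` pball (iota 0) (int i))" for i
      by (subst emeasure_distr[OF meas])
        (auto simp: space_haar0 image_eq pball_subset_Qp sets_haar0 intro!: sigma_sets.Basic pball_in_balls)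
    then show "emeasure (distr haar0 haar0 ?T) (pball (iota 0) (int i)) \<noteq> \<infinity>" for i
      using ball_img[of "iota 0" "int i"] emeasure_haar0_pball by (metis ennreal_neq_top iota_in_Qp infinity_ennreal_def)
  qed (auto simp: sets_haar0 pball_in_balls)
  then have "emeasure haar0 A = emeasure (distr haar0 haar0 ?T) A" by simp
  also have "\<dots> = emeasure haar0 (?T -` A \<inter> Qp p)"
    using emeasure_distr[OF meas A] by (simp add: space_haar0)
  also have "?T -` A \<inter> Qp p = padic_add p a ` A"
    using image_eq sets.sets_into_space[OF A] by (simp add: space_haar0)
  finally show "emeasure haar0 (padic_add p a ` A) = emeasure haar0 A" by simp
qed

lemma padic_haar_is_normalized_haar: "is_normalized_haar p (padic_haar p)"
  unfolding padic_haar_def using haar0_is_normalized_haar by (rule someI)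

end

section \<open>Radial integrals\<close>

context p_adic begin

abbreviation haar :: "padic measure" where "haar \<equiv> padic_haar p"

lemma space_haar: "space haar = Qp p"
  and sets_haar: "sets haar = sigma_sets (Qp p) balls"
  and haar_translate: "a \<in> Qp p \<Longrightarrow> A \<in> sets haar \<Longrightarrow> emeasure haar (padic_add p a ` A) = emeasure haar A"
  and haar_Zp: "emeasure haar (Zp p) = 1"
  using padic_haar_is_normalized_haar by (auto simp: is_normalized_haar_def sets_padic_borel)

lemma pball_sets [simp]: "x \<in> Qp p \<Longrightarrow> pball x n \<in> sets haar"
  unfolding sets_haar by (intro sigma_sets.Basic pball_in_balls)

lemma emeasure_pball_translate:
  assumes "x \<in> Qp p" shows "emeasure haar (pball x n) = emeasure haar (pball (iota 0) n)"
proof -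
  have "padic_add p x (iota 0) = x"
    using assms by (elim Qp_cases) (simp add: iota_def padic_add_Qp_class)
  then show ?thesis
    using haar_translate[OF assms pball_sets[OF iota_in_Qp[of 0]], of n] add_image_pball[OF assms iota_in_Qp[of 0], of n]
    by simp
qed

text \<open>The digits represent the cosets of the smaller ball in the larger one.\<close>

lemma pball_split:
  "pball (iota 0) (n + 1) = (\<Union>d<p. pball (iota (of_nat d * pr powi (- (n + 1)))) n)" (is "_ = (\<Union>d<p. ?B d)")
  "disjoint_family_on (\<lambda>d. pball (iota (of_nat d * pr powi (- (n + 1)))) n) {..<p}"
proof -
  let ?c = "\<lambda>d::nat. of_nat d * pr powi (- (n + 1))"
  have in_B: "?B d = {y \<in> Qp p. dist_p (iota (?c d)) y \<le> w powi n}" for d by (simp add: pball_def)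
  show "pball (iota 0) (n + 1) = (\<Union>d<p. ?B d)"
  proof
    show "pball (iota 0) (n + 1) \<subseteq> (\<Union>d<p. ?B d)"
    proof
      fix x assume "x \<in> pball (iota 0) (n + 1)"
      then have x: "x \<in> Qp p" "dist_p (iota 0) x \<le> w powi (n + 1)" by (auto simp: pball_def)
      obtain q where q: "dist_p x (iota q) \<le> w powi n" using rat_dense[OF x(1)] by blast
      have "dist_p (iota 0) (iota q) \<le> max (dist_p (iota 0) x) (dist_p x (iota q))"
        using dist_ultra x by blast
      also have "\<dots> \<le> w powi (n + 1)"
        using x(2) q w_powi_le_iff[of n "n + 1"] by (auto intro: order_trans)
      finally have "N q \<le> w powi (- (- (n + 1)))" by (simp add: dist_iota add.commute)
      then obtain d where d: "d < p" "N (q - ?c d) \<le> w powi (- (- (n + 1) + 1))"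
        by (rule N_digit)
      then have "dist_p (iota (?c d)) (iota q) \<le> w powi n" by (simp add: dist_iota N_commute)
      then have "dist_p (iota (?c d)) x \<le> w powi n"
        using dist_ultra[of "iota (?c d)" "iota q" x] q x dist_commute[of x "iota q"] by simp
      then show "x \<in> (\<Union>d<p. ?B d)" using x d(1) unfolding in_B by blast
    qed
    show "(\<Union>d<p. ?B d) \<subseteq> pball (iota 0) (n + 1)"
    proof
      fix x assume "x \<in> (\<Union>d<p. ?B d)"
      then obtain d where d: "x \<in> Qp p" "dist_p (iota (?c d)) x \<le> w powi n" unfolding in_B by blast
      have "N (?c d) \<le> w powi (n + 1)"
        using N_powi_times_of_int_le[of "int d" "- (n + 1)"] by (simp add: add.commute)
      then have "dist_p (iota 0) (iota (?c d)) \<le> w powi (n + 1)" by (simp add: dist_iota)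
      moreover have "w powi n \<le> w powi (n + 1)" by simp
      ultimately have "dist_p (iota 0) x \<le> w powi (n + 1)"
        using dist_ultra[of "iota 0" "iota (?c d)" x] d by (smt (verit) iota_in_Qp)
      then show "x \<in> pball (iota 0) (n + 1)" using d by (simp add: pball_def)
    qed
  qed
  show "disjoint_family_on ?B {..<p}"
    unfolding disjoint_family_on_def
  proof (intro ballI impI)
    fix d e :: nat assume de: "d \<in> {..<p}" "e \<in> {..<p}" "d \<noteq> e"
    show "?B d \<inter> ?B e = {}"
    proof (rule ccontr)
      assume "?B d \<inter> ?B e \<noteq> {}"
      then obtain x where x: "x \<in> Qp p" "dist_p (iota (?c d)) x \<le> w powi n" "dist_p (iota (?c e)) x \<le> w powi n"
        unfolding in_B by blast
      then have "N (?c d - ?c e) \<le> w powi n"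
        using dist_ultra[of "iota (?c d)" x "iota (?c e)"] dist_commute[of x "iota (?c e)"]
        by (simp add: dist_iota)
      moreover have "\<not> int p dvd int d - int e"
      proof
        assume "int p dvd int d - int e"
        then have "int d mod int p = int e mod int p" by (simp add: mod_eq_dvd_iff)
        then show False using de by simp
      qed
      then have "N (?c d - ?c e) = w powi (n + 1)"
        using N_powi_times_unit[of "int d - int e" "- (n + 1)"] by (simp add: left_diff_distrib add.commute)
      ultimately show False by simp
    qed
  qed
qed

lemma emeasure_pball_step: "emeasure haar (pball (iota 0) (n + 1)) = ennreal w * emeasure haar (pball (iota 0) n)"
proof -
  have "emeasure haar (pball (iota 0) (n + 1)) = (\<Sum>d<p. emeasure haar (pball (iota (of_nat d * pr powi (- (n + 1)))) n))"
    unfolding pball_split(1) by (rule sum_emeasure[symmetric]) (use pball_split(2) in auto)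
  also have "\<dots> = (\<Sum>d<p. emeasure haar (pball (iota 0) n))"
    by (rule sum.cong[OF refl], rule emeasure_pball_translate, rule iota_in_Qp)
  also have "\<dots> = of_nat p * emeasure haar (pball (iota 0) n)"
    by simp
  finally show ?thesis by (simp add: ennreal_of_nat_eq_real_of_nat)
qed

text \<open>The disjoint decomposition into translates multiplies the measure by \<open>p\<close> at each step, so the
  normalization at radius 1 fixes all values in both directions.\<close>

lemma emeasure_pball_0: "emeasure haar (pball (iota 0) n) = ennreal (w powi n)"
proof (induction n rule: int_induct[where k = 0])
  case base
  then show ?case using haar_Zp by (simp add: Zp_eq_pball)
next
  case (step1 n)
  then show ?case unfolding emeasure_pball_step
    by (simp add: ennreal_mult[symmetric] less_imp_le power_int_add mult.commute)
next
  case (step2 n)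
  have "ennreal w * emeasure haar (pball (iota 0) (n - 1)) = ennreal (w powi n)"
    using emeasure_pball_step[of "n - 1"] step2 by simp
  also have "\<dots> = ennreal w * ennreal (w powi (n - 1))"
    by (simp add: ennreal_mult[symmetric] less_imp_le power_int_diff)
  finally show ?case by (auto simp: ennreal_mult_cancel_left)
qed

definition sphere_p :: "int \<Rightarrow> padic set" where "sphere_p n = {y \<in> Qp p. norm_p y = w powi n}"

lemma sphere_eq: "sphere_p n = pball (iota 0) n - pball (iota 0) (n - 1)"
proof (intro set_eqI iffI)
  fix y assume "y \<in> pball (iota 0) n - pball (iota 0) (n - 1)"
  then have y: "y \<in> Qp p" "norm_p y \<le> w powi n" "\<not> norm_p y \<le> w powi (n - 1)"
    by (auto simp: pball_def norm_eq_dist dist_commute)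
  then have "norm_p y \<noteq> 0" using w_powi_pos[of "n - 1"] by linarith
  then obtain k where "norm_p y = w powi k" using norm_values[OF y(1)] by blast
  then have "norm_p y = w powi n" using y by simp
  then show "y \<in> sphere_p n" using y by (simp add: sphere_p_def)
qed (auto simp: sphere_p_def pball_def norm_eq_dist dist_commute)

lemma sphere_sets [simp]: "sphere_p n \<in> sets haar"
  unfolding sphere_eq by (intro sets.Diff) simp_all

lemma emeasure_sphere: "emeasure haar (sphere_p n) = ennreal ((1 - 1 / w) * w powi n)"
proof -
  have "emeasure haar (sphere_p n) = ennreal (w powi n) - ennreal (w powi (n - 1))"
    unfolding sphere_eq by (subst emeasure_Diff) (auto simp: emeasure_pball_0 pball_mono)
  also have "\<dots> = ennreal (w powi n - w powi (n - 1))"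
    by (rule ennreal_minus) (simp add: less_imp_le)
  also have "w powi n - w powi (n - 1) = (1 - 1 / w) * w powi n"
    by (simp add: power_int_diff left_diff_distrib)
  finally show ?thesis .
qed

lemma measure_sphere: "measure haar (sphere_p n) = (1 - 1 / w) * w powi n"
  using w_gt_1 by (simp add: measure_def emeasure_sphere enn2real_ennreal less_imp_le)

lemma zero_null: "{iota 0} \<in> sets haar" "emeasure haar {iota 0} = 0"
proof -
  have eq: "{iota 0} = (\<Inter>n. pball (iota 0) (- int n))"
  proof
    show "(\<Inter>n. pball (iota 0) (- int n)) \<subseteq> {iota 0}"
    proof
      fix x assume "x \<in> (\<Inter>n. pball (iota 0) (- int n))"
      then have x: "x \<in> Qp p" "\<And>n. dist_p (iota 0) x \<le> w powi (- int n)" by (auto simp: pball_def)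
      have "\<not> dist_p (iota 0) x > 0" using x(2) ex_w_powi_less by (metis linorder_not_le)
      then show "x \<in> {iota 0}" using x(1) dist_nonneg[of "iota 0" x] dist_eq_0_iff[of "iota 0" x] by simp
    qed
  qed (use self_in_pball in auto)
  show sets: "{iota 0} \<in> sets haar" unfolding eq by (intro sets.countable_INT) auto
  have le: "emeasure haar {iota 0} \<le> ennreal (w powi (- int n))" for n
    unfolding emeasure_pball_0[symmetric] by (rule emeasure_mono) (use self_in_pball in auto)
  show "emeasure haar {iota 0} = 0"
  proof (rule ccontr)
    assume "emeasure haar {iota 0} \<noteq> 0"
    then have "0 < enn2real (emeasure haar {iota 0})"
      using le[of 0] by (auto simp: enn2real_positive_iff zero_less_iff_neq_zero order_le_less_trans)
    then obtain n where "w powi (- int n) < enn2real (emeasure haar {iota 0})" using ex_w_powi_less by blast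
    moreover have "enn2real (emeasure haar {iota 0}) \<le> w powi (- int n)"
      using le[of n] by (intro enn2real_leI) (auto simp: less_imp_le)
    ultimately show False by simp
  qed
qed

text \<open>The spheres are disjoint, so pointwise at most one term of the series is nonzero, and the
  termwise integrals converge absolutely by assumption.\<close>

lemma has_bochner_integral_shells:
  fixes h :: "int \<Rightarrow> real" and j :: "nat \<Rightarrow> int"
  assumes j: "inj j" and summ: "summable (\<lambda>i. \<bar>h (j i) * w powi j i\<bar>)"
    and A: "(\<lambda>i. h (j i) * w powi j i) sums A"
  shows "has_bochner_integral haar (\<lambda>y. \<Sum>i. h (j i) * indicator (sphere_p (j i)) y) ((1 - 1 / w) * A)"
proof -
  let ?f = "\<lambda>i y. h (j i) * indicator (sphere_p (j i)) y :: real"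
  have int: "integrable haar (?f i)" for i
    by (intro integrable_mult_right integrable_real_indicator) (auto simp: emeasure_sphere)
  have sub: "sphere_p n \<inter> space haar = sphere_p n" for n by (auto simp: sphere_p_def space_haar)
  have I: "integral\<^sup>L haar (?f i) = (1 - 1 / w) * (h (j i) * w powi j i)" for i
    by (simp add: sub measure_sphere)
  have "norm (?f i y) = \<bar>h (j i)\<bar> * indicator (sphere_p (j i)) y" for i y
    by (simp add: abs_mult)
  then have nI: "(\<integral>y. norm (?f i y) \<partial>haar) = (1 - 1 / w) * \<bar>h (j i) * w powi j i\<bar>" for i
    by (simp add: sub measure_sphere abs_mult less_imp_le)
  have fin: "summable (\<lambda>i. norm (?f i y))" for y
  proof (rule summable_finite)
    show "finite {i. y \<in> sphere_p (j i)}"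
    proof (rule finite_subset)
      show "{i. y \<in> sphere_p (j i)} \<subseteq> {i. j i = (THE k. norm_p y = w powi k)}"
        by (auto simp: sphere_p_def)
      show "finite {i. j i = (THE k. norm_p y = w powi k)}"
        using finite_vimageI[OF _ j, of "{THE k. norm_p y = w powi k}"] by (simp add: vimage_def)
    qed
  qed auto
  have s: "summable (\<lambda>i. \<integral>y. norm (?f i y) \<partial>haar)" unfolding nI using summ by (rule summable_mult)
  have "integrable haar (\<lambda>y. \<Sum>i. ?f i y)" by (rule integrable_suminf[OF int _ s]) (use fin in auto)
  moreover have "(\<lambda>i. integral\<^sup>L haar (?f i)) sums (\<integral>y. (\<Sum>i. ?f i y) \<partial>haar)"
    by (rule sums_integral[OF int _ s]) (use fin in auto)
  then have "(\<integral>y. (\<Sum>i. ?f i y) \<partial>haar) = (1 - 1 / w) * A"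
    unfolding I using sums_mult[OF A, of "1 - 1 / w"] sums_unique2 by blast
  ultimately show ?thesis by (simp add: has_bochner_integral_iff)
qed

lemma suminf_shells:
  assumes "inj j" "y \<in> Qp p" "norm_p y = w powi k"
  shows "(\<Sum>i. h (j i) * indicator (sphere_p (j i)) y) = (if k \<in> range j then h k else (0::real))"
proof (cases "k \<in> range j")
  case True
  then obtain i0 where i0: "k = j i0" by blast
  have "(\<lambda>i. h (j i) * indicator (sphere_p (j i)) y) = (\<lambda>i. if i = i0 then h k else 0)"
    using assms i0 by (auto simp: sphere_p_def indicator_def fun_eq_iff dest: injD)
  then show ?thesis using True sums_single[of i0 "\<lambda>_. h k"] sums_unique by metis
next
  case False
  then have "(\<lambda>i. h (j i) * indicator (sphere_p (j i)) y) = (\<lambda>i. 0)"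
    using assms by (auto simp: sphere_p_def indicator_def fun_eq_iff)
  then show ?thesis using False by simp
qed

text \<open>Integration in polar coordinates. The split at an arbitrary index \<open>m\<close> lets the sums below and
  above the sphere of a given point be treated separately. The origin belongs to neither; it is a
  null set, being contained in balls of arbitrarily small measure.\<close>

lemma has_bochner_integral_radial:
  fixes F :: "padic \<Rightarrow> real"
  assumes F: "\<And>y j. y \<in> Qp p \<Longrightarrow> norm_p y = w powi j \<Longrightarrow> F y = h j"
    and sA: "summable (\<lambda>i. \<bar>h (m - 1 - int i) * w powi (m - 1 - int i)\<bar>)"
    and sB: "summable (\<lambda>i. \<bar>h (m + int i) * w powi (m + int i)\<bar>)"
    and A: "(\<lambda>i. h (m - 1 - int i) * w powi (m - 1 - int i)) sums A"
    and B: "(\<lambda>i. h (m + int i) * w powi (m + int i)) sums B"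
  shows "has_bochner_integral haar F ((1 - 1 / w) * (A + B))"
proof -
  let ?j = "\<lambda>i::nat. m - 1 - int i" and ?k = "\<lambda>i::nat. m + int i"
  let ?G = "\<lambda>y. (\<Sum>i. h (?j i) * indicator (sphere_p (?j i)) y) + (\<Sum>i. h (?k i) * indicator (sphere_p (?k i)) y)"
  have inj: "inj ?j" "inj ?k" by (auto simp: inj_def)
  have "has_bochner_integral haar ?G ((1 - 1 / w) * A + (1 - 1 / w) * B)"
    by (intro has_bochner_integral_add has_bochner_integral_shells inj sA sB A B)
  moreover have "?G y = F y" if y: "y \<in> space haar" "y \<notin> {iota 0}" for y
  proof -
    have yQ: "y \<in> Qp p" using y space_haar by simp
    then obtain k where k: "norm_p y = w powi k" using norm_values norm_eq_0_iff y(2) by blast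
    have "k \<in> range ?j \<longleftrightarrow> k \<notin> range ?k"
    proof (cases "k < m")
      case True
      then have "k = ?j (nat (m - 1 - k))" by simp
      then have "k \<in> range ?j" by (rule range_eqI)
      then show ?thesis using True by auto
    next
      case False
      then have "k = ?k (nat (k - m))" by simp
      then have "k \<in> range ?k" by (rule range_eqI)
      then show ?thesis using False by auto
    qed
    then show ?thesis
      unfolding suminf_shells[OF inj(1) yQ k] suminf_shells[OF inj(2) yQ k] F[OF yQ k] by auto
  qed
  ultimately show ?thesis
    using has_bochner_integral_discrete_difference[of "{iota 0}" haar ?G F] zero_null
    by (simp add: distrib_left)
qed

lemma D_integrand_real:
  fixes u :: "real \<Rightarrow> real"
  assumes "x \<in> Qp p" "y \<in> Qp p"
  shows "D_integrand p 2 (\<lambda>x. complex_of_real (u (norm_p x))) x y =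
    complex_of_real ((u (norm_p y) - u (norm_p x)) / dist_p x y ^ 3)"
proof -
  have "dist_p x y powr (2 + 1) = dist_p x y ^ 3"
    using dist_nonneg[of x y] by simp
  then show ?thesis
    using assms by (simp add: D_integrand_def dist_eq_norm[symmetric])
qed

lemma has_bochner_integral_cong_Qp:
  fixes F :: "padic \<Rightarrow> real"
  assumes "has_bochner_integral haar F I"
    and "\<And>y. y \<in> Qp p \<Longrightarrow> G y = complex_of_real (F y)"
  shows "integrable haar G \<and> integral\<^sup>L haar G = complex_of_real I"
proof -
  have "has_bochner_integral haar (\<lambda>y. complex_of_real (F y)) (complex_of_real I)"
    using assms(1) by (rule has_bochner_integral_of_real)
  then have "has_bochner_integral haar G (complex_of_real I)"
    by (subst has_bochner_integral_cong[OF refl assms(2) refl]) (simp_all add: space_haar)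
  then show ?thesis by (simp add: has_bochner_integral_iff)
qed

lemma geometric_w_sums: "(\<lambda>i. (1 / w) ^ i) sums (w / (w - 1))"
  using geometric_sums[of "1 / w"] w_gt_1 by (simp add: field_simps)

lemma geometric_w2_sums: "(\<lambda>i. (1 / w\<^sup>2) ^ i) sums (w\<^sup>2 / (w\<^sup>2 - 1))"
proof -
  have "w\<^sup>2 > 1" using w_gt_1 by (simp add: one_less_power)
  then show ?thesis using geometric_sums[of "1 / w\<^sup>2"] by (simp add: field_simps)
qed

text \<open>Away from the sphere of \<open>x\<close> the ultrametric inequality makes \<open>|x - y|\<close> a function
  of \<open>|y|\<close>, and on that sphere the numerator vanishes: the whole integrand is radial.\<close>

lemma D_integral_nonzero:
  fixes u :: "real \<Rightarrow> real"
  assumes x: "x \<in> Qp p" "norm_p x = w powi m"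
    and U: "\<And>j. \<bar>u (w powi j)\<bar> \<le> U"
    and z: "z = w powi m"
    and T: "(\<lambda>i. z / w ^ Suc i * u (z / w ^ Suc i)) sums T"
    and R: "(\<lambda>i. u (z * w ^ Suc i) / (z * w ^ Suc i)\<^sup>2) sums R"
  defines "G \<equiv> D_integrand p 2 (\<lambda>x. complex_of_real (u (norm_p x))) x"
  shows "integrable haar G \<and> integral\<^sup>L haar G = complex_of_real
    ((1 - 1 / w) * ((T - u z * (z / (w - 1))) / z ^ 3 + (R - u z / (z\<^sup>2 * (w\<^sup>2 - 1)))))"
proof -
  have w1: "w > 1" "w\<^sup>2 > 1" using w_gt_1 by (auto simp: one_less_power)
  have z0: "z > 0" using z by simp
  \<comment> \<open>the maximum is \<open>|x - y|\<close> except on the sphere of \<open>x\<close>, where the numerator is 0\<close>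
  define h where "h = (\<lambda>j. (u (w powi j) - u z) / (max z (w powi j)) ^ 3)"
  have lower: "w powi (m - 1 - int i) = z / w ^ Suc i" for i
    using z by (simp add: power_int_diff)
  have upper: "w powi (m + int i) = z * w ^ i" for i
    using z by (simp add: power_int_add)
  have hlow: "h (m - 1 - int i) * w powi (m - 1 - int i) =
      (z / w ^ Suc i * u (z / w ^ Suc i) - u z * (z / w ^ Suc i)) / z ^ 3" for i
  proof -
    have "w powi (m - 1 - int i) \<le> z" unfolding z by simp
    then have "max z (w powi (m - 1 - int i)) = z" by simp
    then show ?thesis unfolding h_def lower by (simp add: algebra_simps)
  qed
  have hup: "h (m + int i) * w powi (m + int i) =
      u (z * w ^ i) / (z * w ^ i)\<^sup>2 - u z / (z * w ^ i)\<^sup>2" for i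
  proof -
    have "z \<le> w powi (m + int i)" unfolding z by simp
    then have "max z (w powi (m + int i)) = w powi (m + int i)" by simp
    then show ?thesis unfolding h_def upper using z0
      by (simp add: power2_eq_square power3_eq_cube diff_divide_distrib[symmetric])
  qed
  have geo: "(\<lambda>i. z / w ^ Suc i) sums (z / (w - 1))"
    using sums_mult[OF geometric_w_sums, of "z / w"] w1 by (simp add: power_divide field_simps)
  have geo2: "(\<lambda>i. 1 / (z * w ^ Suc i)\<^sup>2) sums (1 / (z\<^sup>2 * (w\<^sup>2 - 1)))"
    using sums_mult[OF geometric_w2_sums, of "1 / (z\<^sup>2 * w\<^sup>2)"] w1 z0
    by (simp add: power_divide power_mult_distrib power_mult[symmetric] mult_ac)
  have uz: "\<bar>u (w powi j) - u z\<bar> \<le> 2 * U" for j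
    unfolding z using U[of j] U[of m] by linarith
  have "has_bochner_integral haar (\<lambda>y. (u (norm_p y) - u (norm_p x)) / dist_p x y ^ 3)
    ((1 - 1 / w) * ((T - u z * (z / (w - 1))) / z ^ 3 + (R - u z / (z\<^sup>2 * (w\<^sup>2 - 1)))))"
  proof (rule has_bochner_integral_radial[where h = h and m = m])
    show "summable (\<lambda>i. \<bar>h (m - 1 - int i) * w powi (m - 1 - int i)\<bar>)"
    proof (rule summable_comparison_test')
      show "summable (\<lambda>i. 2 * U / z ^ 3 * (z / w ^ Suc i))"
        using geo by (intro summable_mult sums_summable)
      fix i :: nat
      have "\<bar>h (m - 1 - int i) * w powi (m - 1 - int i)\<bar> = \<bar>u (w powi (m - 1 - int i)) - u z\<bar> * (z / w ^ Suc i) / z ^ 3"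
      proof -
        have "z / w ^ Suc i * u (z / w ^ Suc i) - u z * (z / w ^ Suc i) = (u (z / w ^ Suc i) - u z) * (z / w ^ Suc i)"
          by (subst left_diff_distrib) (simp only: mult.commute)
        moreover have "\<bar>z / w ^ Suc i\<bar> = z / w ^ Suc i" "\<bar>z ^ 3\<bar> = z ^ 3" using z0 by simp_all
        ultimately show ?thesis
          unfolding hlow unfolding lower by (simp only: abs_mult abs_divide)
      qed
      also have "\<dots> \<le> 2 * U * (z / w ^ Suc i) / z ^ 3"
        using uz z0 by (intro divide_right_mono mult_right_mono) auto
      finally show "norm \<bar>h (m - 1 - int i) * w powi (m - 1 - int i)\<bar> \<le> 2 * U / z ^ 3 * (z / w ^ Suc i)"
        by (simp add: mult_ac)
    qed
    show "summable (\<lambda>i. \<bar>h (m + int i) * w powi (m + int i)\<bar>)"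
    proof (subst summable_Suc_iff[symmetric], rule summable_comparison_test')
      show "summable (\<lambda>i. 2 * U * (1 / (z * w ^ Suc i)\<^sup>2))"
        using geo2 by (intro summable_mult sums_summable)
      fix i :: nat
      have "\<bar>h (m + int (Suc i)) * w powi (m + int (Suc i))\<bar> = \<bar>u (w powi (m + int (Suc i))) - u z\<bar> / (z * w ^ Suc i)\<^sup>2"
        unfolding hup unfolding upper using z0 by (simp add: diff_divide_distrib[symmetric])
      also have "\<dots> \<le> 2 * U / (z * w ^ Suc i)\<^sup>2"
        using uz by (intro divide_right_mono) auto
      finally show "norm \<bar>h (m + int (Suc i)) * w powi (m + int (Suc i))\<bar> \<le> 2 * U * (1 / (z * w ^ Suc i)\<^sup>2)"
        by simp
    qed
    show "(\<lambda>i. h (m - 1 - int i) * w powi (m - 1 - int i)) sums ((T - u z * (z / (w - 1))) / z ^ 3)"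
      unfolding hlow by (intro sums_divide sums_diff T sums_mult geo)
    show "(\<lambda>i. h (m + int i) * w powi (m + int i)) sums (R - u z / (z\<^sup>2 * (w\<^sup>2 - 1)))"
    proof -
      have "(\<lambda>i. u (z * w ^ Suc i) / (z * w ^ Suc i)\<^sup>2 - u z * (1 / (z * w ^ Suc i)\<^sup>2)) sums
          (R - u z * (1 / (z\<^sup>2 * (w\<^sup>2 - 1))))"
        by (intro sums_diff R sums_mult geo2)
      then have "(\<lambda>i. h (m + int (Suc i)) * w powi (m + int (Suc i))) sums (R - u z / (z\<^sup>2 * (w\<^sup>2 - 1)))"
        unfolding hup by simp
      moreover have "h (m + int 0) * w powi (m + int 0) = 0" unfolding hup by simp
      ultimately show ?thesis
        using sums_Suc_iff[of "\<lambda>i. h (m + int i) * w powi (m + int i)"] by simp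
    qed
    fix y assume y: "y \<in> Qp p"
    fix j assume j: "norm_p y = w powi j"
    show "(u (norm_p y) - u (norm_p x)) / dist_p x y ^ 3 = h j"
    proof (cases "norm_p x = norm_p y")
      case True
      then show ?thesis using x(2) j z by (simp add: h_def)
    next
      case False
      then show ?thesis using dist_eq_max[OF x(1) y False] x(2) j z by (simp add: h_def)
    qed
  qed
  then show ?thesis
    unfolding G_def by (rule has_bochner_integral_cong_Qp) (rule D_integrand_real[OF x(1)])
qed

text \<open>At the origin the numerator must be summed together with the kernel: only the difference \<open>u z - u 0\<close>
  is small enough to compensate \<open>z^(-3)\<close>.\<close>

lemma D_integral_zero:
  fixes u :: "real \<Rightarrow> real"
  assumes sS: "summable (\<lambda>i. \<bar>(u (1 / w ^ i) - u 0) * (w ^ i)\<^sup>2\<bar>)"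
    and S: "(\<lambda>i. (u (1 / w ^ i) - u 0) * (w ^ i)\<^sup>2) sums S"
    and U: "\<And>j. \<bar>u (w powi j)\<bar> \<le> U"
    and R: "(\<lambda>i. u (w ^ Suc i) / (w ^ Suc i)\<^sup>2) sums R"
  defines "G \<equiv> D_integrand p 2 (\<lambda>x. complex_of_real (u (norm_p x))) (iota 0)"
  shows "integrable haar G \<and> integral\<^sup>L haar G = complex_of_real
    ((1 - 1 / w) * (S + (R - u 0 / (w\<^sup>2 - 1))))"
proof -
  have w1: "w > 1" "w\<^sup>2 > 1" using w_gt_1 by (auto simp: one_less_power)
  have n0: "norm_p (iota 0) = 0" by (simp add: norm_iota)
  define h where "h = (\<lambda>j. (u (w powi j) - u 0) / (w powi j) ^ 3)"
  have lower: "w powi (1 - 1 - int i) = 1 / w ^ i" for i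
    by (simp add: power_int_minus_divide)
  have upper: "w powi (1 + int i) = w ^ Suc i" for i
    by (simp add: power_int_add)
  have hlow: "h (1 - 1 - int i) * w powi (1 - 1 - int i) = (u (1 / w ^ i) - u 0) * (w ^ i)\<^sup>2" for i
    unfolding h_def lower using w1 by (simp add: power2_eq_square power3_eq_cube)
  have hup: "h (1 + int i) * w powi (1 + int i) = u (w ^ Suc i) / (w ^ Suc i)\<^sup>2 - u 0 / (w ^ Suc i)\<^sup>2" for i
    unfolding h_def upper using w1 by (simp add: power2_eq_square power3_eq_cube diff_divide_distrib[symmetric])
  have geo2: "(\<lambda>i. 1 / (w ^ Suc i)\<^sup>2) sums (1 / (w\<^sup>2 - 1))"
    using sums_mult[OF geometric_w2_sums, of "1 / w\<^sup>2"] w1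
    by (simp add: power_divide power_mult_distrib power_mult[symmetric] mult_ac)
  have "has_bochner_integral haar (\<lambda>y. (u (norm_p y) - u (norm_p (iota 0))) / dist_p (iota 0) y ^ 3)
    ((1 - 1 / w) * (S + (R - u 0 / (w\<^sup>2 - 1))))"
  \<comment> \<open>the split at 1 collects the integral over \<open>\<int>\<^sub>p\<close> in the lower sum\<close>
  proof (rule has_bochner_integral_radial[where h = h and m = 1])
    show "summable (\<lambda>i. \<bar>h (1 - 1 - int i) * w powi (1 - 1 - int i)\<bar>)"
      unfolding hlow by (rule sS)
    show "(\<lambda>i. h (1 - 1 - int i) * w powi (1 - 1 - int i)) sums S"
      unfolding hlow by (rule S)
    show "(\<lambda>i. h (1 + int i) * w powi (1 + int i)) sums (R - u 0 / (w\<^sup>2 - 1))"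
      using sums_diff[OF R sums_mult[OF geo2, of "u 0"]] unfolding hup by simp
    show "summable (\<lambda>i. \<bar>h (1 + int i) * w powi (1 + int i)\<bar>)"
    proof (rule summable_comparison_test')
      show "summable (\<lambda>i. (U + \<bar>u 0\<bar>) * (1 / (w ^ Suc i)\<^sup>2))"
        using geo2 by (intro summable_mult sums_summable)
      fix i :: nat
      have "\<bar>h (1 + int i) * w powi (1 + int i)\<bar> = \<bar>u (w powi (1 + int i)) - u 0\<bar> / (w ^ Suc i)\<^sup>2"
        unfolding hup unfolding upper by (simp add: diff_divide_distrib[symmetric])
      also have "\<dots> \<le> (U + \<bar>u 0\<bar>) / (w ^ Suc i)\<^sup>2"
      proof (rule divide_right_mono)
        show "\<bar>u (w powi (1 + int i)) - u 0\<bar> \<le> U + \<bar>u 0\<bar>" using U[of "1 + int i"] by linarith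
      qed simp
      finally show "norm \<bar>h (1 + int i) * w powi (1 + int i)\<bar> \<le> (U + \<bar>u 0\<bar>) * (1 / (w ^ Suc i)\<^sup>2)"
        by simp
    qed
    fix y assume y: "y \<in> Qp p"
    fix j assume j: "norm_p y = w powi j"
    show "(u (norm_p y) - u (norm_p (iota 0))) / dist_p (iota 0) y ^ 3 = h j"
      using j norm_eq_dist[OF y] by (simp add: h_def n0 dist_commute)
  qed
  then show ?thesis
    unfolding G_def by (rule has_bochner_integral_cong_Qp) (rule D_integrand_real[OF iota_in_Qp])
qed

end

section \<open>Telescoping sums of a radial power series\<close>

locale base_ge_2 =
  fixes w :: real
  assumes w2: "w \<ge> 2"
begin

lemma w1: "w > 1" "w \<noteq> 0" "w > 0" "w\<^sup>2 > 1"
  using w2 by (auto simp: one_less_power)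

lemma w_pow_ge_2: "n > 0 \<Longrightarrow> w ^ n \<ge> 2"
  using self_le_power[of w n] w2 by simp

lemma inv_bounds:
  assumes "n > 0" shows "0 < 1 / (w ^ n - 1)" "1 / (w ^ n - 1) \<le> 2 / w ^ n" "1 / (w ^ n - 1) \<le> 1"
  using w_pow_ge_2[OF assms] by (auto simp: field_simps)

lemma quot_bounds:
  assumes "n > 0" shows "0 < w ^ n / (w ^ n - 1)" "w ^ n / (w ^ n - 1) \<le> 2"
  using w_pow_ge_2[OF assms] by (auto simp: field_simps)

lemma quot_bound_abs: "n > 0 \<Longrightarrow> \<bar>w ^ n / (w ^ n - 1)\<bar> \<le> 2"
  using quot_bounds[of n] by linarith

end

text \<open>Here \<open>c n\<close> is the coefficient of \<open>z^(2n)\<close> below 1 and \<open>k n\<close> that of \<open>z^(-2n-5)\<close> above 1; all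
  other coefficients vanish.\<close>

locale radial_profile = base_ge_2 +
  fixes c k :: "nat \<Rightarrow> real"
  assumes summable_c: "summable (\<lambda>n. \<bar>c n\<bar>)"
    and summable_k: "summable (\<lambda>n. \<bar>k n\<bar> / w ^ (2 * n))"
    and c1: "c 1 = 0"
begin

definition profile :: "real \<Rightarrow> real" where
  "profile z = (if z \<le> 1 then \<Sum>n. c n * z ^ (2 * n) else \<Sum>n. k n * (1 / z) ^ (2 * n + 5))"

text \<open>Formal sums of \<open>v * profile v\<close> over \<open>v = z/w, z/w\<^sup>2, \<dots>\<close>, and of \<open>profile v / v\<^sup>2\<close> over
  \<open>v = zw, zw\<^sup>2, \<dots>\<close>, obtained by summing a geometric series for each power. Where such a series
  diverges its formal value still has the right difference between consecutive \<open>z\<close>, and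
  is correct up to a constant. That is the case for \<open>inner_high\<close>, taken with the opposite sign,
  and for \<open>outer_low\<close>, which also has the opposite sign and omits the power \<open>z^(-2)\<close>.\<close>

definition inner_low :: "real \<Rightarrow> real" where
  "inner_low z = c 0 * z / (w - 1) + (\<Sum>n. c (n + 2) * (z ^ (2 * n + 5) / (w ^ (2 * n + 5) - 1)))"

definition inner_high :: "real \<Rightarrow> real" where
  "inner_high z = (\<Sum>n. k n * ((1 / z) ^ (2 * n + 4) * (w ^ (2 * n + 4) / (w ^ (2 * n + 4) - 1))))"

definition outer_low :: "real \<Rightarrow> real" where
  "outer_low z = (\<Sum>n. c (n + 2) * (z ^ (2 * n + 2) * (w ^ (2 * n + 2) / (w ^ (2 * n + 2) - 1))))"

definition outer_high :: "real \<Rightarrow> real" where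
  "outer_high z = (\<Sum>n. k n * ((1 / z) ^ (2 * n + 7) / (w ^ (2 * n + 7) - 1)))"

text \<open>The true sums over all smaller, respectively larger, values. Each is the formal sum on the side
  where that converges; on the other side the constant is adjusted at the boundary.\<close>

definition inner_sum :: "real \<Rightarrow> real" where
  "inner_sum z = (if z \<le> 1 then inner_low z else inner_low w + inner_high w - inner_high z)"

definition outer_sum :: "real \<Rightarrow> real" where
  "outer_sum z = (if 1 \<le> z then outer_high z else
     outer_high 1 + (c 0 / (z\<^sup>2 * (w\<^sup>2 - 1)) - outer_low z) - (c 0 / (w\<^sup>2 - 1) - outer_low 1))"

lemma summable_c2: "summable (\<lambda>n. \<bar>c (n + 2)\<bar>)"
  using summable_ignore_initial_segment[OF summable_c, of 2] by simp

text \<open>A comparison with the absolutely convergent reference series, used for all series below.\<close>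

lemma weighted_series:
  fixes a v x :: "nat \<Rightarrow> real"
  assumes "summable (\<lambda>n. \<bar>a n\<bar> / v n)" "\<And>n. v n > 0" "\<And>n. \<bar>x n\<bar> \<le> K / v n"
  shows "summable (\<lambda>n. a n * x n)" "\<bar>\<Sum>n. a n * x n\<bar> \<le> K * (\<Sum>n. \<bar>a n\<bar> / v n)"
proof -
  have le: "norm (a n * x n) \<le> K * (\<bar>a n\<bar> / v n)" for n
    using mult_left_mono[OF assms(3)[of n] abs_ge_zero[of "a n"]] by (simp add: abs_mult mult.commute)
  have s: "summable (\<lambda>n. K * (\<bar>a n\<bar> / v n))" using assms(1) by (rule summable_mult)
  then show "summable (\<lambda>n. a n * x n)" by (rule summable_comparison_test') (rule le)
  have "norm (\<Sum>n. a n * x n) \<le> (\<Sum>n. K * (\<bar>a n\<bar> / v n))"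
    by (rule norm_suminf_le[OF le s])
  then show "\<bar>\<Sum>n. a n * x n\<bar> \<le> K * (\<Sum>n. \<bar>a n\<bar> / v n)"
    using suminf_mult[OF assms(1), of K] by simp
qed

lemma c_series:
  assumes "\<And>n. \<bar>x n\<bar> \<le> K"
  shows "summable (\<lambda>n. c n * x n)" "\<bar>\<Sum>n. c n * x n\<bar> \<le> K * (\<Sum>n. \<bar>c n\<bar>)"
  using weighted_series[of c "\<lambda>_. 1" x K] summable_c assms by auto

lemma c2_series:
  assumes "\<And>n. \<bar>x n\<bar> \<le> K"
  shows "summable (\<lambda>n. c (n + 2) * x n)" "\<bar>\<Sum>n. c (n + 2) * x n\<bar> \<le> K * (\<Sum>n. \<bar>c (n + 2)\<bar>)"
  using weighted_series[of "\<lambda>n. c (n + 2)" "\<lambda>_. 1" x K] summable_c2 assms by auto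

lemma k_series:
  assumes "\<And>n. \<bar>x n\<bar> \<le> K / w ^ (2 * n)"
  shows "summable (\<lambda>n. k n * x n)" "\<bar>\<Sum>n. k n * x n\<bar> \<le> K * (\<Sum>n. \<bar>k n\<bar> / w ^ (2 * n))"
  using weighted_series[of k "\<lambda>n. w ^ (2 * n)" x K] summable_k assms w1 by auto

lemma pow_mult_bound:
  fixes y :: real assumes "0 \<le> y" "y \<le> 1" "m \<le> n" "\<bar>a\<bar> \<le> K" shows "\<bar>y ^ n * a\<bar> \<le> K * y ^ m"
proof -
  have "\<bar>y ^ n * a\<bar> = y ^ n * \<bar>a\<bar>" using assms by (simp add: abs_mult)
  also have "\<dots> \<le> y ^ m * K" using assms by (intro mult_mono power_decreasing) auto
  finally show ?thesis by (simp add: mult.commute)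
qed

lemma high_bound:
  fixes y :: real assumes "0 \<le> y" "y \<le> 1 / w" "\<bar>a\<bar> \<le> K" shows "\<bar>y ^ (2 * n + s) * a\<bar> \<le> (y ^ s * K) / w ^ (2 * n)"
proof -
  have "y ^ (2 * n) \<le> (1 / w) ^ (2 * n)" using assms by (intro power_mono) auto
  then have "y ^ (2 * n) * (y ^ s * \<bar>a\<bar>) \<le> (1 / w) ^ (2 * n) * (y ^ s * K)"
    using assms w1 by (intro mult_mono) auto
  then show ?thesis using assms by (simp add: abs_mult power_add power_divide mult.assoc)
qed

lemma profile_low_sums:
  assumes "0 \<le> z" "z \<le> 1" shows "(\<lambda>n. c n * z ^ (2 * n)) sums profile z"
proof -
  have "\<bar>z ^ (2 * n)\<bar> \<le> 1" for n using assms by (simp add: power_le_one)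
  from c_series(1)[OF this] show ?thesis using assms(2) by (simp add: profile_def summable_sums)
qed

lemma profile_low_sums2:
  assumes "0 \<le> z" "z \<le> 1" shows "(\<lambda>n. c (n + 2) * z ^ (2 * n + 4)) sums (profile z - c 0)"
proof -
  have "(\<lambda>n. c (n + 2) * z ^ (2 * (n + 2))) sums (profile z - (\<Sum>i<2. c i * z ^ (2 * i)))"
    using sums_split_initial_segment[OF profile_low_sums[OF assms], of 2] by simp
  moreover have "(\<Sum>i<2. c i * z ^ (2 * i)) = c 0" using c1 by (simp add: numeral_2_eq_2)
  moreover have "2 * (n + 2) = 2 * n + 4" for n :: nat by simp
  ultimately show ?thesis by (simp only:)
qed

lemma profile_low_bound:
  assumes "0 \<le> z" "z \<le> 1" shows "\<bar>profile z\<bar> \<le> (\<Sum>n. \<bar>c n\<bar>)"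
proof -
  have "\<bar>z ^ (2 * n)\<bar> \<le> 1" for n using assms by (simp add: power_le_one)
  then show ?thesis
    using c_series(2)[of "\<lambda>n. z ^ (2 * n)" 1] sums_unique[OF profile_low_sums[OF assms]] by simp
qed

lemma profile_0: "profile 0 = c 0"
proof -
  have "(\<lambda>_. 0 :: real) sums (profile 0 - c 0)" using profile_low_sums2[of 0] by (simp add: power_0_left)
  from sums_unique2[OF this sums_zero] show ?thesis by simp
qed

text \<open>The vanishing of the quadratic term makes the profile flat to fourth order at 0,
  which is what makes the integral at the origin converge.\<close>

lemma profile_low_diff_bound:
  assumes "0 \<le> z" "z \<le> 1" shows "\<bar>profile z - c 0\<bar> \<le> z ^ 4 * (\<Sum>n. \<bar>c (n + 2)\<bar>)"
proof -
  have "\<bar>z ^ (2 * n + 4) * 1\<bar> \<le> 1 * z ^ 4" for n using assms by (intro pow_mult_bound) auto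
  then show ?thesis
    using c2_series(2)[of "\<lambda>n. z ^ (2 * n + 4)" "z ^ 4"] sums_unique[OF profile_low_sums2[OF assms]] by simp
qed

lemma high_arg: "z \<ge> w \<Longrightarrow> 0 \<le> 1 / z" "z \<ge> w \<Longrightarrow> 1 / z \<le> 1 / w" "z \<ge> w \<Longrightarrow> \<not> z \<le> 1"
  using w1 by (auto simp: frac_le)

lemma profile_high_sums:
  assumes "z \<ge> w" shows "(\<lambda>n. k n * (1 / z) ^ (2 * n + 5)) sums profile z"
proof -
  have "\<bar>(1 / z) ^ (2 * n + 5) * 1\<bar> \<le> ((1 / z) ^ 5 * 1) / w ^ (2 * n)" for n
    using high_arg[OF assms] by (intro high_bound) auto
  from k_series(1)[OF this] show ?thesis
    using high_arg(3)[OF assms] by (simp add: profile_def summable_sums)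
qed

lemma profile_high_bound:
  assumes "z \<ge> w" shows "\<bar>profile z\<bar> \<le> (\<Sum>n. \<bar>k n\<bar> / w ^ (2 * n))"
proof -
  have "(1 / z) ^ 5 \<le> 1" using high_arg[OF assms] w1 by (intro power_le_one) (auto intro: order_trans)
  then have "\<bar>(1 / z) ^ (2 * n + 5) * 1\<bar> \<le> 1 / w ^ (2 * n)" for n
    using high_bound[of "1 / z" 1 1 n 5] high_arg[OF assms] w1
    by (smt (verit, best) divide_right_mono mult.right_neutral zero_le_power)
  then show ?thesis
    using k_series(2)[of "\<lambda>n. (1 / z) ^ (2 * n + 5)" 1] sums_unique[OF profile_high_sums[OF assms]] by simp
qed

lemma inner_low_series:
  assumes "0 \<le> z" "z \<le> w"
  shows "(\<lambda>n. c (n + 2) * (z ^ (2 * n + 5) / (w ^ (2 * n + 5) - 1))) sums (inner_low z - c 0 * z / (w - 1))"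
    and "\<bar>inner_low z\<bar> \<le> z * (\<bar>c 0\<bar> + 2 * (\<Sum>n. \<bar>c (n + 2)\<bar>))"
proof -
  have b: "\<bar>z ^ (2 * n + 5) / (w ^ (2 * n + 5) - 1)\<bar> \<le> 2 * z" for n
  proof -
    have "z ^ (2 * n + 5) / (w ^ (2 * n + 5) - 1) \<le> z ^ (2 * n + 5) * (2 / w ^ (2 * n + 5))"
      using mult_left_mono[OF inv_bounds(2)[of "2 * n + 5"], of "z ^ (2 * n + 5)"] assms by simp
    also have "\<dots> = 2 * (z / w) ^ (2 * n + 5)" by (simp add: power_divide)
    also have "\<dots> \<le> 2 * (z / w) ^ 1"
      using assms w1 by (intro mult_left_mono power_decreasing) auto
    also have "\<dots> \<le> 2 * z" using assms w1 using mult_right_mono[of 1 w z] by (simp add: field_simps)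
    finally have "z ^ (2 * n + 5) / (w ^ (2 * n + 5) - 1) \<le> 2 * z" .
    moreover have "0 \<le> z ^ (2 * n + 5) / (w ^ (2 * n + 5) - 1)"
      using assms w_pow_ge_2[of "2 * n + 5"] by (intro divide_nonneg_nonneg zero_le_power) auto
    ultimately show ?thesis by linarith
  qed
  note s = c2_series[of "\<lambda>n. z ^ (2 * n + 5) / (w ^ (2 * n + 5) - 1)", OF b]
  show "(\<lambda>n. c (n + 2) * (z ^ (2 * n + 5) / (w ^ (2 * n + 5) - 1))) sums (inner_low z - c 0 * z / (w - 1))"
    using summable_sums[OF s(1)] by (simp add: inner_low_def)
  have "\<bar>c 0 * z / (w - 1)\<bar> \<le> z * \<bar>c 0\<bar>"
  proof -
    have "\<bar>c 0 * z / (w - 1)\<bar> = (z * \<bar>c 0\<bar>) * (1 / (w ^ 1 - 1))" using assms w1 by (simp add: abs_mult)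
    also have "\<dots> \<le> (z * \<bar>c 0\<bar>) * 1" using inv_bounds(3)[of 1] assms by (intro mult_left_mono) auto
    finally show ?thesis by simp
  qed
  then show "\<bar>inner_low z\<bar> \<le> z * (\<bar>c 0\<bar> + 2 * (\<Sum>n. \<bar>c (n + 2)\<bar>))"
  proof -
    let ?S = "\<Sum>n. c (n + 2) * (z ^ (2 * n + 5) / (w ^ (2 * n + 5) - 1))"
    assume "\<bar>c 0 * z / (w - 1)\<bar> \<le> z * \<bar>c 0\<bar>"
    moreover have "\<bar>c 0 * z / (w - 1) + ?S\<bar> \<le> \<bar>c 0 * z / (w - 1)\<bar> + \<bar>?S\<bar>"
      by (rule abs_triangle_ineq)
    moreover have "z * (\<bar>c 0\<bar> + 2 * (\<Sum>n. \<bar>c (n + 2)\<bar>)) = z * \<bar>c 0\<bar> + 2 * z * (\<Sum>n. \<bar>c (n + 2)\<bar>)"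
      by (simp add: distrib_left)
    ultimately show ?thesis using s(2) unfolding inner_low_def by linarith
  qed
qed

lemma inner_high_sums:
  assumes "z \<ge> w"
  shows "(\<lambda>n. k n * ((1 / z) ^ (2 * n + 4) * (w ^ (2 * n + 4) / (w ^ (2 * n + 4) - 1)))) sums inner_high z"
proof -
  have "\<bar>(1 / z) ^ (2 * n + 4) * (w ^ (2 * n + 4) / (w ^ (2 * n + 4) - 1))\<bar> \<le> ((1 / z) ^ 4 * 2) / w ^ (2 * n)" for n
    by (intro high_bound high_arg assms quot_bound_abs) simp
  from k_series(1)[OF this] show ?thesis by (simp add: inner_high_def summable_sums)
qed

lemma outer_low_series:
  assumes "0 \<le> z" "z \<le> 1"
  shows "(\<lambda>n. c (n + 2) * (z ^ (2 * n + 2) * (w ^ (2 * n + 2) / (w ^ (2 * n + 2) - 1)))) sums outer_low z"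
    and "\<bar>outer_low z\<bar> \<le> z * (2 * (\<Sum>n. \<bar>c (n + 2)\<bar>))"
proof -
  have "\<bar>z ^ (2 * n + 2) * (w ^ (2 * n + 2) / (w ^ (2 * n + 2) - 1))\<bar> \<le> 2 * z ^ 1" for n
    using assms by (intro pow_mult_bound quot_bound_abs) auto
  note s = c2_series[OF this]
  show "(\<lambda>n. c (n + 2) * (z ^ (2 * n + 2) * (w ^ (2 * n + 2) / (w ^ (2 * n + 2) - 1)))) sums outer_low z"
    using summable_sums[OF s(1)] by (simp add: outer_low_def)
  show "\<bar>outer_low z\<bar> \<le> z * (2 * (\<Sum>n. \<bar>c (n + 2)\<bar>))"
    using s(2) by (simp add: outer_low_def mult_ac)
qed

lemma outer_high_series:
  assumes "z \<ge> 1"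
  shows "(\<lambda>n. k n * ((1 / z) ^ (2 * n + 7) / (w ^ (2 * n + 7) - 1))) sums outer_high z"
    and "\<bar>outer_high z\<bar> \<le> (1 / z) * (2 * (\<Sum>n. \<bar>k n\<bar> / w ^ (2 * n)))"
proof -
  have b: "\<bar>(1 / z) ^ (2 * n + 7) / (w ^ (2 * n + 7) - 1)\<bar> \<le> (2 * (1 / z)) / w ^ (2 * n)" for n
  proof -
    have "1 / (w ^ (2 * n + 7) - 1) \<le> 2 / w ^ (2 * n + 7)" by (rule inv_bounds) simp
    also have "\<dots> \<le> 2 / w ^ (2 * n)"
      using w1 by (intro divide_left_mono power_increasing mult_pos_pos) auto
    finally have "\<bar>(1 / z) ^ (2 * n + 7) * (1 / (w ^ (2 * n + 7) - 1))\<bar> \<le> (2 / w ^ (2 * n)) * (1 / z) ^ 1"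
      using assms inv_bounds(1)[of "2 * n + 7"] by (intro pow_mult_bound) auto
    then show ?thesis by (simp add: mult_ac)
  qed
  note s = k_series[of "\<lambda>n. (1 / z) ^ (2 * n + 7) / (w ^ (2 * n + 7) - 1)", OF b]
  show "(\<lambda>n. k n * ((1 / z) ^ (2 * n + 7) / (w ^ (2 * n + 7) - 1))) sums outer_high z"
    using summable_sums[OF s(1)] by (simp add: outer_high_def)
  show "\<bar>outer_high z\<bar> \<le> (1 / z) * (2 * (\<Sum>n. \<bar>k n\<bar> / w ^ (2 * n)))"
    using s(2) by (simp add: outer_high_def mult_ac)
qed

text \<open>With \<open>W\<close> the ratio of consecutive terms, these are the telescoping identities behind a geometric
  sum.\<close>

lemma quot_diff:
  fixes y W :: real assumes "W \<ge> 2"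
  shows "y * W / (W - 1) - y / (W - 1) = y" "y * (W / (W - 1)) - y / W * (W / (W - 1)) = y"
proof -
  have "W - 1 \<noteq> 0" "W \<noteq> 0" using assms by auto
  then show *: "y * W / (W - 1) - y / (W - 1) = y"
    by (simp add: diff_divide_distrib[symmetric] eq_divide_eq[symmetric] divide_eq_eq right_diff_distrib)
  then show "y * (W / (W - 1)) - y / W * (W / (W - 1)) = y" using \<open>W \<noteq> 0\<close> by simp
qed

lemma inner_low_step:
  assumes "0 \<le> z" "z \<le> 1" shows "inner_low (z * w) - inner_low z = z * profile z"
proof -
  have zw: "z * w \<le> w" "0 \<le> z * w" "z \<le> w" using assms w1 by (auto simp: mult_left_le_one_le)
  have "(\<lambda>n. c (n + 2) * ((z * w) ^ (2 * n + 5) / (w ^ (2 * n + 5) - 1)) - c (n + 2) * (z ^ (2 * n + 5) / (w ^ (2 * n + 5) - 1)))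
    sums ((inner_low (z * w) - c 0 * (z * w) / (w - 1)) - (inner_low z - c 0 * z / (w - 1)))"
    by (intro sums_diff inner_low_series zw assms)
  moreover have "c (n + 2) * ((z * w) ^ (2 * n + 5) / (w ^ (2 * n + 5) - 1)) - c (n + 2) * (z ^ (2 * n + 5) / (w ^ (2 * n + 5) - 1))
      = z * (c (n + 2) * z ^ (2 * n + 4))" for n
  proof -
    have *: "(z * w) ^ (2 * n + 5) / (w ^ (2 * n + 5) - 1) - z ^ (2 * n + 5) / (w ^ (2 * n + 5) - 1) = z ^ (2 * n + 5)"
      unfolding power_mult_distrib by (rule quot_diff(1)) (rule w_pow_ge_2, simp)
    have "z ^ (2 * n + 5) = z * z ^ (2 * n + 4)" by (simp add: power_add eval_nat_numeral)
    then show ?thesis unfolding right_diff_distrib[symmetric] * by simp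
  qed
  ultimately have "(\<lambda>n. z * (c (n + 2) * z ^ (2 * n + 4))) sums
     ((inner_low (z * w) - c 0 * (z * w) / (w - 1)) - (inner_low z - c 0 * z / (w - 1)))" by simp
  then have "(inner_low (z * w) - c 0 * (z * w) / (w - 1)) - (inner_low z - c 0 * z / (w - 1)) = z * (profile z - c 0)"
    using sums_mult[OF profile_low_sums2[OF assms], of z] sums_unique2 by blast
  moreover have "c 0 * (z * w) / (w - 1) - c 0 * z / (w - 1) = z * c 0"
    using quot_diff(1)[OF w2, of "c 0 * z"] by (simp add: mult_ac)
  ultimately show ?thesis by (simp add: right_diff_distrib)
qed

lemma inner_high_step:
  assumes "z \<ge> w" shows "inner_high z - inner_high (z * w) = z * profile z"
proof -
  have zw: "z * w \<ge> w" and z0: "z > 0" using assms w1 by (auto intro: order_trans)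
  have "(\<lambda>n. k n * ((1 / z) ^ (2 * n + 4) * (w ^ (2 * n + 4) / (w ^ (2 * n + 4) - 1))) - k n * ((1 / (z * w)) ^ (2 * n + 4) * (w ^ (2 * n + 4) / (w ^ (2 * n + 4) - 1))))
    sums (inner_high z - inner_high (z * w))"
    by (intro sums_diff inner_high_sums zw assms)
  moreover have "k n * ((1 / z) ^ (2 * n + 4) * (w ^ (2 * n + 4) / (w ^ (2 * n + 4) - 1))) - k n * ((1 / (z * w)) ^ (2 * n + 4) * (w ^ (2 * n + 4) / (w ^ (2 * n + 4) - 1)))
     = z * (k n * (1 / z) ^ (2 * n + 5))" for n
  proof -
    note * = quot_diff(2)
    have "(1 / (z * w)) ^ (2 * n + 4) = (1 / z) ^ (2 * n + 4) / w ^ (2 * n + 4)"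
      by (simp add: power_divide power_mult_distrib)
    then have "k n * ((1 / z) ^ (2 * n + 4) * (w ^ (2 * n + 4) / (w ^ (2 * n + 4) - 1))) - k n * ((1 / (z * w)) ^ (2 * n + 4) * (w ^ (2 * n + 4) / (w ^ (2 * n + 4) - 1)))
     = k n * (1 / z) ^ (2 * n + 4)"
      unfolding right_diff_distrib[symmetric] by (simp only: *[OF w_pow_ge_2[of "2 * n + 4"]])
    moreover have "(1 / z) ^ (2 * n + 4) = z * (1 / z) ^ (2 * n + 5)"
      using z0 by (simp add: power_add eval_nat_numeral)
    ultimately show ?thesis by simp
  qed
  ultimately have "(\<lambda>n. z * (k n * (1 / z) ^ (2 * n + 5))) sums (inner_high z - inner_high (z * w))" by simp
  then show ?thesis using sums_mult[OF profile_high_sums[OF assms], of z] sums_unique2 by blast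
qed

lemma outer_low_step:
  assumes "0 < z" "z \<le> 1" shows "outer_low z - outer_low (z / w) = (profile z - c 0) / z\<^sup>2"
proof -
  have zw: "0 \<le> z / w" "z / w \<le> 1" "0 \<le> z" using assms w1 by (auto simp: field_simps)
  have "(\<lambda>n. c (n + 2) * (z ^ (2 * n + 2) * (w ^ (2 * n + 2) / (w ^ (2 * n + 2) - 1))) - c (n + 2) * ((z / w) ^ (2 * n + 2) * (w ^ (2 * n + 2) / (w ^ (2 * n + 2) - 1))))
    sums (outer_low z - outer_low (z / w))"
    by (intro sums_diff outer_low_series zw assms)
  moreover have "c (n + 2) * (z ^ (2 * n + 2) * (w ^ (2 * n + 2) / (w ^ (2 * n + 2) - 1))) - c (n + 2) * ((z / w) ^ (2 * n + 2) * (w ^ (2 * n + 2) / (w ^ (2 * n + 2) - 1)))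
     = c (n + 2) * z ^ (2 * n + 4) / z\<^sup>2" for n
  proof -
    note * = quot_diff(2)
    have a: "c (n + 2) * (z ^ (2 * n + 2) * (w ^ (2 * n + 2) / (w ^ (2 * n + 2) - 1))) - c (n + 2) * ((z / w) ^ (2 * n + 2) * (w ^ (2 * n + 2) / (w ^ (2 * n + 2) - 1)))
      = c (n + 2) * z ^ (2 * n + 2)"
      unfolding right_diff_distrib[symmetric] power_divide by (simp only: *[OF w_pow_ge_2[of "2 * n + 2"]])
    have b: "z ^ (2 * n + 4) / z\<^sup>2 = z ^ (2 * n + 2)"
      using assms by (simp add: power_add eval_nat_numeral)
    show ?thesis unfolding a unfolding times_divide_eq_right[of "c (n + 2)", symmetric] b ..
  qed
  ultimately have "(\<lambda>n. c (n + 2) * z ^ (2 * n + 4) / z\<^sup>2) sums (outer_low z - outer_low (z / w))" by simp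
  then show ?thesis
    using sums_divide[OF profile_low_sums2[OF zw(3) assms(2)], of "z\<^sup>2"] sums_unique2 by blast
qed

lemma outer_high_step:
  assumes "z \<ge> w" shows "outer_high (z / w) - outer_high z = profile z / z\<^sup>2"
proof -
  have zw: "z / w \<ge> 1" "z \<ge> 1" and z0: "z > 0" using assms w1 by auto
  have "(\<lambda>n. k n * ((1 / (z / w)) ^ (2 * n + 7) / (w ^ (2 * n + 7) - 1)) - k n * ((1 / z) ^ (2 * n + 7) / (w ^ (2 * n + 7) - 1)))
    sums (outer_high (z / w) - outer_high z)"
    by (intro sums_diff outer_high_series zw)
  moreover have "k n * ((1 / (z / w)) ^ (2 * n + 7) / (w ^ (2 * n + 7) - 1)) - k n * ((1 / z) ^ (2 * n + 7) / (w ^ (2 * n + 7) - 1))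
     = k n * (1 / z) ^ (2 * n + 5) / z\<^sup>2" for n
  proof -
    note * = quot_diff(1)
    have "(1 / (z / w)) ^ (2 * n + 7) = (1 / z) ^ (2 * n + 7) * w ^ (2 * n + 7)"
      by (simp add: power_divide)
    then have a: "k n * ((1 / (z / w)) ^ (2 * n + 7) / (w ^ (2 * n + 7) - 1)) - k n * ((1 / z) ^ (2 * n + 7) / (w ^ (2 * n + 7) - 1))
       = k n * (1 / z) ^ (2 * n + 7)"
      unfolding right_diff_distrib[symmetric] by (simp only: *[OF w_pow_ge_2[of "2 * n + 7"]])
    have b: "(1 / z) ^ (2 * n + 5) / z\<^sup>2 = (1 / z) ^ (2 * n + 7)"
      using z0 by (simp add: power_add eval_nat_numeral)
    show ?thesis unfolding a unfolding times_divide_eq_right[of "k n", symmetric] b ..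
  qed
  ultimately have "(\<lambda>n. k n * (1 / z) ^ (2 * n + 5) / z\<^sup>2) sums (outer_high (z / w) - outer_high z)" by simp
  then show ?thesis
    using sums_divide[OF profile_high_sums[OF assms], of "z\<^sup>2"] sums_unique2 by blast
qed

end

section \<open>The radial equation\<close>

context radial_profile begin

lemma w_powi_cases:
  obtains "j < 0" "w powi j \<le> 1" "w powi j * w \<le> 1" "w powi j / w < 1"
  | "j = 0" "w powi j = 1" | "j > 0" "w powi j \<ge> w"
proof -
  consider "j < 0" | "j = 0" | "j > 0" by linarith
  then show ?thesis
  proof cases
    case 1
    have "w powi j \<le> w powi (- 1)" using 1 w1 by (intro power_int_increasing) auto
    then have le: "w powi j * w \<le> 1" using w1 by (simp add: power_int_minus field_simps)
    moreover have "w powi j \<le> w powi j * w" using w1 by simp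
    moreover have "w powi j / w < w powi j" using w1 by (simp add: field_simps)
    ultimately show ?thesis using that(1)[OF 1] by linarith
  next
    case 3
    have "w powi 1 \<le> w powi j" using 3 w1 by (intro power_int_increasing) auto
    then show ?thesis using that(3)[OF 3] by simp
  qed (use that(2) in simp)
qed

lemma w_powi_pos': "w powi j > 0"
  using w1 by simp

lemma profile_bound:
  "\<bar>profile (w powi j)\<bar> \<le> (\<Sum>n. \<bar>c n\<bar>) + (\<Sum>n. \<bar>k n\<bar> / w ^ (2 * n))"
proof -
  have "0 \<le> (\<Sum>n. \<bar>c n\<bar>)" by (rule suminf_nonneg[OF summable_c]) simp
  moreover have "0 \<le> (\<Sum>n. \<bar>k n\<bar> / w ^ (2 * n))" by (rule suminf_nonneg[OF summable_k]) (use w1 in simp)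
  ultimately show ?thesis
    using profile_low_bound[of "w powi j"] profile_high_bound[of "w powi j"] w_powi_pos'[of j]
    by (cases j rule: w_powi_cases) linarith+
qed

lemma inner_sum_step:
  "inner_sum (w powi j * w) - inner_sum (w powi j) = w powi j * profile (w powi j)"
proof (cases j rule: w_powi_cases)
  case 1
  then show ?thesis using inner_low_step[of "w powi j"] w_powi_pos'[of j] by (simp add: inner_sum_def)
next
  case 2
  then show ?thesis using inner_low_step[of 1] w1 by (simp add: inner_sum_def)
next
  case 3
  have "w powi j * 1 \<le> w powi j * w" using w1 w_powi_pos'[of j] by (intro mult_left_mono) auto
  then have "w powi j * w > 1" "w powi j > 1" using 3 w1 by linarith+
  then show ?thesis using inner_high_step[OF 3(2)] by (simp add: inner_sum_def)
qed

lemma outer_sum_low: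
  assumes "z \<le> 1"
  shows "outer_sum z = outer_high 1 + (c 0 / (z\<^sup>2 * (w\<^sup>2 - 1)) - outer_low z) - (c 0 / (w\<^sup>2 - 1) - outer_low 1)"
  using assms by (cases "z = 1") (auto simp: outer_sum_def)

lemma outer_sum_step:
  "outer_sum (w powi j / w) - outer_sum (w powi j) = profile (w powi j) / (w powi j)\<^sup>2"
proof (cases "j > 0")
  case True
  then have "w powi j \<ge> w" by (cases j rule: w_powi_cases) auto
  moreover from this have "1 \<le> w powi j / w" "1 \<le> w powi j" using w1 by (auto simp: field_simps)
  ultimately show ?thesis using outer_high_step[of "w powi j"] by (simp add: outer_sum_def)
next
  case False
  define z where "z = w powi j"
  have z: "0 < z" "z \<le> 1" "z / w \<le> 1"
    using False w_powi_pos'[of j] w1 unfolding z_def by (cases j rule: w_powi_cases; simp)+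
  have "c 0 / ((z / w)\<^sup>2 * (w\<^sup>2 - 1)) - c 0 / (z\<^sup>2 * (w\<^sup>2 - 1)) = c 0 / z\<^sup>2"
  proof -
    have "c 0 / ((z / w)\<^sup>2 * (w\<^sup>2 - 1)) - c 0 / (z\<^sup>2 * (w\<^sup>2 - 1))
      = (c 0 / z\<^sup>2) * w\<^sup>2 / (w\<^sup>2 - 1) - (c 0 / z\<^sup>2) / (w\<^sup>2 - 1)"
      by (simp add: power_divide)
    also have "\<dots> = c 0 / z\<^sup>2"
      by (rule quot_diff(1)) (use w_pow_ge_2[of 2] in simp)
    finally show ?thesis .
  qed
  then have "outer_sum (z / w) - outer_sum z = c 0 / z\<^sup>2 + (profile z - c 0) / z\<^sup>2"
    unfolding outer_sum_low[OF z(2)] outer_sum_low[OF z(3)] using outer_low_step[OF z(1,2)] by linarith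
  then show ?thesis unfolding z_def by (simp add: diff_divide_distrib)
qed

lemma inverse_w_tendsto_0: "(\<lambda>i. z / w ^ i) \<longlonglongrightarrow> 0"
  using tendsto_mult_right_zero[OF LIMSEQ_realpow_zero[of "1 / w"], of z] w1 by (simp add: power_divide)

text \<open>The closed form tends to 0 at the lower end, so it equals the telescoped sum.\<close>

lemma inner_sum_sums:
  assumes "z = w powi m"
  shows "(\<lambda>i. z / w ^ Suc i * profile (z / w ^ Suc i)) sums inner_sum z"
proof -
  let ?f = "\<lambda>i. inner_sum (z / w ^ i)"
  let ?C = "\<bar>c 0\<bar> + 2 * (\<Sum>n. \<bar>c (n + 2)\<bar>)"
  have z0: "z > 0" using assms w1 by simp
  have powi: "z / w ^ i = w powi (m - int i)" for i
    using assms w1 by (simp add: power_int_diff)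
  have "(\<lambda>i. z / w ^ i * ?C) \<longlonglongrightarrow> 0"
    using tendsto_mult_left_zero[OF inverse_w_tendsto_0] .
  moreover have "\<forall>\<^sub>F i in sequentially. z / w ^ i < 1"
    by (rule order_tendstoD(2)[OF inverse_w_tendsto_0]) simp
  then have "\<forall>\<^sub>F i in sequentially. norm (?f i) \<le> z / w ^ i * ?C"
  proof eventually_elim
    case (elim i)
    have "0 \<le> z / w ^ i" using z0 w1 by simp
    moreover have "z / w ^ i \<le> w" using elim w1 by linarith
    ultimately show ?case using inner_low_series(2)[of "z / w ^ i"] elim by (simp add: inner_sum_def)
  qed
  ultimately have "?f \<longlonglongrightarrow> 0" by (rule Lim_null_comparison[rotated])
  from telescope_sums'[OF this] have "(\<lambda>i. ?f i - ?f (Suc i)) sums inner_sum z" by simp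
  moreover have "?f i - ?f (Suc i) = z / w ^ Suc i * profile (z / w ^ Suc i)" for i
  proof -
    have 1: "w powi (m - int (Suc i)) * w = z / w ^ i"
      unfolding powi[symmetric] using w1 by simp
    show ?thesis using inner_sum_step[of "m - int (Suc i)"] unfolding 1 unfolding powi[symmetric] .
  qed
  ultimately show ?thesis by simp
qed

lemma outer_sum_sums:
  assumes "z = w powi m"
  shows "(\<lambda>i. profile (z * w ^ Suc i) / (z * w ^ Suc i)\<^sup>2) sums outer_sum z"
proof -
  let ?f = "\<lambda>i. outer_sum (z * w ^ i)"
  let ?C = "2 * (\<Sum>n. \<bar>k n\<bar> / w ^ (2 * n))"
  have z0: "z > 0" using assms w1 by simp
  have powi: "z * w ^ i = w powi (m + int i)" for i
    using assms w1 by (simp add: power_int_add)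
  have t: "(\<lambda>i. 1 / (z * w ^ i)) \<longlonglongrightarrow> 0"
    using inverse_w_tendsto_0[of "1 / z"] by simp
  then have "(\<lambda>i. 1 / (z * w ^ i) * ?C) \<longlonglongrightarrow> 0" by (rule tendsto_mult_left_zero)
  moreover have "\<forall>\<^sub>F i in sequentially. 1 / (z * w ^ i) < 1"
    by (rule order_tendstoD(2)[OF t]) simp
  then have "\<forall>\<^sub>F i in sequentially. norm (?f i) \<le> 1 / (z * w ^ i) * ?C"
  proof eventually_elim
    case (elim i)
    have "0 < z * w ^ i" using z0 w1 by simp
    then have "1 \<le> z * w ^ i" using elim by (simp add: divide_less_eq)
    then show ?case using outer_high_series(2)[of "z * w ^ i"] by (simp add: outer_sum_def)
  qed
  ultimately have "?f \<longlonglongrightarrow> 0" by (rule Lim_null_comparison[rotated])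
  from telescope_sums'[OF this] have "(\<lambda>i. ?f i - ?f (Suc i)) sums outer_sum z" by simp
  moreover have "?f i - ?f (Suc i) = profile (z * w ^ Suc i) / (z * w ^ Suc i)\<^sup>2" for i
  proof -
    have 1: "w powi (m + int (Suc i)) / w = z * w ^ i"
      unfolding powi[symmetric] using w1 by simp
    show ?thesis using outer_sum_step[of "m + int (Suc i)"] unfolding 1 unfolding powi[symmetric] .
  qed
  ultimately show ?thesis by simp
qed

lemma origin_sums:
  shows "(\<lambda>i. (profile (1 / w ^ i) - profile 0) * (w ^ i)\<^sup>2) sums outer_low 1"
    and "summable (\<lambda>i. \<bar>(profile (1 / w ^ i) - profile 0) * (w ^ i)\<^sup>2\<bar>)"
proof -
  let ?f = "\<lambda>i. outer_low (1 / w ^ i)"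
  let ?C = "\<Sum>n. \<bar>c (n + 2)\<bar>"
  have v: "0 < 1 / w ^ i" "1 / w ^ i \<le> 1" for i using w1 by (auto simp: field_simps)
  have "(\<lambda>i. 1 / w ^ i * (2 * ?C)) \<longlonglongrightarrow> 0"
    using inverse_w_tendsto_0 by (rule tendsto_mult_left_zero)
  moreover have "\<forall>\<^sub>F i in sequentially. norm (?f i) \<le> 1 / w ^ i * (2 * ?C)"
    using outer_low_series(2)[OF less_imp_le[OF v(1)] v(2)] by (intro always_eventually) simp
  ultimately have "?f \<longlonglongrightarrow> 0" by (rule Lim_null_comparison[rotated])
  from telescope_sums'[OF this] have "(\<lambda>i. ?f i - ?f (Suc i)) sums outer_low 1" by simp
  moreover have "?f i - ?f (Suc i) = (profile (1 / w ^ i) - profile 0) * (w ^ i)\<^sup>2" for i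
    using outer_low_step[OF v, of i] w1 by (simp add: profile_0 power_divide mult.commute)
  ultimately show "(\<lambda>i. (profile (1 / w ^ i) - profile 0) * (w ^ i)\<^sup>2) sums outer_low 1" by simp
  show "summable (\<lambda>i. \<bar>(profile (1 / w ^ i) - profile 0) * (w ^ i)\<^sup>2\<bar>)"
  proof (rule summable_comparison_test')
    show "summable (\<lambda>i. (1 / w) ^ i * ?C)"
      using w1 by (intro summable_mult2 summable_geometric) simp
    fix i :: nat
    have "\<bar>(profile (1 / w ^ i) - profile 0) * (w ^ i)\<^sup>2\<bar> = \<bar>profile (1 / w ^ i) - c 0\<bar> * (w ^ i)\<^sup>2"
      by (simp add: profile_0 abs_mult)
    also have "\<dots> \<le> ((1 / w ^ i) ^ 4 * ?C) * (w ^ i)\<^sup>2"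
      using profile_low_diff_bound[OF less_imp_le[OF v(1)] v(2)] by (intro mult_right_mono) auto
    also have "\<dots> = (1 / w ^ i) ^ 2 * ?C"
      using w1 by (simp add: eval_nat_numeral)
    also have "\<dots> \<le> (1 / w ^ i) ^ 1 * ?C"
      using v[of i] by (intro mult_right_mono power_decreasing suminf_nonneg[OF summable_c2]) auto
    finally show "norm \<bar>(profile (1 / w ^ i) - profile 0) * (w ^ i)\<^sup>2\<bar> \<le> (1 / w) ^ i * ?C"
      by (simp add: power_divide)
  qed
qed

end

text \<open>When \<open>g\<close> is the constant of the operator, this is the factor by which \<open>D\<^sup>2\<close> multiplies
  a power. For \<open>j = 2n + 2\<close> it belongs to \<open>z^(2n+4)\<close>, and for
  \<open>j = 2n + 4\<close> to \<open>z^(-2n-5)\<close>: the two families share one formula because \<open>\<Gamma>\<^sub>p(s) \<Gamma>\<^sub>p(1-s) = 1\<close>.\<close>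

definition coef :: "real \<Rightarrow> real \<Rightarrow> nat \<Rightarrow> real" where
  "coef w g j = g * (1 / (w ^ (j + 3) - 1) - w ^ j / (w ^ j - 1) - 1 / (w - 1) - 1 / (w\<^sup>2 - 1))"

text \<open>The last two assumptions are the matching conditions: the constants of integration in the
  sums must account for the terms that the recursions leave over.\<close>

locale radial_solution = radial_profile +
  fixes E g :: real
  assumes rec_c: "c (n + 2) * coef w g (2 * n + 2) + c n = E * c (n + 1)"
    and rec_k0: "k 1 = E * k 0"
    and rec_k: "k n * coef w g (2 * n + 4) + k (n + 2) = E * k (n + 1)"
    and match_low: "g * (outer_high 1 - (c 0 / (w\<^sup>2 - 1) - outer_low 1)) = E * c 0"
    and match_high: "g * (inner_low w + inner_high w) + k 0 = 0"
begin

text \<open>Dividing the closed forms by the powers of \<open>z\<close> that the kernel prescribes, the terms with \<open>c 0\<close>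
  cancel, the remaining ones are the power series with coefficients \<open>c (n + 2) * coef\<close>, and the
  recursion turns it into \<open>E u - z\<^sup>2 u\<close> without its constant term.\<close>

lemma level_equation_low:
  assumes z: "0 < z" "z \<le> 1"
  shows "g * ((inner_sum z - profile z * (z / (w - 1))) / z ^ 3 + (outer_sum z - profile z / (z\<^sup>2 * (w\<^sup>2 - 1))))
    + z\<^sup>2 * profile z = E * profile z"
proof -
  have zw: "0 \<le> z" "z \<le> w" using z w1 by auto
  let ?p = "1 / (w - 1)" and ?q = "1 / (w\<^sup>2 - 1)"
  have "(\<lambda>n. g * (c (n + 2) * (z ^ (2 * n + 5) / (w ^ (2 * n + 5) - 1)) / z ^ 3
      - c (n + 2) * (z ^ (2 * n + 2) * (w ^ (2 * n + 2) / (w ^ (2 * n + 2) - 1)))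
      - c (n + 2) * z ^ (2 * n + 4) * (?p + ?q) / z\<^sup>2))
    sums (g * ((inner_low z - c 0 * z / (w - 1)) / z ^ 3 - outer_low z - (profile z - c 0) * (?p + ?q) / z\<^sup>2))"
    (is "?f sums ?L")
    by (intro sums_mult sums_diff sums_divide sums_mult2 inner_low_series outer_low_series profile_low_sums2 z zw)
  moreover have "?f n = c (n + 2) * coef w g (2 * n + 2) * z ^ (2 * n + 2)" for n
  proof -
    have 1: "z ^ (2 * n + 5) = z ^ 3 * z ^ (2 * n + 2)" "z ^ (2 * n + 4) = z\<^sup>2 * z ^ (2 * n + 2)"
      unfolding power_add[symmetric] by (rule arg_cong[where f = "\<lambda>i. z ^ i"], simp)+
    have 2: "2 * n + 2 + 3 = 2 * n + 5" by simp
    have "?f n = g * (c (n + 2) * z ^ (2 * n + 2) * (1 / (w ^ (2 * n + 5) - 1))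
       - c (n + 2) * z ^ (2 * n + 2) * (w ^ (2 * n + 2) / (w ^ (2 * n + 2) - 1)) - c (n + 2) * z ^ (2 * n + 2) * (?p + ?q))"
      unfolding 1 using z by simp
    then show ?thesis unfolding coef_def 2 by (simp only: algebra_simps)
  qed
  moreover have "c (n + 2) * coef w g (2 * n + 2) = E * c (n + 1) - c n" for n
    using rec_c[of n] by linarith
  ultimately have s1: "(\<lambda>n. (E * c (n + 1) - c n) * z ^ (2 * n + 2)) sums ?L" by simp
  have "(\<lambda>n. c (n + 1) * z ^ (2 * (n + 1))) sums (profile z - c 0)"
    using sums_split_initial_segment[OF profile_low_sums[OF zw(1) z(2)], of 1] by simp
  then have "(\<lambda>n. E * (c (n + 1) * z ^ (2 * (n + 1))) - z\<^sup>2 * (c n * z ^ (2 * n))) sums (E * (profile z - c 0) - z\<^sup>2 * profile z)"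
    by (intro sums_diff sums_mult profile_low_sums zw z)
  moreover have "E * (c (n + 1) * z ^ (2 * (n + 1))) - z\<^sup>2 * (c n * z ^ (2 * n)) = (E * c (n + 1) - c n) * z ^ (2 * n + 2)" for n
    by (simp add: power_add algebra_simps power2_eq_square)
  ultimately have L: "?L = E * (profile z - c 0) - z\<^sup>2 * profile z"
    using s1 sums_unique2 by simp
  have "g * ((inner_sum z - profile z * (z / (w - 1))) / z ^ 3 + (outer_sum z - profile z / (z\<^sup>2 * (w\<^sup>2 - 1))))
    = ?L + g * (outer_high 1 - (c 0 / (w\<^sup>2 - 1) - outer_low 1))"
  proof -
    have cub: "x * (z * y) / z ^ 3 = x * y / z\<^sup>2" for x y
      using z by (simp add: power3_eq_cube power2_eq_square)
    have 1: "(inner_sum z - profile z * (z / (w - 1))) / z ^ 3 = inner_low z / z ^ 3 - profile z * ?p / z\<^sup>2"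
      using z cub[of "profile z" ?p] by (simp add: inner_sum_def diff_divide_distrib)
    have 2: "(inner_low z - c 0 * z / (w - 1)) / z ^ 3 = inner_low z / z ^ 3 - c 0 * ?p / z\<^sup>2"
      using cub[of "c 0" ?p] by (simp add: diff_divide_distrib)
    have 3: "profile z / (z\<^sup>2 * (w\<^sup>2 - 1)) = profile z * ?q / z\<^sup>2" "c 0 / (z\<^sup>2 * (w\<^sup>2 - 1)) = c 0 * ?q / z\<^sup>2"
      by (simp_all add: mult.commute)
    have 4: "(profile z - c 0) * (?p + ?q) / z\<^sup>2 = profile z * ?p / z\<^sup>2 + profile z * ?q / z\<^sup>2 - c 0 * ?p / z\<^sup>2 - c 0 * ?q / z\<^sup>2"
      by (simp only: distrib_left left_diff_distrib diff_divide_distrib add_divide_distrib)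
    show ?thesis
      unfolding 1 2 3 4 outer_sum_low[OF z(2)] by (simp only: distrib_left right_diff_distrib)
  qed
  then show ?thesis using L match_low by (simp add: algebra_simps)
qed

text \<open>As before, but the recursion involves \<open>k\<close> two steps ahead, so it leaves over a multiple of \<open>z^(-3)\<close> and
  one of \<open>z^(-5)\<close>. The latter vanishes by the first step of the recursion, the former is cancelled
  by the second matching condition.\<close>

lemma level_equation_high:
  assumes z: "z \<ge> w"
  shows "g * ((inner_sum z - profile z * (z / (w - 1))) / z ^ 3 + (outer_sum z - profile z / (z\<^sup>2 * (w\<^sup>2 - 1))))
    + z\<^sup>2 * profile z = E * profile z"
proof -
  have z1: "z > 1" "z \<ge> 1" "z > 0" "z \<noteq> 0" using z w1 by auto
  let ?p = "1 / (w - 1)" and ?q = "1 / (w\<^sup>2 - 1)" and ?y = "1 / z"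
  have "(\<lambda>n. g * (k n * (?y ^ (2 * n + 7) / (w ^ (2 * n + 7) - 1))
      - k n * (?y ^ (2 * n + 4) * (w ^ (2 * n + 4) / (w ^ (2 * n + 4) - 1))) / z ^ 3
      - k n * ?y ^ (2 * n + 5) * (?p + ?q) / z\<^sup>2))
    sums (g * (outer_high z - inner_high z / z ^ 3 - profile z * (?p + ?q) / z\<^sup>2))"
    (is "?f sums ?L")
    by (intro sums_mult sums_diff sums_divide sums_mult2 inner_high_sums outer_high_series profile_high_sums z z1)
  moreover have "?f n = k n * coef w g (2 * n + 4) * ?y ^ (2 * n + 7)" for n
  proof -
    have "?y ^ (2 * n + 7) = ?y ^ (2 * n + 4) * ?y ^ 3" "?y ^ (2 * n + 7) = ?y ^ (2 * n + 5) * ?y\<^sup>2"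
      unfolding power_add[symmetric] by (rule arg_cong[where f = "\<lambda>i. ?y ^ i"], simp)+
    then have 1: "?y ^ (2 * n + 4) / z ^ 3 = ?y ^ (2 * n + 7)" "?y ^ (2 * n + 5) / z\<^sup>2 = ?y ^ (2 * n + 7)"
      by (simp_all add: power_divide)
    have 2: "2 * n + 4 + 3 = 2 * n + 7" by simp
    have "?f n = g * (k n * ?y ^ (2 * n + 7) * (1 / (w ^ (2 * n + 7) - 1))
       - k n * (?y ^ (2 * n + 4) / z ^ 3) * (w ^ (2 * n + 4) / (w ^ (2 * n + 4) - 1)) - k n * (?y ^ (2 * n + 5) / z\<^sup>2) * (?p + ?q))"
      by (intro arg_cong[where f = "\<lambda>x. g * x"] arg_cong2[where f = "(-)"])
        (simp_all, simp only: mult_ac)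
    then show ?thesis unfolding 1 coef_def 2 by (simp only: algebra_simps)
  qed
  moreover have "k n * coef w g (2 * n + 4) = E * k (n + 1) - k (n + 2)" for n
    using rec_k[of n] by linarith
  ultimately have s1: "(\<lambda>n. (E * k (n + 1) - k (n + 2)) * ?y ^ (2 * n + 7)) sums ?L" by simp
  have "(\<lambda>n. k (n + 1) * ?y ^ (2 * (n + 1) + 5)) sums (profile z - k 0 * ?y ^ 5)"
    using sums_split_initial_segment[OF profile_high_sums[OF z], of 1] by simp
  moreover have "(\<lambda>n. k (n + 2) * ?y ^ (2 * (n + 2) + 5)) sums (profile z - (k 0 * ?y ^ 5 + k 1 * ?y ^ 7))"
  proof -
    have "{..<2::nat} = {0, 1}" by auto
    then have "(\<Sum>i<2. k i * ?y ^ (2 * i + 5)) = k 0 * ?y ^ 5 + k 1 * ?y ^ 7" by simp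
    then show ?thesis
      using sums_split_initial_segment[OF profile_high_sums[OF z], of 2] by simp
  qed
  ultimately have "(\<lambda>n. E * (k (n + 1) * ?y ^ (2 * (n + 1) + 5)) - z\<^sup>2 * (k (n + 2) * ?y ^ (2 * (n + 2) + 5)))
      sums (E * (profile z - k 0 * ?y ^ 5) - z\<^sup>2 * (profile z - (k 0 * ?y ^ 5 + k 1 * ?y ^ 7)))"
    by (intro sums_diff sums_mult)
  moreover have "E * (k (n + 1) * ?y ^ (2 * (n + 1) + 5)) - z\<^sup>2 * (k (n + 2) * ?y ^ (2 * (n + 2) + 5))
      = (E * k (n + 1) - k (n + 2)) * ?y ^ (2 * n + 7)" for n
  proof -
    have "?y ^ (2 * (n + 2) + 5) = ?y ^ (2 * n + 7) * ?y\<^sup>2" by (simp flip: power_add)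
    then have 1: "z\<^sup>2 * ?y ^ (2 * (n + 2) + 5) = ?y ^ (2 * n + 7)" using z1 by (simp add: power_divide)
    have 2: "2 * (n + 1) + 5 = 2 * n + 7" by simp
    have "E * (k (n + 1) * ?y ^ (2 * (n + 1) + 5)) - z\<^sup>2 * (k (n + 2) * ?y ^ (2 * (n + 2) + 5))
      = E * (k (n + 1) * ?y ^ (2 * (n + 1) + 5)) - k (n + 2) * (z\<^sup>2 * ?y ^ (2 * (n + 2) + 5))" by simp
    then show ?thesis unfolding 1 unfolding 2 by (simp only: algebra_simps)
  qed
  ultimately have "?L = E * (profile z - k 0 * ?y ^ 5) - z\<^sup>2 * (profile z - (k 0 * ?y ^ 5 + k 1 * ?y ^ 7))"
    using s1 sums_unique2 by simp
  also have "\<dots> = E * profile z - z\<^sup>2 * profile z + k 0 / z ^ 3"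
  proof -
    have "z\<^sup>2 * (k 0 * ?y ^ 5) = k 0 / z ^ 3" "z\<^sup>2 * (k 1 * ?y ^ 7) = E * (k 0 * ?y ^ 5)"
      using z1 unfolding rec_k0 by (simp_all add: power_divide eval_nat_numeral)
    then show ?thesis by (simp add: right_diff_distrib distrib_left)
  qed
  finally have L: "?L = E * profile z - z\<^sup>2 * profile z + k 0 / z ^ 3" .
  have "g * ((inner_sum z - profile z * (z / (w - 1))) / z ^ 3 + (outer_sum z - profile z / (z\<^sup>2 * (w\<^sup>2 - 1))))
    = ?L + g * (inner_low w + inner_high w) / z ^ 3"
  proof -
    have cub: "x * (z * y) / z ^ 3 = x * y / z\<^sup>2" for x y
      using z1 by (simp add: power3_eq_cube power2_eq_square)
    have 1: "(inner_sum z - profile z * (z / (w - 1))) / z ^ 3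
        = (inner_low w + inner_high w) / z ^ 3 - inner_high z / z ^ 3 - profile z * ?p / z\<^sup>2"
      using z1 cub[of "profile z" ?p] by (simp add: inner_sum_def diff_divide_distrib)
    have 2: "outer_sum z = outer_high z" using z1 by (simp add: outer_sum_def)
    have 3: "profile z / (z\<^sup>2 * (w\<^sup>2 - 1)) = profile z * ?q / z\<^sup>2"
      by (simp add: mult.commute)
    have 4: "profile z * (?p + ?q) / z\<^sup>2 = profile z * ?p / z\<^sup>2 + profile z * ?q / z\<^sup>2"
      by (simp only: distrib_left add_divide_distrib)
    have 5: "g * (inner_low w + inner_high w) / z ^ 3 = g * ((inner_low w + inner_high w) / z ^ 3)" by simp
    show ?thesis
      unfolding 1 2 3 4 5 by (simp only: distrib_left right_diff_distrib)
  qed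
  moreover have "g * (inner_low w + inner_high w) / z ^ 3 = - k 0 / z ^ 3"
  proof -
    have "g * (inner_low w + inner_high w) = - k 0" using match_high by linarith
    then show ?thesis by (simp only:)
  qed
  ultimately show ?thesis using L by simp
qed

lemma level_equation:
  assumes "z = w powi m"
  shows "g * ((inner_sum z - profile z * (z / (w - 1))) / z ^ 3 + (outer_sum z - profile z / (z\<^sup>2 * (w\<^sup>2 - 1))))
    + z\<^sup>2 * profile z = E * profile z"
  using level_equation_low[of z] level_equation_high[of z] w_powi_pos'[of m] unfolding assms
  by (cases m rule: w_powi_cases) auto

lemma origin_equation:
  "g * (outer_low 1 + (outer_sum 1 - profile 0 / (w\<^sup>2 - 1))) = E * profile 0"
  using match_low by (simp add: profile_0 outer_sum_def algebra_simps)

end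

section \<open>The eigenvalue for large base\<close>

lemma continuous_on_suminf_Weierstrass:
  fixes f :: "nat \<Rightarrow> real \<Rightarrow> real"
  assumes "\<And>n. continuous_on S (f n)" "\<And>n x. x \<in> S \<Longrightarrow> \<bar>f n x\<bar> \<le> M n" "summable M"
  shows "continuous_on S (\<lambda>x. \<Sum>n. f n x)"
proof (rule uniform_limit_theorem)
  show "uniform_limit S (\<lambda>n x. \<Sum>i<n. f i x) (\<lambda>x. \<Sum>n. f n x) sequentially"
    by (rule Weierstrass_m_test) (use assms in auto)
  show "\<forall>\<^sub>F n in sequentially. continuous_on S (\<lambda>x. \<Sum>i<n. f i x)"
    using assms(1) by (intro always_eventually allI continuous_on_sum)
qed simp

text \<open>The bound 1000 is generous; it only has to make the error terms of the determinant smaller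
  than its main part, which is close to 1 at the left end of the interval and to -1 at the right.\<close>

locale large_base =
  fixes w :: real
  assumes w_large: "w \<ge> 1000"
begin

sublocale base_ge_2 w
  by unfold_locales (use w_large in simp)

definition g :: real where "g = (1 - 1 / w) * (1 - w\<^sup>2) / (1 - 1 / w ^ 3)"

text \<open>The common value of the quotients of Gamma factors in the two recursions, with positive
  factors only.\<close>

definition ratio :: "nat \<Rightarrow> real" where
  "ratio j = w\<^sup>2 * (w ^ (j + 2) - 1) * (w ^ (j + 1) - 1) / ((w ^ (j + 3) - 1) * (w ^ j - 1))"

text \<open>The two recursions started with 1. Every solution is a multiple of these, which leaves
  one free factor for each side.\<close>

fun c_seq :: "real \<Rightarrow> nat \<Rightarrow> real" where
  "c_seq E 0 = 1"
| "c_seq E (Suc 0) = 0"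
| "c_seq E (Suc (Suc n)) = (E * c_seq E (Suc n) - c_seq E n) / ratio (2 * n + 2)"

fun k_seq :: "real \<Rightarrow> nat \<Rightarrow> real" where
  "k_seq E 0 = 1"
| "k_seq E (Suc 0) = E"
| "k_seq E (Suc (Suc n)) = E * k_seq E (Suc n) - ratio (2 * n + 4) * k_seq E n"

lemma w_gt: "w > 1" "w > 0" "w \<noteq> 0" "w\<^sup>2 > 1" "w ^ 3 > 1"
  using w_large by (auto simp: one_less_power)

text \<open>Over the common denominator, the numerator of the second factor of \<open>coef\<close> is
  \<open>- (w^3 - 1) (X w\<^sup>2 - 1) (X w - 1)\<close> with \<open>X = w^j\<close>.\<close>

lemma coef_eq_ratio:
  assumes "j > 0"
  shows "coef w g j = ratio j"
proof -
  define X where "X = w ^ j"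
  have X: "X \<ge> 2" unfolding X_def by (rule w_pow_ge_2[OF assms])
  have ne: "X - 1 \<noteq> 0" "X * w ^ 3 - 1 \<noteq> 0" "w - 1 \<noteq> 0" "w\<^sup>2 - 1 \<noteq> 0" "w ^ 3 - 1 \<noteq> 0"
  proof -
    have "2 * 1 \<le> X * w ^ 3" using X w_gt(5) by (intro mult_mono) auto
    then show "X - 1 \<noteq> 0" "X * w ^ 3 - 1 \<noteq> 0" "w - 1 \<noteq> 0" "w\<^sup>2 - 1 \<noteq> 0" "w ^ 3 - 1 \<noteq> 0"
      using X w_gt(1,4,5) by linarith+
  qed
  have "g = (w - 1) * (1 - w\<^sup>2) * w\<^sup>2 / (w ^ 3 - 1)"
  proof -
    have "1 - 1 / w = (w - 1) / w" "1 - 1 / w ^ 3 = (w ^ 3 - 1) / w ^ 3"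
      using w_gt by (simp_all add: field_simps)
    then show ?thesis unfolding g_def using w_gt by (simp add: power3_eq_cube power2_eq_square)
  qed
  moreover have "(w - 1) * (1 - w\<^sup>2) * w\<^sup>2 / (w ^ 3 - 1) * (1 / (X * w ^ 3 - 1) - X / (X - 1) - 1 / (w - 1) - 1 / (w\<^sup>2 - 1))
     = w\<^sup>2 * (X * w\<^sup>2 - 1) * (X * w - 1) / ((X * w ^ 3 - 1) * (X - 1))"
  proof -
    have 1: "1 / (X * w ^ 3 - 1) - X / (X - 1) - 1 / (w - 1) - 1 / (w\<^sup>2 - 1)
      = ((X - 1) * (w - 1) * (w\<^sup>2 - 1) - X * (X * w ^ 3 - 1) * (w - 1) * (w\<^sup>2 - 1)
          - (X * w ^ 3 - 1) * (X - 1) * (w\<^sup>2 - 1) - (X * w ^ 3 - 1) * (X - 1) * (w - 1))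
        / ((X * w ^ 3 - 1) * (X - 1) * (w - 1) * (w\<^sup>2 - 1))" (is "_ = ?A / _")
      using ne by (simp add: diff_frac_eq) algebra
    have 2: "?A = - (w ^ 3 - 1) * (X * w\<^sup>2 - 1) * (X * w - 1)" by algebra
    have 3: "1 - w\<^sup>2 = - (w\<^sup>2 - 1)" by simp
    have cancel: "a * (- b) * W / d * (- d * M * K / (P * Q * a * b)) = W * M * K / (P * Q)"
      if "a \<noteq> 0" "b \<noteq> 0" "d \<noteq> 0" for a b d W M K P Q :: real
      using that by simp
    show ?thesis unfolding 1 2 3 by (rule cancel) (rule ne)+
  qed
  moreover have "w ^ (j + 3) = X * w ^ 3" "w ^ (j + 2) = X * w\<^sup>2" "w ^ (j + 1) = X * w"
    by (simp_all add: X_def power_add power2_eq_square)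
  ultimately show ?thesis unfolding coef_def ratio_def X_def[symmetric] by (simp only:)
qed

text \<open>Apart from the factor \<open>w\<^sup>2\<close>, numerator and denominator differ by \<open>X (w - 1)\<^sup>2 (w + 1)\<close>, which is positive and of lower order
  in \<open>X\<close>.\<close>

lemma ratio_bounds: assumes "j \<ge> 2" shows "w\<^sup>2 \<le> ratio j" "ratio j \<le> 2 * w\<^sup>2"
proof -
  define X where "X = w ^ j"
  have X2: "X \<ge> w\<^sup>2" unfolding X_def using assms w_gt by (intro power_increasing) auto
  have "w * w \<ge> 1000 * w" using w_large w_gt by (intro mult_right_mono) auto
  then have X: "X \<ge> 3" using X2 w_large unfolding power2_eq_square by linarith
  have Xw: "X * w ^ 3 \<ge> 2" using X w_gt mult_mono[of 2 X 1 "w ^ 3"] by simp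
  have D: "(X * w ^ 3 - 1) * (X - 1) > 0" using X Xw by simp
  have r: "ratio j = w\<^sup>2 * (((X * w\<^sup>2 - 1) * (X * w - 1)) / ((X * w ^ 3 - 1) * (X - 1)))"
    unfolding ratio_def X_def power_add by simp
  have d: "(X * w\<^sup>2 - 1) * (X * w - 1) = (X * w ^ 3 - 1) * (X - 1) + X * ((w - 1)\<^sup>2 * (w + 1))"
    by algebra
  have "0 \<le> X * ((w - 1)\<^sup>2 * (w + 1))" using X w_gt by simp
  then have "1 \<le> ((X * w\<^sup>2 - 1) * (X * w - 1)) / ((X * w ^ 3 - 1) * (X - 1))"
    using D d by (simp add: le_divide_eq)
  then show "w\<^sup>2 \<le> ratio j" unfolding r using mult_left_mono[of 1 _ "w\<^sup>2"] by fastforce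
  have "(w - 1)\<^sup>2 * (w + 1) \<le> w ^ 3 - 1"
  proof -
    have "w ^ 3 - 1 - (w - 1)\<^sup>2 * (w + 1) = (w - 1) * (w + 2)" by algebra
    moreover have "(w - 1) * (w + 2) \<ge> 0" using w_gt by simp
    ultimately show ?thesis by linarith
  qed
  then have "X * ((w - 1)\<^sup>2 * (w + 1)) \<le> X * (w ^ 3 - 1)" using X by (intro mult_left_mono) auto
  also have "\<dots> \<le> X * w ^ 3 - 1" using X by (simp add: right_diff_distrib)
  also have "\<dots> \<le> (X * w ^ 3 - 1) * (X - 1)" using X Xw mult_left_mono[of 1 "X - 1" "X * w ^ 3 - 1"] by simp
  finally have "(X * w\<^sup>2 - 1) * (X * w - 1) \<le> 2 * ((X * w ^ 3 - 1) * (X - 1))"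
    using d by linarith
  then have "((X * w\<^sup>2 - 1) * (X * w - 1)) / ((X * w ^ 3 - 1) * (X - 1)) \<le> 2"
    using pos_divide_le_eq[OF D] by blast
  then have "w\<^sup>2 * (((X * w\<^sup>2 - 1) * (X * w - 1)) / ((X * w ^ 3 - 1) * (X - 1))) \<le> w\<^sup>2 * 2"
    by (intro mult_left_mono) auto
  then show "ratio j \<le> 2 * w\<^sup>2" unfolding r by simp
qed

lemma ratio_pos: "j \<ge> 2 \<Longrightarrow> ratio j > 0"
  using ratio_bounds(1)[of j] w_gt by linarith

text \<open>For \<open>0 \<le> E \<le> 3\<close> the recursion is at most \<open>w\<^sup>2 c\<^sub>n\<^sub>+\<^sub>2 = 3 c\<^sub>n\<^sub>+\<^sub>1 + c\<^sub>n\<close> in absolute value, and the second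
  term dominates, so \<open>2/w\<close> is a safe rate where \<open>1/w\<close> is the true one. The rate \<open>2w\<close> for the
  other sequence arises in the same way.\<close>

lemma c_seq_bound:
  assumes E: "0 \<le> E" "E \<le> 3" shows "\<bar>c_seq E n\<bar> \<le> (2 / w) ^ n"
proof (induction n rule: c_seq.induct[of "\<lambda>_ n. \<bar>c_seq E n\<bar> \<le> (2 / w) ^ n" E])
  case (3 F n)
  have "\<bar>E * c_seq E (Suc n) - c_seq E n\<bar> \<le> 3 * (2 / w) ^ Suc n + (2 / w) ^ n"
  proof -
    have "\<bar>E * c_seq E (Suc n)\<bar> \<le> 3 * (2 / w) ^ Suc n"
      unfolding abs_mult using E 3 by (intro mult_mono) auto
    then show ?thesis using 3 by linarith
  qed
  also have "\<dots> \<le> 4 * (2 / w) ^ n"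
  proof -
    have "3 * (2 / w) ^ Suc n = (6 / w) * (2 / w) ^ n" by simp
    also have "\<dots> \<le> 3 * (2 / w) ^ n" using w_large by (intro mult_right_mono) (auto simp: divide_le_eq)
    finally show ?thesis by simp
  qed
  finally have "\<bar>E * c_seq E (Suc n) - c_seq E n\<bar> / ratio (2 * n + 2) \<le> (4 * (2 / w) ^ n) / w\<^sup>2"
    using ratio_bounds(1)[of "2 * n + 2"] w_gt by (intro frac_le) auto
  also have "\<dots> = (2 / w) ^ Suc (Suc n)" by (simp add: power2_eq_square)
  finally show ?case using ratio_pos[of "2 * n + 2"] by simp
qed (use w_gt in auto)

lemma k_seq_bound:
  assumes E: "0 \<le> E" "E \<le> 3" shows "\<bar>k_seq E n\<bar> \<le> (2 * w) ^ n"
proof (induction n rule: k_seq.induct[of "\<lambda>_ n. \<bar>k_seq E n\<bar> \<le> (2 * w) ^ n" E])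
  case (3 F n)
  have "\<bar>E * k_seq E (Suc n)\<bar> \<le> 3 * (2 * w) ^ Suc n"
    unfolding abs_mult using E 3 by (intro mult_mono) auto
  also have "\<dots> \<le> (2 * w\<^sup>2) * (2 * w) ^ n"
  proof -
    have "3 * (2 * w) ^ Suc n = (6 * w) * (2 * w) ^ n" by simp
    also have "\<dots> \<le> (2 * w\<^sup>2) * (2 * w) ^ n"
      using w_large by (intro mult_right_mono) (auto simp: power2_eq_square)
    finally show ?thesis .
  qed
  finally have a: "\<bar>E * k_seq E (Suc n)\<bar> \<le> (2 * w\<^sup>2) * (2 * w) ^ n" .
  have b: "\<bar>ratio (2 * n + 4) * k_seq E n\<bar> \<le> (2 * w\<^sup>2) * (2 * w) ^ n"
    unfolding abs_mult using ratio_bounds(2)[of "2 * n + 4"] ratio_pos[of "2 * n + 4"] 3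
    by (intro mult_mono) auto
  have "\<bar>k_seq E (Suc (Suc n))\<bar> \<le> (2 * w\<^sup>2) * (2 * w) ^ n + (2 * w\<^sup>2) * (2 * w) ^ n"
    using a b unfolding k_seq.simps by linarith
  also have "\<dots> = (2 * w) ^ Suc (Suc n)" by (simp add: power2_eq_square)
  finally show ?case .
qed (use w_gt w_large E in auto)

lemma continuous_c_seq: "continuous_on S (\<lambda>E. c_seq E n)"
proof (induction n rule: c_seq.induct[of "\<lambda>_ n. continuous_on S (\<lambda>E. c_seq E n)"])
  case (3 F n)
  then show ?case unfolding c_seq.simps using ratio_pos[of "2 * n + 2"] by (intro continuous_intros) auto
qed auto

lemma continuous_k_seq: "continuous_on S (\<lambda>E. k_seq E n)"
proof (induction n rule: k_seq.induct[of "\<lambda>_ n. continuous_on S (\<lambda>E. k_seq E n)"])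
  case (3 F n)
  then show ?case unfolding k_seq.simps by (intro continuous_intros) auto
qed (auto intro: continuous_intros)

text \<open>The formal sums for the normalized sequences at the boundary values \<open>w\<close> and 1. Of the outer
  sum over \<open>c_seq\<close>, the first term is split off, because it is as large as the contribution of
  the constant term of the profile.\<close>

definition tau :: "real \<Rightarrow> real" where
  "tau E = w / (w - 1) + (\<Sum>n. c_seq E (n + 2) * (w ^ (2 * n + 5) / (w ^ (2 * n + 5) - 1)))"
definition sigma :: "real \<Rightarrow> real" where
  "sigma E = (\<Sum>n. k_seq E n * ((1 / w) ^ (2 * n + 4) * (w ^ (2 * n + 4) / (w ^ (2 * n + 4) - 1))))"
definition rho :: "real \<Rightarrow> real" where
  "rho E = (\<Sum>n. k_seq E n * (1 / (w ^ (2 * n + 7) - 1)))"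
definition zeta_tail :: "real \<Rightarrow> real" where
  "zeta_tail E = (\<Sum>n. c_seq E (n + 3) * (w ^ (2 * n + 4) / (w ^ (2 * n + 4) - 1)))"
definition zeta :: "real \<Rightarrow> real" where
  "zeta E = 1 / (w\<^sup>2 - 1) + 1 / ratio 2 * (w\<^sup>2 / (w\<^sup>2 - 1)) - zeta_tail E"

lemma geometric_2w: "summable (\<lambda>n. K * (2 / w) ^ n)" "0 \<le> K \<Longrightarrow> (\<Sum>n. K * (2 / w) ^ n) \<le> 2 * K"
proof -
  have "norm (2 / w) < 1" using w_large by simp
  note s = summable_geometric[OF this] suminf_geometric[OF this]
  show "summable (\<lambda>n. K * (2 / w) ^ n)" using s(1) by (rule summable_mult)
  have "(\<Sum>n. (2 / w) ^ n) \<le> 2" unfolding s(2) using w_large by (simp add: field_simps)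
  then show "0 \<le> K \<Longrightarrow> (\<Sum>n. K * (2 / w) ^ n) \<le> 2 * K"
    using suminf_mult[OF s(1), of K] mult_left_mono[of _ 2 K] by fastforce
qed

text \<open>Continuity in \<open>E\<close> and the numerical bounds for all the series come from one geometric
  majorant of ratio \<open>2/w \<le> 1/2\<close>.\<close>

lemma dominated_series:
  fixes f :: "nat \<Rightarrow> real \<Rightarrow> real"
  assumes "\<And>n E. E \<in> {0..3} \<Longrightarrow> \<bar>f n E\<bar> \<le> K * (2 / w) ^ n" "\<And>n. continuous_on {0..3} (f n)" "0 \<le> K"
  shows "continuous_on {0..3} (\<lambda>E. \<Sum>n. f n E)"
    and "E \<in> {0..3} \<Longrightarrow> summable (\<lambda>n. f n E)"
    and "E \<in> {0..3} \<Longrightarrow> \<bar>\<Sum>n. f n E\<bar> \<le> 2 * K"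
proof -
  show "continuous_on {0..3} (\<lambda>E. \<Sum>n. f n E)"
    by (rule continuous_on_suminf_Weierstrass[OF assms(2,1) geometric_2w(1)])
  assume E: "E \<in> {0..3}"
  show "summable (\<lambda>n. f n E)"
    by (rule summable_comparison_test'[OF geometric_2w(1)[of K]]) (use assms(1)[OF E] in simp)
  have "norm (\<Sum>n. f n E) \<le> (\<Sum>n. K * (2 / w) ^ n)"
    by (rule norm_suminf_le[OF _ geometric_2w(1)]) (use assms(1)[OF E] in simp)
  then show "\<bar>\<Sum>n. f n E\<bar> \<le> 2 * K" using geometric_2w(2)[OF assms(3)] by simp
qed

lemma c_seq_term_bound:
  assumes "E \<in> {0..3}" "m > 0"
  shows "\<bar>c_seq E (n + s) * (w ^ m / (w ^ m - 1))\<bar> \<le> (2 * (2 / w) ^ s) * (2 / w) ^ n"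
proof -
  have "\<bar>c_seq E (n + s) * (w ^ m / (w ^ m - 1))\<bar> \<le> (2 / w) ^ (n + s) * 2"
    unfolding abs_mult[of "c_seq E (n + s)"] using c_seq_bound[of E "n + s"] assms(1) w_gt
    by (intro mult_mono quot_bound_abs assms(2)) auto
  then show ?thesis by (simp add: power_add mult_ac)
qed

lemma k_seq_term_bound:
  assumes "E \<in> {0..3}" shows "\<bar>k_seq E n * (a / w ^ (2 * n + s))\<bar> \<le> (\<bar>a\<bar> / w ^ s) * (2 / w) ^ n"
proof -
  have "\<bar>k_seq E n * (a / w ^ (2 * n + s))\<bar> \<le> (2 * w) ^ n * (\<bar>a\<bar> / w ^ (2 * n + s))"
    using k_seq_bound[of E n] assms w_gt unfolding abs_mult abs_divide by (intro mult_mono) auto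
  also have "\<dots> = (\<bar>a\<bar> / w ^ s) * (2 / w) ^ n"
  proof -
    have "w ^ (2 * n + s) = w ^ n * w ^ n * w ^ s" by (simp add: power_add mult_2)
    then show ?thesis using w_gt by (simp add: power_mult_distrib power_divide mult_ac)
  qed
  finally show ?thesis .
qed

lemma sigma_term_bound:
  assumes "E \<in> {0..3}"
  shows "\<bar>k_seq E n * ((1 / w) ^ (2 * n + 4) * (w ^ (2 * n + 4) / (w ^ (2 * n + 4) - 1)))\<bar> \<le> (2 / w ^ 4) * (2 / w) ^ n"
proof -
  let ?a = "w ^ (2 * n + 4) / (w ^ (2 * n + 4) - 1)"
  have "\<bar>k_seq E n * ((1 / w) ^ (2 * n + 4) * ?a)\<bar> = \<bar>k_seq E n * (?a / w ^ (2 * n + 4))\<bar>"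
    by (simp add: power_divide)
  also have "\<dots> \<le> (\<bar>?a\<bar> / w ^ 4) * (2 / w) ^ n" by (rule k_seq_term_bound[OF assms])
  also have "\<dots> \<le> (2 / w ^ 4) * (2 / w) ^ n"
    using w_gt by (intro mult_right_mono divide_right_mono quot_bound_abs) auto
  finally show ?thesis .
qed

lemma rho_term_bound:
  assumes "E \<in> {0..3}" shows "\<bar>k_seq E n * (1 / (w ^ (2 * n + 7) - 1))\<bar> \<le> (2 / w ^ 7) * (2 / w) ^ n"
proof -
  have "\<bar>k_seq E n * (1 / (w ^ (2 * n + 7) - 1))\<bar> \<le> \<bar>k_seq E n * (2 / w ^ (2 * n + 7))\<bar>"
    unfolding abs_mult using inv_bounds[of "2 * n + 7"] by (intro mult_left_mono) linarith+
  also have "\<dots> \<le> (2 / w ^ 7) * (2 / w) ^ n" using k_seq_term_bound[OF assms, of n 2 7] by simp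
  finally show ?thesis .
qed

lemmas cont_intros = continuous_on_mult continuous_on_const continuous_c_seq continuous_k_seq

lemma tau_props: "continuous_on {0..3} tau" "E \<in> {0..3} \<Longrightarrow> \<bar>tau E\<bar> \<le> 4"
  and tau_summable: "E \<in> {0..3} \<Longrightarrow> summable (\<lambda>n. c_seq E (n + 2) * (w ^ (2 * n + 5) / (w ^ (2 * n + 5) - 1)))"
proof -
  have b: "\<bar>c_seq E (n + 2) * (w ^ (2 * n + 5) / (w ^ (2 * n + 5) - 1))\<bar> \<le> (2 * (2 / w) ^ 2) * (2 / w) ^ n"
    if "E \<in> {0..3}" for n E using c_seq_term_bound[OF that, of "2 * n + 5" n 2] by simp
  note d = dominated_series[of "\<lambda>n E. c_seq E (n + 2) * (w ^ (2 * n + 5) / (w ^ (2 * n + 5) - 1))", OF b cont_intros(1)[OF cont_intros(3,2)]]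
  show "continuous_on {0..3} tau" unfolding tau_def by (intro continuous_on_add continuous_on_const d) (use w_gt in simp_all)
  show "E \<in> {0..3} \<Longrightarrow> summable (\<lambda>n. c_seq E (n + 2) * (w ^ (2 * n + 5) / (w ^ (2 * n + 5) - 1)))"
    by (rule d(2)) (use w_gt in simp_all)
  assume E: "E \<in> {0..3}"
  have "(2 / w) ^ 2 \<le> 1 / 2"
  proof -
    have "(2 / w) ^ 2 \<le> (1 / 500) ^ 2" using w_large by (intro power_mono) (auto simp: field_simps)
    then show ?thesis by (simp add: power2_eq_square)
  qed
  moreover have "\<bar>w / (w - 1)\<bar> \<le> 2" using w_large by (simp add: divide_le_eq)
  moreover have "\<bar>\<Sum>n. c_seq E (n + 2) * (w ^ (2 * n + 5) / (w ^ (2 * n + 5) - 1))\<bar> \<le> 2 * (2 * (2 / w) ^ 2)"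
    by (rule d(3)) (use E w_gt in simp_all)
  ultimately show "\<bar>tau E\<bar> \<le> 4" unfolding tau_def by linarith
qed

lemma sigma_props: "continuous_on {0..3} sigma" "E \<in> {0..3} \<Longrightarrow> \<bar>sigma E\<bar> \<le> 4 / w ^ 4"
  and sigma_summable: "E \<in> {0..3} \<Longrightarrow> summable (\<lambda>n. k_seq E n * ((1 / w) ^ (2 * n + 4) * (w ^ (2 * n + 4) / (w ^ (2 * n + 4) - 1))))"
  using dominated_series[of "\<lambda>n E. k_seq E n * ((1 / w) ^ (2 * n + 4) * (w ^ (2 * n + 4) / (w ^ (2 * n + 4) - 1)))",
      OF sigma_term_bound cont_intros(1)[OF cont_intros(4,2)]] w_gt
  unfolding sigma_def by auto

lemma rho_props: "continuous_on {0..3} rho" "E \<in> {0..3} \<Longrightarrow> \<bar>rho E\<bar> \<le> 4 / w ^ 7"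
  and rho_summable: "E \<in> {0..3} \<Longrightarrow> summable (\<lambda>n. k_seq E n * (1 / (w ^ (2 * n + 7) - 1)))"
  using dominated_series[of "\<lambda>n E. k_seq E n * (1 / (w ^ (2 * n + 7) - 1))",
      OF rho_term_bound cont_intros(1)[OF cont_intros(4,2)]] w_gt
  unfolding rho_def by auto

lemma zeta_tail_props: "continuous_on {0..3} zeta_tail" "E \<in> {0..3} \<Longrightarrow> \<bar>zeta_tail E\<bar> \<le> 32 / w ^ 3"
  and zeta_tail_summable: "E \<in> {0..3} \<Longrightarrow> summable (\<lambda>n. c_seq E (n + 3) * (w ^ (2 * n + 4) / (w ^ (2 * n + 4) - 1)))"
proof -
  have b: "\<bar>c_seq E (n + 3) * (w ^ (2 * n + 4) / (w ^ (2 * n + 4) - 1))\<bar> \<le> (2 * (2 / w) ^ 3) * (2 / w) ^ n"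
    if "E \<in> {0..3}" for n E using c_seq_term_bound[OF that, of "2 * n + 4" n 3] by simp
  note d = dominated_series[of "\<lambda>n E. c_seq E (n + 3) * (w ^ (2 * n + 4) / (w ^ (2 * n + 4) - 1))", OF b cont_intros(1)[OF cont_intros(3,2)]]
  show "continuous_on {0..3} zeta_tail" unfolding zeta_tail_def using d(1) w_gt by simp
  show "E \<in> {0..3} \<Longrightarrow> summable (\<lambda>n. c_seq E (n + 3) * (w ^ (2 * n + 4) / (w ^ (2 * n + 4) - 1)))"
    using d(2) w_gt by simp
  show "E \<in> {0..3} \<Longrightarrow> \<bar>zeta_tail E\<bar> \<le> 32 / w ^ 3"
    unfolding zeta_tail_def using d(3) w_gt by (simp add: power_divide)
qed

text \<open>Up to sign, the determinant of the two matching conditions. Inside \<open>a\<close> times \<open>c_seq\<close> and outside \<open>b\<close> times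
  \<open>k_seq\<close> solve both if and only if \<open>g tau a + (1 + g sigma) b = 0\<close> and
  \<open>(- g zeta - E) a + g rho b = 0\<close>.\<close>

definition matching :: "real \<Rightarrow> real" where
  "matching E = (1 + g * sigma E) * (- g * zeta E - E) - g\<^sup>2 * tau E * rho E"

lemma continuous_matching: "continuous_on {0..3} matching"
  unfolding matching_def zeta_def
  by (intro continuous_intros tau_props sigma_props rho_props zeta_tail_props)

text \<open>Up to sign, \<open>g\<close> is \<open>w\<^sup>2 - 1\<close> times the quotient of \<open>1 - 1/w\<close> and \<open>1 - 1/w\<^sup>3\<close>, which is
  close to 1.\<close>

lemma g_bounds: "\<bar>g\<bar> \<le> w\<^sup>2" "1 - 1 / w \<le> - g / (w\<^sup>2 - 1)" "- g / (w\<^sup>2 - 1) \<le> 1"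
proof -
  have a: "0 < 1 - 1 / w ^ 3" "1 - 1 / w ^ 3 \<le> 1" using w_gt by auto
  have "w ^ 1 \<le> w ^ 3" using w_gt by (intro power_increasing) auto
  then have b: "1 / w ^ 3 \<le> 1 / w" using w_gt by (intro divide_left_mono) auto
  have c: "0 \<le> 1 - 1 / w" using w_gt by simp
  have eq: "- g / (w\<^sup>2 - 1) = (1 - 1 / w) / (1 - 1 / w ^ 3)"
  proof -
    have 1: "- g = (1 - 1 / w) / (1 - 1 / w ^ 3) * (w\<^sup>2 - 1)"
    proof -
      have "- (a * (1 - x) / b) = a / b * (x - 1)" for a b x :: real
        by (simp add: algebra_simps diff_divide_distrib)
      then show ?thesis unfolding g_def .
    qed
    have "w\<^sup>2 - 1 \<noteq> 0" using w_gt(4) by linarith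
    then show ?thesis unfolding 1 by (rule nonzero_mult_div_cancel_right)
  qed
  show up: "- g / (w\<^sup>2 - 1) \<le> 1" unfolding eq using a b by (subst divide_le_eq) auto
  have "(1 - 1 / w) / 1 \<le> (1 - 1 / w) / (1 - 1 / w ^ 3)" using a c by (intro divide_left_mono) auto
  then show lo: "1 - 1 / w \<le> - g / (w\<^sup>2 - 1)" unfolding eq by simp
  have "0 \<le> - g / (w\<^sup>2 - 1)" using lo c by linarith
  moreover have pos: "0 < w\<^sup>2 - 1" using w_gt(4) by linarith
  ultimately have "0 * (w\<^sup>2 - 1) \<le> - g" using pos_le_divide_eq[OF pos] by blast
  then have "0 \<le> - g" by simp
  moreover have "- g \<le> 1 * (w\<^sup>2 - 1)" using up unfolding pos_divide_le_eq[OF pos] .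
  ultimately have "0 \<le> - g" "- g \<le> w\<^sup>2 - 1" by simp_all
  then show "\<bar>g\<bar> \<le> w\<^sup>2" by linarith
qed

text \<open>The two summands of \<open>- g zeta\<close> that are close to 1 come from \<open>c\<^sub>0\<close> and from \<open>c\<^sub>4\<close>, the latter being
  about \<open>- c\<^sub>0 / w\<^sup>2\<close>.\<close>

lemma perturbation_bounds:
  assumes E: "E \<in> {0..3}"
  shows "\<bar>g * sigma E\<bar> \<le> 1 / 100" "\<bar>g\<^sup>2 * tau E * rho E\<bar> \<le> 1 / 100"
    "7 / 5 \<le> - g * zeta E" "- g * zeta E \<le> 21 / 10"
proof -
  have w2: "w\<^sup>2 \<ge> 1000000" using power_mono[OF w_large, of 2] by simp
  have w3: "w ^ 3 \<ge> 1000000000" using power_mono[OF w_large, of 3] by simp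
  have "\<bar>g * sigma E\<bar> \<le> w\<^sup>2 * (4 / w ^ 4)"
    unfolding abs_mult using g_bounds(1) sigma_props(2)[OF E] by (intro mult_mono) auto
  also have "\<dots> = 4 / w\<^sup>2" using w_gt by (simp add: eval_nat_numeral)
  also have "\<dots> \<le> 1 / 100" using w2 by (simp add: divide_le_eq)
  finally show "\<bar>g * sigma E\<bar> \<le> 1 / 100" .
  have "\<bar>g\<^sup>2 * tau E * rho E\<bar> \<le> (w\<^sup>2)\<^sup>2 * 4 * (4 / w ^ 7)"
    unfolding abs_mult power_abs using g_bounds(1) tau_props(2)[OF E] rho_props(2)[OF E]
    by (intro mult_mono power_mono) auto
  also have "\<dots> = 16 / w ^ 3" using w_gt by (simp add: eval_nat_numeral)
  also have "\<dots> \<le> 1 / 100" using w3 w_gt by (simp add: divide_le_eq)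
  finally show "\<bar>g\<^sup>2 * tau E * rho E\<bar> \<le> 1 / 100" .
  have "\<bar>g * zeta_tail E\<bar> \<le> w\<^sup>2 * (32 / w ^ 3)"
    unfolding abs_mult using g_bounds(1) zeta_tail_props(2)[OF E] by (intro mult_mono) auto
  also have "\<dots> = 32 / w" using w_gt by (simp add: eval_nat_numeral)
  also have "\<dots> \<le> 32 / 1000" using w_large by (intro divide_left_mono) auto
  finally have t: "\<bar>g * zeta_tail E\<bar> \<le> 32 / 1000" .
  define h where "h = - g / (w\<^sup>2 - 1)"
  define r where "r = w\<^sup>2 / ratio 2"
  have r: "1 / 2 \<le> r" "r \<le> 1"
    using ratio_bounds[of 2] ratio_pos[of 2] unfolding r_def by (auto simp: le_divide_eq divide_le_eq)
  have h: "999 / 1000 \<le> h" "h \<le> 1"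
  proof -
    have "1 / w \<le> 1 / 1000" using w_large by (intro divide_left_mono) auto
    then show "999 / 1000 \<le> h" "h \<le> 1" using g_bounds(2,3) unfolding h_def by linarith+
  qed
  have z: "- g * zeta E = h + h * r + g * zeta_tail E"
    unfolding zeta_def h_def r_def by (simp add: algebra_simps)
  have "999 / 1000 * (1 / 2) \<le> h * r" "h * r \<le> 1 * 1" using h r by (intro mult_mono; simp)+
  then show "7 / 5 \<le> - g * zeta E" "- g * zeta E \<le> 21 / 10" unfolding z using t h by linarith+
qed

lemma ex_matching_zero: "\<exists>E\<in>{1..3}. matching E = 0"
proof -
  have "matching 1 \<ge> 0"
  proof -
    note b = perturbation_bounds[of 1]
    have "99 / 100 * (2 / 5) \<le> (1 + g * sigma 1) * (- g * zeta 1 - 1)"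
      using b by (intro mult_mono) (auto simp: abs_le_iff)
    then show ?thesis using b(2) unfolding matching_def by (simp add: abs_le_iff)
  qed
  moreover have "matching 3 \<le> 0"
  proof -
    note b = perturbation_bounds[of 3]
    have "99 / 100 * (9 / 10) \<le> (1 + g * sigma 3) * (3 - (- g * zeta 3))"
      using b by (intro mult_mono) (auto simp: abs_le_iff)
    moreover have "(1 + g * sigma 3) * (- g * zeta 3 - 3) = - ((1 + g * sigma 3) * (3 - (- g * zeta 3)))"
      by (simp add: algebra_simps)
    ultimately show ?thesis using b(2) unfolding matching_def by (simp add: abs_le_iff)
  qed
  moreover have "continuous_on {1..3} matching"
    by (rule continuous_on_subset[OF continuous_matching]) auto
  ultimately show ?thesis using IVT2'[of matching 3 0 1] by fastforce
qed

text \<open>The factors \<open>a = 1 + g sigma\<close> and \<open>b = - g tau\<close> solve the outer matching condition identically, which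
  leaves the vanishing of the determinant for the inner one. The first factor is close to 1, so
  the solution is not trivial.\<close>

lemma radial_solution_exists:
  "\<exists>E a b. a \<noteq> 0 \<and> radial_solution w (\<lambda>n. a * c_seq E n) (\<lambda>n. b * k_seq E n) E g"
proof -
  obtain E where "E \<in> {1..3}" and zero: "matching E = 0" using ex_matching_zero by blast
  then have E: "E \<in> {0..3}" "0 \<le> E" "E \<le> 3" by auto
  define a where "a = 1 + g * sigma E"
  define b where "b = - g * tau E"
  have "a \<noteq> 0" using perturbation_bounds(1)[OF E(1)] unfolding a_def by (simp add: abs_le_iff)
  have "radial_profile w (\<lambda>n. a * c_seq E n) (\<lambda>n. b * k_seq E n)"
  proof
    show "summable (\<lambda>n. \<bar>a * c_seq E n\<bar>)"
      by (rule summable_comparison_test'[OF geometric_2w(1)[of "\<bar>a\<bar>"]])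
        (use c_seq_bound[OF E(2,3)] in \<open>auto simp: abs_mult intro: mult_left_mono\<close>)
    show "summable (\<lambda>n. \<bar>b * k_seq E n\<bar> / w ^ (2 * n))"
    proof (rule summable_comparison_test'[OF geometric_2w(1)[of "\<bar>b\<bar>"]])
      fix n
      have "norm (\<bar>b * k_seq E n\<bar> / w ^ (2 * n)) = \<bar>b\<bar> * \<bar>k_seq E n * (1 / w ^ (2 * n + 0))\<bar>"
        using w_gt by (simp add: abs_mult)
      also have "\<dots> \<le> \<bar>b\<bar> * (2 / w) ^ n"
        using k_seq_term_bound[OF E(1), of n 1 0] by (intro mult_left_mono) auto
      finally show "norm (\<bar>b * k_seq E n\<bar> / w ^ (2 * n)) \<le> \<bar>b\<bar> * (2 / w) ^ n" .
    qed
  qed simp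
  then interpret radial_profile w "\<lambda>n. a * c_seq E n" "\<lambda>n. b * k_seq E n" .
  have il: "inner_low w = a * tau E"
    unfolding inner_low_def tau_def distrib_left suminf_mult[OF tau_summable[OF E(1)], symmetric]
    by (simp add: mult.assoc)
  have ih: "inner_high w = b * sigma E"
    unfolding inner_high_def sigma_def suminf_mult[OF sigma_summable[OF E(1)], symmetric]
    by (simp add: mult.assoc)
  have oh: "outer_high 1 = b * rho E"
    unfolding outer_high_def rho_def suminf_mult[OF rho_summable[OF E(1)], symmetric]
    by (simp add: mult.assoc)
  have ol: "outer_low 1 = a * (zeta_tail E - 1 / ratio 2 * (w\<^sup>2 / (w\<^sup>2 - 1)))"
  proof -
    let ?f = "\<lambda>n. c_seq E (n + 2) * (w ^ (2 * n + 2) / (w ^ (2 * n + 2) - 1))"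
    have e: "(\<lambda>n. ?f (Suc n)) = (\<lambda>n. c_seq E (n + 3) * (w ^ (2 * n + 4) / (w ^ (2 * n + 4) - 1)))"
    proof
      fix n
      have "Suc n + 2 = n + 3" "2 * Suc n + 2 = 2 * n + 4" by simp_all
      then show "?f (Suc n) = c_seq E (n + 3) * (w ^ (2 * n + 4) / (w ^ (2 * n + 4) - 1))" by (simp only:)
    qed
    have "(\<lambda>n. ?f (Suc n)) sums zeta_tail E"
      unfolding e zeta_tail_def by (rule summable_sums[OF zeta_tail_summable[OF E(1)]])
    then have "?f sums (zeta_tail E + ?f 0)" by (subst (asm) sums_Suc_iff)
    moreover have "?f 0 = - (1 / ratio 2 * (w\<^sup>2 / (w\<^sup>2 - 1)))" by (simp add: numeral_2_eq_2)
    ultimately have "(\<lambda>n. a * ?f n) sums (a * (zeta_tail E - 1 / ratio 2 * (w\<^sup>2 / (w\<^sup>2 - 1))))"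
      using sums_mult[of ?f _ a] by simp
    then show ?thesis unfolding outer_low_def by (subst sums_unique) (simp_all add: mult.assoc)
  qed
  have "radial_solution w (\<lambda>n. a * c_seq E n) (\<lambda>n. b * k_seq E n) E g"
  proof
    fix n
    have "ratio (2 * n + 2) \<noteq> 0" "ratio (2 * n + 4) \<noteq> 0"
      using ratio_pos[of "2 * n + 2"] ratio_pos[of "2 * n + 4"] by auto
    then have r: "c_seq E (n + 2) * ratio (2 * n + 2) = E * c_seq E (n + 1) - c_seq E n"
        "k_seq E n * ratio (2 * n + 4) = E * k_seq E (n + 1) - k_seq E (n + 2)"
      by simp_all
    have "coef w g (2 * n + 2) = ratio (2 * n + 2)" "coef w g (2 * n + 4) = ratio (2 * n + 4)"
      by (rule coef_eq_ratio; simp)+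
    then show "a * c_seq E (n + 2) * coef w g (2 * n + 2) + a * c_seq E n = E * (a * c_seq E (n + 1))"
      "b * k_seq E n * coef w g (2 * n + 4) + b * k_seq E (n + 2) = E * (b * k_seq E (n + 1))"
      by (simp_all only: mult.assoc r) (simp_all add: right_diff_distrib)
  next
    show "b * k_seq E 1 = E * (b * k_seq E 0)" by simp
    show "g * (inner_low w + inner_high w) + b * k_seq E 0 = 0"
      unfolding il ih unfolding a_def b_def by (simp add: algebra_simps)
    have "g * (outer_high 1 - (a / (w\<^sup>2 - 1) - outer_low 1)) = g * (b * rho E - a * zeta E)"
      unfolding oh ol zeta_def by (simp add: algebra_simps)
    also have "\<dots> = matching E + E * a"
      unfolding matching_def a_def b_def by (simp add: algebra_simps power2_eq_square)
    finally show "g * (outer_high 1 - (a * c_seq E 0 / (w\<^sup>2 - 1) - outer_low 1)) = E * (a * c_seq E 0)"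
      using zero by simp
  qed
  then show ?thesis using \<open>a \<noteq> 0\<close> by blast
qed

end

section \<open>Radial solutions on the p-adic numbers\<close>

lemma (in large_base) ratio_Gamma_quotient:
  assumes "j > 0"
  shows "((1 - w ^ (j + 2)) / (1 - 1 / w ^ (j + 3))) / ((1 - w ^ j) / (1 - 1 / w ^ (j + 1))) = ratio j"
    and "((1 - 1 / w ^ (j + 1)) / (1 - w ^ j)) / ((1 - 1 / w ^ (j + 3)) / (1 - w ^ (j + 2))) = ratio j"
proof -
  have inv: "1 - 1 / W = (W - 1) / W" if "W \<ge> 2" for W :: real
    using that by (simp add: diff_divide_distrib)
  have W: "w ^ j \<ge> 2" "w ^ (j + 1) \<ge> 2" "w ^ (j + 2) \<ge> 2" "w ^ (j + 3) \<ge> 2"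
    by (rule w_pow_ge_2; use assms in simp)+
  have c: "w ^ (j + 3) = w ^ (j + 1) * w\<^sup>2" by (simp add: power_add power3_eq_cube power2_eq_square)
  have gen: "((1 - A) / ((C - 1) / C)) / ((1 - B) / ((D - 1) / D)) = (A - 1) * (D - 1) * C / ((C - 1) * (B - 1) * D)"
    if "A \<ge> 2" "B \<ge> 2" "C \<ge> 2" "D \<ge> 2" for A B C D :: real
  proof -
    have "(1 - A) / (1 - B) = (A - 1) / (B - 1)"
      by (metis minus_diff_eq minus_divide_divide)
    moreover have "((1 - A) / ((C - 1) / C)) / ((1 - B) / ((D - 1) / D))
        = (1 - A) / (1 - B) * ((D - 1) * C / ((C - 1) * D))"
      using that by (simp add: mult_ac)
    ultimately show ?thesis by (simp add: mult_ac)
  qed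
  have "(w ^ (j + 2) - 1) * (w ^ (j + 1) - 1) * w ^ (j + 3) / ((w ^ (j + 3) - 1) * (w ^ j - 1) * w ^ (j + 1)) = ratio j"
  proof -
    have "w ^ (j + 1) \<noteq> 0" using w_gt by simp
    then have "x * w ^ (j + 3) / (y * w ^ (j + 1)) = w\<^sup>2 * x / y" for x y
      unfolding c by simp
    then show ?thesis unfolding ratio_def by (simp only: mult.assoc[of "w\<^sup>2"])
  qed
  then show "((1 - w ^ (j + 2)) / (1 - 1 / w ^ (j + 3))) / ((1 - w ^ j) / (1 - 1 / w ^ (j + 1))) = ratio j"
    unfolding inv[OF W(4)] inv[OF W(2)] gen[OF W(3,1,4,2)] .
  then show "((1 - 1 / w ^ (j + 1)) / (1 - w ^ j)) / ((1 - 1 / w ^ (j + 3)) / (1 - w ^ (j + 2))) = ratio j"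
    by (simp add: mult_ac)
qed

lemma (in p_adic) Gamma_p_nat:
  shows "Gamma_p p (real n + 1) = (1 - w ^ n) / (1 - 1 / w ^ (n + 1))"
    and "Gamma_p p (- real n) = (1 - 1 / w ^ (n + 1)) / (1 - w ^ n)"
proof -
  have "w powr (real n + 1 - 1) = w ^ n" using w_gt_1 by (simp add: powr_realpow)
  moreover have "w powr (- (real n + 1)) = 1 / w ^ (n + 1)"
    using powr_minus_divide[of w "real (n + 1)"] powr_realpow[of w "n + 1"] w_gt_1 by (simp add: add.commute)
  moreover have "w powr (- real n - 1) = 1 / w ^ (n + 1)"
  proof -
    have "- real n - 1 = - (real n + 1)" by simp
    then show ?thesis using calculation(2) by (simp only:)
  qed
  moreover have "w powr (- (- real n)) = w ^ n" using w_gt_1 by (simp add: powr_realpow)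
  ultimately show "Gamma_p p (real n + 1) = (1 - w ^ n) / (1 - 1 / w ^ (n + 1))"
    "Gamma_p p (- real n) = (1 - 1 / w ^ (n + 1)) / (1 - w ^ n)"
    unfolding Gamma_p_def by simp_all
qed

locale large_prime = p_adic + large_base "real p"
begin

lemma Gamma_quotients:
  assumes "j > 0"
  shows "Gamma_p p (real j + 3) / Gamma_p p (real j + 1) = ratio j"
    and "Gamma_p p (- real j) / Gamma_p p (- real j - 2) = ratio j"
  using ratio_Gamma_quotient[OF assms] Gamma_p_nat[of j] Gamma_p_nat[of "j + 2"]
  by (simp_all add: add.commute numeral_eq_Suc)

lemma g_eq: "g = (1 - 1 / w) * (1 / Gamma_p p (- 2))"
  using Gamma_p_nat(2)[of 2] by (simp add: g_def numeral_eq_Suc)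

lemma radial_solution_is_solution:
  assumes sol: "radial_solution w c k E g"
    and psi: "\<And>x. x \<in> Qp p \<Longrightarrow> \<psi> x = complex_of_real (radial_profile.profile c k (norm_p x))"
  shows "is_solution p 1 E \<psi>"
proof -
  interpret radial_solution w c k E g by (rule sol)
  let ?F = "\<lambda>x. complex_of_real (profile (norm_p x))"
  have D: "integrable haar (D_integrand p 2 \<psi> x) \<and>
      D_padic p 2 \<psi> x = complex_of_real (g * S)"
    if x: "x \<in> Qp p"
      and I: "integrable haar (D_integrand p 2 ?F x) \<and> integral\<^sup>L haar (D_integrand p 2 ?F x) = complex_of_real ((1 - 1 / w) * S)"
    for x S
  proof -
    have eq: "D_integrand p 2 \<psi> x y = D_integrand p 2 ?F x y" if "y \<in> space haar" for y
      using psi[OF x] psi[of y] that by (simp add: D_integrand_def space_haar)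
    have "integrable haar (D_integrand p 2 \<psi> x)"
      using I eq by (subst Bochner_Integration.integrable_cong[OF refl eq]) auto
    moreover have "integral\<^sup>L haar (D_integrand p 2 \<psi> x) = complex_of_real ((1 - 1 / w) * S)"
      using I eq by (subst Bochner_Integration.integral_cong[OF refl eq]) auto
    ultimately show ?thesis unfolding D_padic_def g_eq by simp
  qed
  show ?thesis
    unfolding is_solution_def
  proof (intro ballI)
    fix x assume x: "x \<in> Qp p"
    show "integrable haar (D_integrand p 2 \<psi> x) \<and>
      D_padic p 2 \<psi> x + complex_of_real (1 * (norm_p x)\<^sup>2) * \<psi> x = complex_of_real E * \<psi> x"
    proof (cases "norm_p x = 0")
      case True
      then have x0: "x = iota 0" using norm_eq_0_iff[OF x] by simp
      have R: "(\<lambda>i. profile (w ^ Suc i) / (w ^ Suc i)\<^sup>2) sums outer_sum 1"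
        using outer_sum_sums[of 1 0] by simp
      note * = D[OF x D_integral_zero[OF origin_sums(2,1) profile_bound R, folded x0]]
      have "D_padic p 2 \<psi> x = complex_of_real (E * profile 0)"
        using * unfolding origin_equation by simp
      then show ?thesis using * psi[OF x] True by simp
    next
      case False
      then obtain m where m: "norm_p x = w powi m" using norm_values[OF x] by blast
      let ?z = "w powi m"
      note * = D[OF x D_integral_nonzero[OF x m profile_bound refl inner_sum_sums[OF refl] outer_sum_sums[OF refl]]]
      have "D_padic p 2 \<psi> x + complex_of_real (?z\<^sup>2 * profile ?z) = complex_of_real (E * profile ?z)"
        unfolding level_equation[OF refl, of m, symmetric] of_real_add using * by simp
      then show ?thesis using * psi[OF x] unfolding m by simp
    qed
  qed
qed

end

text \<open>The profile in terms of the sequences indexed by all exponents, whose missing terms are zero: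
  odd exponents inside, and even ones together with 1 and 3 outside.\<close>

lemma (in radial_profile) profile_interleaved:
  assumes cc: "\<And>n. cc (2 * n) = c n" "\<And>n. cc (2 * n + 1) = 0"
    and kk: "\<And>n. kk (2 * n + 5) = k n" "kk 1 = 0" "kk 3 = 0" "\<And>n. n \<ge> 1 \<Longrightarrow> kk (2 * n) = 0"
  shows "0 \<le> z \<Longrightarrow> z \<le> 1 \<Longrightarrow> (\<lambda>n. cc n * z ^ n) sums profile z"
    and "w \<le> z \<Longrightarrow> (\<lambda>n. kk (Suc n) * z powi (- int (Suc n))) sums profile z"
proof -
  assume z: "0 \<le> z" "z \<le> 1"
  have "(\<lambda>n. cc (2 * n) * z ^ (2 * n)) sums profile z"
    unfolding cc(1) by (rule profile_low_sums[OF z])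
  moreover have "strict_mono (\<lambda>n::nat. 2 * n)" by (rule strict_monoI) simp
  moreover have "cc n * z ^ n = 0" if "n \<notin> range (\<lambda>n::nat. 2 * n)" for n
  proof -
    have "odd n" using that by (auto simp: image_iff elim: evenE)
    then show ?thesis using cc(2) by (auto elim: oddE)
  qed
  ultimately show "(\<lambda>n. cc n * z ^ n) sums profile z"
    using sums_mono_reindex[of "\<lambda>n. 2 * n" "\<lambda>n. cc n * z ^ n"] by blast
next
  assume z: "w \<le> z"
  have "(\<lambda>n. kk (Suc (2 * n + 4)) * z powi (- int (Suc (2 * n + 4)))) sums profile z"
  proof -
    have 5: "Suc (2 * n + 4) = 2 * n + 5" for n by simp
    show ?thesis
      unfolding 5 kk(1) power_int_minus_divide power_int_of_nat
      using profile_high_sums[OF z] unfolding power_divide power_one .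
  qed
  moreover have "strict_mono (\<lambda>n::nat. 2 * n + 4)" by (rule strict_monoI) simp
  moreover have "kk (Suc n) * z powi (- int (Suc n)) = 0" if n: "n \<notin> range (\<lambda>n::nat. 2 * n + 4)" for n
  proof -
    have "kk (Suc n) = 0"
    proof (cases "even n")
      case True
      then obtain i where i: "n = 2 * i" by (rule evenE)
      have "i < 2"
      proof (rule ccontr)
        assume "\<not> i < 2"
        then have "n = 2 * (i - 2) + 4" using i by simp
        then show False using n by blast
      qed
      then have "i = 0 \<or> i = 1" by auto
      then show ?thesis using kk(2,3) i by (auto simp: numeral_eq_Suc)
    next
      case False
      then obtain i where "n = 2 * i + 1" by (rule oddE)
      then show ?thesis using kk(4)[of "i + 1"] by simp
    qed
    then show ?thesis by simp
  qed
  ultimately show "(\<lambda>n. kk (Suc n) * z powi (- int (Suc n))) sums profile z"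
    using sums_mono_reindex[of "\<lambda>n. 2 * n + 4" "\<lambda>n. kk (Suc n) * z powi (- int (Suc n))"] by blast
qed

context large_prime begin

text \<open>The value group has a gap between 1 and \<open>p\<close>, which is where the two series meet.\<close>

lemma norm_outside_Zp:
  assumes "x \<in> Qp p" "x \<notin> Zp p" shows "w \<le> norm_p x"
proof -
  have gt: "1 < norm_p x" using assms by (simp add: Zp_def)
  then obtain m where m: "norm_p x = w powi m" using norm_values[OF assms(1)] by force
  then have "w powi 0 < w powi m" using gt by simp
  then have "w powi 1 \<le> w powi m" by (subst w_powi_le_iff) (simp only: w_powi_less_iff)
  then show ?thesis using m by simp
qed

lemma ground_state:
  "\<exists>E c0 k5 :: real. (c0 \<noteq> 0 \<or> k5 \<noteq> 0) \<and>
      (\<exists>c k :: nat \<Rightarrow> real.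
         c_recursion p 1 E c0 c \<and> k_recursion p 1 E k5 k \<and>
         (\<forall>x\<in>Zp p. summable (\<lambda>n. c n * padic_norm p x ^ n)) \<and>
         (\<forall>x\<in>Qp p - Zp p. summable (\<lambda>n. k (Suc n) * padic_norm p x powi (- int (Suc n)))) \<and>
         is_solution p 1 E (\<lambda>x. complex_of_real (psi0 p c k x)))"
proof -
  obtain E a b where a: "a \<noteq> 0" and sol: "radial_solution w (\<lambda>n. a * c_seq E n) (\<lambda>n. b * k_seq E n) E g"
    using radial_solution_exists by blast
  interpret radial_solution w "\<lambda>n. a * c_seq E n" "\<lambda>n. b * k_seq E n" E g by (rule sol)
  define c where "c = (\<lambda>n. if even n then a * c_seq E (n div 2) else 0)"
  define k where "k = (\<lambda>n. if odd n \<and> n \<ge> 5 then b * k_seq E ((n - 5) div 2) else 0)"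
  have c: "c (2 * n) = a * c_seq E n" "c (2 * n + 1) = 0" for n by (simp_all add: c_def)
  have k: "k (2 * n + 5) = b * k_seq E n" "k 1 = 0" "k 3 = 0" "k (2 * n) = 0" for n by (simp_all add: k_def)
  have c_rec: "c_recursion p 1 E a c"
    unfolding c_recursion_def
  proof (intro conjI allI)
    show "c 0 = a" "c 2 = 0" using c(1)[of 0] c(1)[of 1] by simp_all
    fix n
    show "c (2 * n + 1) = 0" by (rule c)
    have r: "Gamma_p p (2 * real n + 5) / Gamma_p p (2 * real n + 3) = ratio (2 * n + 2)"
      using Gamma_quotients(1)[of "2 * n + 2"] by (simp add: add.commute)
    have i: "2 * n + 4 = 2 * (n + 2)" "2 * n + 2 = 2 * (n + 1)" by simp_all
    have e: "c (2 * n + 4) = a * c_seq E (n + 2)" "c (2 * n + 2) = a * c_seq E (n + 1)"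
      unfolding i by (rule c(1))+
    show "c (2 * n + 4) * (Gamma_p p (2 * real n + 5) / Gamma_p p (2 * real n + 3)) + 1 * c (2 * n) = E * c (2 * n + 2)"
      unfolding r e c(1) using rec_c[of n] coef_eq_ratio[of "2 * n + 2"] by simp
  qed
  have k_rec: "k_recursion p 1 E b k"
    unfolding k_recursion_def
  proof (intro conjI allI impI)
    show "k 5 = b" using k(1)[of 0] by simp
    show "k 1 = 0" "k 3 = 0" by (rule k)+
    fix n :: nat
    show "k (2 * n) = 0" by (rule k)
    assume n: "1 \<le> n"
    have r: "Gamma_p p (- 2 * real n) / Gamma_p p (- 2 * real n - 2) = ratio (2 * n)"
      using Gamma_quotients(2)[of "2 * n"] n by simp
    show "k (2 * n + 1) * (Gamma_p p (- 2 * real n) / Gamma_p p (- 2 * real n - 2)) + 1 * k (2 * n + 5) = E * k (2 * n + 3)"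
    proof (cases "n = 1")
      case True
      then show ?thesis using k(1)[of 0] k(1)[of 1] k(3) by simp
    next
      case False
      define i where "i = n - 2"
      have i: "n = i + 2" using n False by (simp add: i_def)
      have e: "2 * n + 1 = 2 * i + 5" "2 * n + 3 = 2 * (i + 1) + 5" "2 * n + 5 = 2 * (i + 2) + 5" "2 * n = 2 * i + 4"
        by (simp_all add: i)
      show ?thesis
        unfolding r unfolding e(1-3) unfolding e(4) k(1) using rec_k[of i] coef_eq_ratio[of "2 * i + 4"] by simp
    qed
  qed
  note sums = profile_interleaved[of c k, OF c k(1,2,3,4)]
  have low: "(\<lambda>n. c n * norm_p x ^ n) sums profile (norm_p x)" if "x \<in> Zp p" for x
    using that norm_nonneg[of x] by (intro sums(1)) (auto simp: Zp_def)
  have high: "(\<lambda>n. k (Suc n) * norm_p x powi (- int (Suc n))) sums profile (norm_p x)" if "x \<in> Qp p - Zp p" for x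
    using that norm_outside_Zp[of x] by (intro sums(2)) auto
  have psi: "psi0 p c k x = profile (norm_p x)" if "x \<in> Qp p" for x
  proof (cases "x \<in> Zp p")
    case True
    then show ?thesis
      using sums_unique[OF low[OF True]] by (simp add: psi0_def f_fun_def g_fun_def)
  next
    case False
    then show ?thesis
      using sums_unique[OF high[of x]] that by (simp add: psi0_def f_fun_def g_fun_def)
  qed
  have "is_solution p 1 E (\<lambda>x. complex_of_real (psi0 p c k x))"
    by (rule radial_solution_is_solution[OF sol]) (simp add: psi)
  then show ?thesis
    using a c_rec k_rec low high sums_summable by blast
qed

end

theorem theorem18:
  shows "\<exists>P::nat. \<forall>p::nat. prime p \<and> p \<ge> P \<longrightarrow>
    (\<exists>E c0 k5 :: real. (c0 \<noteq> 0 \<or> k5 \<noteq> 0) \<and>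
      (\<exists>c k :: nat \<Rightarrow> real.
         c_recursion p 1 E c0 c \<and> k_recursion p 1 E k5 k \<and>
         (\<forall>x\<in>Zp p. summable (\<lambda>n. c n * padic_norm p x ^ n)) \<and>
         (\<forall>x\<in>Qp p - Zp p. summable (\<lambda>n. k (Suc n) * padic_norm p x powi (- int (Suc n)))) \<and>
         is_solution p 1 E (\<lambda>x. complex_of_real (psi0 p c k x))))"
proof (rule exI[of _ 1000], intro allI impI)
  fix p :: nat assume p: "prime p \<and> p \<ge> 1000"
  then interpret large_prime p by unfold_locales auto
  show "\<exists>E c0 k5 :: real. (c0 \<noteq> 0 \<or> k5 \<noteq> 0) \<and>
      (\<exists>c k :: nat \<Rightarrow> real.
         c_recursion p 1 E c0 c \<and> k_recursion p 1 E k5 k \<and>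
         (\<forall>x\<in>Zp p. summable (\<lambda>n. c n * padic_norm p x ^ n)) \<and>
         (\<forall>x\<in>Qp p - Zp p. summable (\<lambda>n. k (Suc n) * padic_norm p x powi (- int (Suc n)))) \<and>
         is_solution p 1 E (\<lambda>x. complex_of_real (psi0 p c k x)))"
    by (rule ground_state)
qed

end
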